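(* For each $n\ge2$ let $d=d_n\ge2$, $\mathbf{y}\in\{\pm1\}^n$, $\boldsymbol\mu\in\mathbb{R}^d$ be deterministic, and $\mathbf{x}_i=y_i\boldsymbol\mu+\mathbf{z}_i$ with $\mathbf{z}_i$ i.i.d. $N(\mathbf{0},\mathbf{I}_d)$. Let $\mathrm{SNR}=\|\boldsymbol\mu\|_2^4/(\|\boldsymbol\mu\|_2^2+d/n)$ and suppose $n\to\infty$, $\mathrm{SNR}\to\infty$ and $\mathrm{SNR}\le C'\log n$ for some constant $C'$. Let $\mathbf{G}=\mathcal{H}(\mathbf{X}\mathbf{X}^\top)$, $\mathbf{u}_1$ a leading unit eigenvector of $\mathbf{G}$, $\bar{\mathbf{u}}_1=\mathbf{y}/\sqrt n$, $\bar\lambda_1=n\|\boldsymbol\mu\|_2^2$. Then there exist a deterministic sequence $\varepsilon_n\to0$ and positive constants $C,N$ such that for all $n\ge N$, $\mathbb{P}\big(\min_{s=\pm1}\|s\mathbf{u}_1-\mathbf{G}\bar{\mathbf{u}}_1/\bar\lambda_1\|_{\mathrm{SNR}}<\varepsilon_n\|\bar{\mathbf{u}}_1\|_{\mathrm{SNR}}\big)>1-Ce^{-\mathrm{SNR}}$.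
   Context: $\mathbf{X}=(\mathbf{x}_1,\dots,\mathbf{x}_n)^\top$; $\mathcal{H}$ zeroes the diagonal of a square matrix; $\|\cdot\|_q$ is the vector $\ell_q$ norm with $q=\mathrm{SNR}$. *)

theory Defs
  imports "HOL-Probability.Probability"
begin

text \<open>Vectors in R^m are functions nat => real, only the coordinates i < m matter;
  n x n matrices are functions nat => nat => real, only entries i,j < n matter.\<close>

definition sqnorm :: "nat \<Rightarrow> (nat \<Rightarrow> real) \<Rightarrow> real" where
  "sqnorm m v = (\<Sum>i<m. (v i)\<^sup>2)"

definition lq_norm :: "real \<Rightarrow> nat \<Rightarrow> (nat \<Rightarrow> real) \<Rightarrow> real" where
  "lq_norm q m v = (\<Sum>i<m. \<bar>v i\<bar> powr q) powr (1 / q)"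

definition mat_vec :: "nat \<Rightarrow> (nat \<Rightarrow> nat \<Rightarrow> real) \<Rightarrow> (nat \<Rightarrow> real) \<Rightarrow> (nat \<Rightarrow> real)" where
  "mat_vec m A v = (\<lambda>i. \<Sum>j<m. A i j * v j)"

definition is_eigenpair :: "nat \<Rightarrow> (nat \<Rightarrow> nat \<Rightarrow> real) \<Rightarrow> real \<Rightarrow> (nat \<Rightarrow> real) \<Rightarrow> bool" where
  "is_eigenpair m A lam v \<longleftrightarrow> (\<exists>i<m. v i \<noteq> 0) \<and> (\<forall>i<m. mat_vec m A v i = lam * v i)"

definition is_leading_unit_eigvec :: "nat \<Rightarrow> (nat \<Rightarrow> nat \<Rightarrow> real) \<Rightarrow> (nat \<Rightarrow> real) \<Rightarrow> bool" where
  "is_leading_unit_eigvec m A u \<longleftrightarrow> sqnorm m u = 1 \<and>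
     (\<exists>lam. is_eigenpair m A lam u \<and> (\<forall>lam' v. is_eigenpair m A lam' v \<longrightarrow> lam' \<le> lam))"

definition hollow :: "(nat \<Rightarrow> nat \<Rightarrow> real) \<Rightarrow> (nat \<Rightarrow> nat \<Rightarrow> real)" where
  "hollow A = (\<lambda>i j. if i = j then 0 else A i j)"

definition gram :: "nat \<Rightarrow> (nat \<Rightarrow> nat \<Rightarrow> real) \<Rightarrow> (nat \<Rightarrow> nat \<Rightarrow> real)" where
  "gram d X = (\<lambda>i j. \<Sum>k<d. X i k * X j k)"

definition noise_space :: "nat \<Rightarrow> nat \<Rightarrow> (nat \<times> nat \<Rightarrow> real) measure" where
  "noise_space n d = PiM ({..<n} \<times> {..<d}) (\<lambda>_. std_normal_distribution)"

definition data_mat :: "(nat \<Rightarrow> real) \<Rightarrow> (nat \<Rightarrow> real) \<Rightarrow> (nat \<times> nat \<Rightarrow> real) \<Rightarrow> (nat \<Rightarrow> nat \<Rightarrow> real)" where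
  "data_mat y mu z = (\<lambda>i k. y i * mu k + z (i, k))"

definition SNR :: "nat \<Rightarrow> nat \<Rightarrow> (nat \<Rightarrow> real) \<Rightarrow> real" where
  "SNR n d mu = (sqnorm d mu)\<^sup>2 / (sqnorm d mu + real d / real n)"

end

theory Submission
  imports Defs
begin

text \<open>
  Write \<open>M = G / lbar\<close> and \<open>ub\<close> for the unit vector \<open>y / sqrt n\<close>. With probability at least
  \<open>1 - C exp (- n)\<close> the matrix \<open>M\<close> is within \<open>\<delta> = O(1 / sqrt SNR)\<close> of \<open>ub ub\<^sup>T\<close> in operator norm, by a
  chi-square tail bound and a union bound over lattice points. For such matrices the normalised power step
  \<open>v \<mapsto> M v / \<langle>ub, M v\<rangle>\<close> is a contraction near \<open>ub\<close>, and its fixed point is the leading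
  eigenvector.

  For coordinate \<open>i\<close>, iterate the same map for \<open>M\<close> with row and column \<open>i\<close> removed. The result \<open>v\<close> is
  independent of the \<open>i\<close>-th sample, and the contraction bounds the \<open>i\<close>-th error by a multiple of
  \<open>|M\<^sub>i (v - ub)| + \<delta> |M\<^sub>i ub| + \<delta> / sqrt n\<close>. Given the other samples, both row terms are Gaussian, with mean
  and \<open>sqrt SNR\<close> times standard deviation of order \<open>\<delta> / sqrt n\<close> and \<open>1 / sqrt n\<close>. Their moments of order
  \<open>q = SNR\<close> are therefore of the right size, and Markov's inequality for the sum over \<open>i\<close> costs only the
  factor \<open>e\<close> in the norm for a failure probability of \<open>exp (- q)\<close>.
\<close>

subsection \<open>Operator norm bounds in coordinates\<close>

text \<open>On the hyperplane of vectors with inner product 1 with \<open>ub\<close>, the rank-one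
  parts of \<open>M v\<close> and \<open>M w\<close> coincide. Differences of power steps therefore
  see only the small remainder of \<open>M\<close>, and this is why the step contracts. Conditioning
  on the operator norm bound would spoil the Gaussian law of the \<open>i\<close>-th sample, because
  that bound involves all samples. The row moments are truncated instead by conditions on the other
  samples alone; the operator norm bound, together with a bound on the noise along the mean, implies
  these conditions, so on that event the truncation is void. A union bound over \<open>i\<close>
  would cost a factor \<open>n\<close> in the failure probability, whereas a sum of
  \<open>q\<close>-th powers costs only \<open>n powr (1 / q)\<close> in the norm, a factor that the
  norm of \<open>ub\<close> carries as well. Factors exponential in \<open>q\<close> become
  constants under the \<open>q\<close>-th root. The bound on SNR enters as \<open>q \<le> n\<close>,
  which turns \<open>exp (- n)\<close> into \<open>exp (- q)\<close>. The resulting rate is a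
  constant times \<open>1 / sqrt SNR\<close>.\<close>

abbreviation nrm :: "nat \<Rightarrow> (nat \<Rightarrow> real) \<Rightarrow> real" where
  "nrm n v \<equiv> L2_set v {..<n}"

definition inn :: "nat \<Rightarrow> (nat \<Rightarrow> real) \<Rightarrow> (nat \<Rightarrow> real) \<Rightarrow> real" where
  "inn n v w = (\<Sum>i<n. v i * w i)"

text \<open>The bilinear form needs no supremum: rank-one terms, diagonals and zeroed coordinates
  are then handled by Cauchy-Schwarz alone.\<close>

definition opb :: "nat \<Rightarrow> (nat \<Rightarrow> nat \<Rightarrow> real) \<Rightarrow> real \<Rightarrow> bool" where
  "opb n A b \<longleftrightarrow> (\<forall>w v. \<bar>inn n w (mat_vec n A v)\<bar> \<le> b * nrm n w * nrm n v)"

lemma nrm_sq: "(nrm n v)\<^sup>2 = sqnorm n v"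
  by (simp add: L2_set_def sqnorm_def sum_nonneg)

lemma inn_self: "inn n v v = (nrm n v)\<^sup>2"
  unfolding nrm_sq by (simp add: inn_def sqnorm_def power2_eq_square)

lemma inn_commute: "inn n v w = inn n w v"
  by (simp add: inn_def mult.commute)

lemma inn_add_left: "inn n (\<lambda>i. v i + w i) x = inn n v x + inn n w x"
  by (simp add: inn_def distrib_right sum.distrib)

lemma inn_diff_left: "inn n (\<lambda>i. v i - w i) x = inn n v x - inn n w x"
  by (simp add: inn_def left_diff_distrib sum_subtractf)

lemma inn_scale_left: "inn n (\<lambda>i. c * v i) x = c * inn n v x"
  by (simp add: inn_def sum_distrib_left mult.assoc)

lemma inn_add_right: "inn n x (\<lambda>i. v i + w i) = inn n x v + inn n x w"
  by (simp add: inn_def distrib_left sum.distrib)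

lemma inn_diff_right: "inn n x (\<lambda>i. v i - w i) = inn n x v - inn n x w"
  by (simp add: inn_def right_diff_distrib sum_subtractf)

lemma inn_scale_right: "inn n x (\<lambda>i. c * v i) = c * inn n x v"
  by (simp add: inn_commute[of n x] inn_scale_left)

lemma inn_divide_right: "inn n x (\<lambda>i. v i / c) = inn n x v / c"
  using inn_scale_right[of n x "1 / c" v] by simp

lemma inn_cong: "(\<And>i. i < n \<Longrightarrow> v i = v' i) \<Longrightarrow> (\<And>i. i < n \<Longrightarrow> w i = w' i) \<Longrightarrow> inn n v w = inn n v' w'"
  unfolding inn_def by (intro sum.cong) auto

lemma nrm_cong: "(\<And>i. i < n \<Longrightarrow> v i = w i) \<Longrightarrow> nrm n v = nrm n w"
  by (intro L2_set_cong) auto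

lemma inn_le_nrm: "\<bar>inn n v w\<bar> \<le> nrm n v * nrm n w"
proof -
  have "\<bar>inn n v w\<bar> \<le> (\<Sum>i<n. \<bar>v i\<bar> * \<bar>w i\<bar>)"
    unfolding inn_def by (rule order_trans[OF sum_abs]) (simp add: abs_mult)
  also have "\<dots> \<le> nrm n v * nrm n w" by (rule L2_set_mult_ineq)
  finally show ?thesis .
qed

lemma nrm_scale: "nrm n (\<lambda>i. c * v i :: real) = \<bar>c\<bar> * nrm n v"
  by (simp add: L2_set_def power_mult_distrib sum_distrib_left[symmetric] real_sqrt_mult)

lemma nrm_divide: "nrm n (\<lambda>i. v i / c) = nrm n v / \<bar>c\<bar>"
  using nrm_scale[where c = "1 / c" and v = v and n = n] by simp

lemma nrm_minus: "nrm n (\<lambda>i. - v i) = nrm n v"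
  by (simp add: L2_set_def)

lemma nrm_diff_le: "nrm n (\<lambda>i. v i - w i) \<le> nrm n v + nrm n w"
  using L2_set_triangle_ineq[of v "\<lambda>i. - w i" "{..<n}"] by (simp add: nrm_minus)

lemma nrm_diff_commute: "nrm n (\<lambda>i. v i - w i) = nrm n (\<lambda>i. w i - v i)"
  by (simp add: L2_set_def power2_commute)

lemma nrm_triangle3: "nrm n (\<lambda>i. v i - x i) \<le> nrm n (\<lambda>i. v i - w i) + nrm n (\<lambda>i. w i - x i)"
  using L2_set_triangle_ineq[of "\<lambda>i. v i - w i" "\<lambda>i. w i - x i" "{..<n}"] by simp

lemma nrm_ge_diff: "nrm n v - nrm n w \<le> nrm n (\<lambda>i. v i - w i)"
  using L2_set_triangle_ineq[of "\<lambda>i. v i - w i" w "{..<n}"] by simp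

lemma component_le_nrm: "i < n \<Longrightarrow> \<bar>v i\<bar> \<le> nrm n v"
  using member_le_L2_set[of "{..<n}" i "\<lambda>i. \<bar>v i\<bar>"] by (simp add: L2_set_def)

lemma mat_vec_diff: "mat_vec n A (\<lambda>i. v i - w i) = (\<lambda>i. mat_vec n A v i - mat_vec n A w i)"
  by (simp add: mat_vec_def right_diff_distrib sum_subtractf)

lemma mat_vec_add: "mat_vec n A (\<lambda>i. v i + w i) = (\<lambda>i. mat_vec n A v i + mat_vec n A w i)"
  by (simp add: mat_vec_def distrib_left sum.distrib)

lemma mat_vec_scale: "mat_vec n A (\<lambda>i. c * v i) = (\<lambda>i. c * mat_vec n A v i)"
  by (simp add: mat_vec_def sum_distrib_left mult.left_commute)

lemma mat_vec_cong: "(\<And>j. j < n \<Longrightarrow> v j = w j) \<Longrightarrow> mat_vec n A v = mat_vec n A w"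
  unfolding mat_vec_def by (intro ext sum.cong) auto

lemma mat_vec_eq_inn: "mat_vec n A v i = inn n (A i) v"
  by (simp add: mat_vec_def inn_def)

lemma mat_vec_rank_one: "mat_vec n (\<lambda>i j. a i * b j) v = (\<lambda>i. a i * inn n b v)"
  by (simp add: mat_vec_def inn_def sum_distrib_left mult.assoc)

lemma mat_vec_mat_add: "mat_vec n (\<lambda>i j. A i j + B i j) v = (\<lambda>i. mat_vec n A v i + mat_vec n B v i)"
  by (simp add: mat_vec_def distrib_right sum.distrib)

lemma mat_vec_mat_diff: "mat_vec n (\<lambda>i j. A i j - B i j) v = (\<lambda>i. mat_vec n A v i - mat_vec n B v i)"
  by (simp add: mat_vec_def left_diff_distrib sum_subtractf)

lemma mat_vec_mat_divide: "mat_vec n (\<lambda>i j. A i j / c) v = (\<lambda>i. mat_vec n A v i / c)"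
  by (simp add: mat_vec_def sum_divide_distrib)

lemma opbI: "(\<And>w v. \<bar>inn n w (mat_vec n A v)\<bar> \<le> b * nrm n w * nrm n v) \<Longrightarrow> opb n A b"
  by (simp add: opb_def)

lemma opb_inn: "opb n A b \<Longrightarrow> \<bar>inn n w (mat_vec n A v)\<bar> \<le> b * nrm n w * nrm n v"
  by (simp add: opb_def)

text \<open>Take \<open>w\<close> to be \<open>A v\<close> itself and cancel one factor of its
  norm.\<close>

lemma opb_nrm:
  assumes "opb n A b" "0 \<le> b"
  shows "nrm n (mat_vec n A v) \<le> b * nrm n v"
proof -
  let ?w = "mat_vec n A v"
  have *: "nrm n ?w * nrm n ?w \<le> (b * nrm n v) * nrm n ?w"
    using opb_inn[OF assms(1), of ?w v] by (simp add: inn_self power2_eq_square algebra_simps)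
  show ?thesis
  proof (cases "nrm n ?w = 0")
    case True
    then show ?thesis using assms(2) by simp
  next
    case False
    then have "0 < nrm n ?w" by (metis L2_set_nonneg less_eq_real_def)
    then show ?thesis using * by simp
  qed
qed

lemma opb_mono: "opb n A b \<Longrightarrow> b \<le> c \<Longrightarrow> opb n A c"
  unfolding opb_def by (meson L2_set_nonneg mult_right_mono order_trans)

lemma opb_cong:
  assumes "opb n A b" "\<And>i j. i < n \<Longrightarrow> j < n \<Longrightarrow> A i j = B i j"
  shows "opb n B b"
proof -
  have "inn n w (mat_vec n B v) = inn n w (mat_vec n A v)" for w v
    using assms(2) by (auto simp: inn_def mat_vec_def intro!: sum.cong)
  then show ?thesis using assms(1) by (simp add: opb_def)
qed

lemma opb_add:
  assumes "opb n A a" "opb n B b"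
  shows "opb n (\<lambda>i j. A i j + B i j) (a + b)"
proof (rule opbI)
  fix w v
  show "\<bar>inn n w (mat_vec n (\<lambda>i j. A i j + B i j) v)\<bar> \<le> (a + b) * nrm n w * nrm n v"
    using opb_inn[OF assms(1), of w v] opb_inn[OF assms(2), of w v]
    by (simp add: mat_vec_mat_add inn_add_right algebra_simps)
qed

lemma opb_diff:
  assumes "opb n A a" "opb n B b"
  shows "opb n (\<lambda>i j. A i j - B i j) (a + b)"
proof (rule opbI)
  fix w v
  show "\<bar>inn n w (mat_vec n (\<lambda>i j. A i j - B i j) v)\<bar> \<le> (a + b) * nrm n w * nrm n v"
    using opb_inn[OF assms(1), of w v] opb_inn[OF assms(2), of w v]
    by (simp add: mat_vec_mat_diff inn_diff_right algebra_simps)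
qed

lemma opb_divide:
  assumes "opb n A a" "0 < c"
  shows "opb n (\<lambda>i j. A i j / c) (a / c)"
proof (rule opbI)
  fix w v
  have "\<bar>inn n w (mat_vec n A v)\<bar> / c \<le> (a * nrm n w * nrm n v) / c"
    using opb_inn[OF assms(1), of w v] assms(2) by (intro divide_right_mono) auto
  then show "\<bar>inn n w (mat_vec n (\<lambda>i j. A i j / c) v)\<bar> \<le> a / c * nrm n w * nrm n v"
    using assms(2) by (simp add: mat_vec_mat_divide inn_divide_right abs_divide)
qed

lemma opb_rank_one: "opb n (\<lambda>i j. a i * b j) (nrm n a * nrm n b)"
proof (rule opbI)
  fix w v
  have "inn n w (mat_vec n (\<lambda>i j. a i * b j) v) = inn n w a * inn n b v"
    using inn_scale_right[of n w "inn n b v" a] by (simp add: mat_vec_rank_one mult.commute)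
  moreover have "\<bar>inn n w a\<bar> * \<bar>inn n b v\<bar> \<le> (nrm n w * nrm n a) * (nrm n b * nrm n v)"
    by (intro mult_mono inn_le_nrm) auto
  ultimately show "\<bar>inn n w (mat_vec n (\<lambda>i j. a i * b j) v)\<bar> \<le> nrm n a * nrm n b * nrm n w * nrm n v"
    by (simp add: abs_mult algebra_simps)
qed

lemma opb_diag:
  assumes "\<And>i. i < n \<Longrightarrow> \<bar>D i\<bar> \<le> c"
  shows "opb n (\<lambda>i j. if i = j then D i else 0) c"
proof (rule opbI)
  fix w v
  have "inn n w (mat_vec n (\<lambda>i j. if i = j then D i else 0) v) = (\<Sum>i<n. w i * (D i * v i))"
    unfolding inn_def mat_vec_def
  proof (intro sum.cong refl)
    fix i assume "i \<in> {..<n}"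
    then have "(\<Sum>j<n. (if i = j then D i else 0) * v j) = D i * v i"
      by (subst sum.remove[of _ i]) (auto intro: sum.neutral)
    then show "w i * (\<Sum>j<n. (if i = j then D i else 0) * v j) = w i * (D i * v i)" by simp
  qed
  also have "\<bar>\<dots>\<bar> \<le> (\<Sum>i<n. c * (\<bar>w i\<bar> * \<bar>v i\<bar>))"
  proof (rule order_trans[OF sum_abs], rule sum_mono)
    fix i assume "i \<in> {..<n}"
    then have "\<bar>D i\<bar> * (\<bar>w i\<bar> * \<bar>v i\<bar>) \<le> c * (\<bar>w i\<bar> * \<bar>v i\<bar>)"
      using assms by (intro mult_right_mono) auto
    then show "\<bar>w i * (D i * v i)\<bar> \<le> c * (\<bar>w i\<bar> * \<bar>v i\<bar>)"
      by (simp add: abs_mult algebra_simps)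
  qed
  also have "\<dots> = c * (\<Sum>i<n. \<bar>w i\<bar> * \<bar>v i\<bar>)" by (simp add: sum_distrib_left)
  also have "\<dots> \<le> c * (nrm n w * nrm n v)"
  proof (cases "n = 0")
    case False
    then have "0 \<le> c" using assms[of 0] by auto
    then show ?thesis by (intro mult_left_mono L2_set_mult_ineq)
  qed simp
  finally show "\<bar>inn n w (mat_vec n (\<lambda>i j. if i = j then D i else 0) v)\<bar> \<le> c * nrm n w * nrm n v"
    by (simp add: algebra_simps)
qed

lemma L2_set_unit: "i < n \<Longrightarrow> nrm n (\<lambda>j. if j = i then 1 else 0) = 1"
  by (simp add: L2_set_def if_distrib[of "\<lambda>x. x\<^sup>2"] cong: if_cong)

lemma opb_entry:
  assumes "opb n A b" "i < n" "j < n"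
  shows "\<bar>A i j\<bar> \<le> b"
proof -
  have "mat_vec n A (\<lambda>k. if k = j then 1 else 0) = (\<lambda>k. A k j)"
    using assms(3) by (simp add: mat_vec_def if_distrib cong: if_cong)
  then have "inn n (\<lambda>k. if k = i then 1 else 0) (mat_vec n A (\<lambda>k. if k = j then 1 else 0)) = A i j"
    using assms(2) by (simp add: inn_def if_distrib[of "\<lambda>x. x * _"] cong: if_cong)
  then show ?thesis
    using opb_inn[OF assms(1), of "\<lambda>k. if k = i then 1 else 0" "\<lambda>k. if k = j then 1 else 0"] assms
    by (simp add: L2_set_unit)
qed

lemma opb_row:
  assumes "opb n A b" "i < n" "0 \<le> b"
  shows "nrm n (A i) \<le> b"
proof -
  let ?r = "nrm n (A i)"
  have "inn n (\<lambda>k. if k = i then 1 else 0) (mat_vec n A (A i)) = ?r\<^sup>2"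
    using assms(2) by (simp add: inn_def if_distrib[of "\<lambda>x. x * _"] mat_vec_eq_inn inn_self[unfolded inn_def] cong: if_cong)
  then have "?r * ?r \<le> b * ?r"
    using opb_inn[OF assms(1), of "\<lambda>k. if k = i then 1 else 0" "A i"] assms
    by (simp add: L2_set_unit power2_eq_square)
  then show ?thesis
    by (smt (verit, best) L2_set_nonneg assms(3) mult_right_le_imp_le)
qed

text \<open>Testing on unit vectors bounds each diagonal entry by \<open>b\<close>, so the removed
  diagonal matrix also has the bound \<open>b\<close>; the price is a factor 2.\<close>

lemma opb_hollow:
  assumes "opb n A b"
  shows "opb n (hollow A) (2 * b)"
proof -
  have "opb n (\<lambda>i j. if i = j then A i i else 0) b"
    using opb_entry[OF assms] by (intro opb_diag) auto
  from opb_diff[OF assms this] show ?thesis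
    by (rule opb_mono[OF opb_cong]) (auto simp: hollow_def)
qed

subsection \<open>The power step near a rank-one projection\<close>

text \<open>A power iteration whose normalisation is linear in \<open>A v\<close>: iterates are
  rational functions of the entries of \<open>A\<close>, and the sign of the limit is fixed.\<close>

definition power_step :: "nat \<Rightarrow> (nat \<Rightarrow> real) \<Rightarrow> (nat \<Rightarrow> nat \<Rightarrow> real) \<Rightarrow> (nat \<Rightarrow> real) \<Rightarrow> (nat \<Rightarrow> real)" where
  "power_step n ub A v = (\<lambda>i. mat_vec n A v i / inn n ub (mat_vec n A v))"

definition slice :: "nat \<Rightarrow> (nat \<Rightarrow> real) \<Rightarrow> (nat \<Rightarrow> real) set" where
  "slice n ub = {v. inn n ub v = 1 \<and> nrm n v \<le> 2}"

text \<open>With \<open>\<delta> \<le> 1 / 12\<close> the denominators of the power step stay at or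
  above 5/6 on the slice, and its Lipschitz constant \<open>3 * \<delta> / (5 / 6)\<close> stays
  below 1/2.\<close>

locale near_rank_one =
  fixes n :: nat and ub :: "nat \<Rightarrow> real" and A :: "nat \<Rightarrow> nat \<Rightarrow> real" and \<delta> :: real
  assumes unit: "nrm n ub = 1"
    and close: "opb n (\<lambda>i j. A i j - ub i * ub j) \<delta>"
    and \<delta>_nonneg: "0 \<le> \<delta>" and \<delta>_le: "\<delta> \<le> 1 / 12"
begin

abbreviation "F \<equiv> (\<lambda>i j. A i j - ub i * ub j)"
abbreviation "T \<equiv> power_step n ub A"

lemma F_bound: "nrm n (mat_vec n F v) \<le> \<delta> * nrm n v"
  by (rule opb_nrm[OF close \<delta>_nonneg])

lemma A_decomp: "mat_vec n A v = (\<lambda>i. inn n ub v * ub i + mat_vec n F v i)"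
  by (simp add: mat_vec_mat_diff mat_vec_rank_one)

lemma inn_unit: "inn n ub ub = 1"
  by (simp add: inn_self unit)

lemma inn_A: "inn n ub (mat_vec n A v) = inn n ub v + inn n ub (mat_vec n F v)"
  by (subst A_decomp) (simp add: inn_add_right inn_scale_right inn_unit)

lemma inn_F: "\<bar>inn n ub (mat_vec n F v)\<bar> \<le> \<delta> * nrm n v"
  using opb_inn[OF close, of ub v] by (simp add: unit)

lemma denom:
  assumes "v \<in> slice n ub"
  shows "\<bar>inn n ub (mat_vec n A v) - 1\<bar> \<le> 2 * \<delta>" "5 / 6 \<le> inn n ub (mat_vec n A v)"
proof -
  have "\<delta> * nrm n v \<le> \<delta> * 2"
    using assms \<delta>_nonneg by (intro mult_left_mono) (auto simp: slice_def)
  then show *: "\<bar>inn n ub (mat_vec n A v) - 1\<bar> \<le> 2 * \<delta>"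
    using inn_F[of v] inn_A[of v] assms by (simp add: slice_def)
  show "5 / 6 \<le> inn n ub (mat_vec n A v)"
    using * \<delta>_le by linarith
qed

lemma step_close:
  assumes "v \<in> slice n ub"
  shows "nrm n (\<lambda>i. T v i - ub i) \<le> 6 * \<delta>"
proof -
  define a where "a = inn n ub (mat_vec n A v)"
  define f where "f = inn n ub (mat_vec n F v)"
  have a: "5 / 6 \<le> a" using denom[OF assms] by (simp add: a_def)
  have af: "a = 1 + f" using inn_A[of v] assms by (simp add: a_def f_def slice_def)
  have Fv: "nrm n (mat_vec n F v) \<le> 2 * \<delta>"
    using F_bound[of v] assms \<delta>_nonneg mult_left_mono[of "nrm n v" 2 \<delta>] by (auto simp: slice_def)
  have f: "\<bar>f\<bar> \<le> 2 * \<delta>"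
    using inn_F[of v] assms \<delta>_nonneg mult_left_mono[of "nrm n v" 2 \<delta>] by (auto simp: slice_def f_def)
  \<comment> \<open>As \<open>a = 1 + f\<close>, the error is the part of \<open>F v\<close>
    orthogonal to \<open>ub\<close>, divided by \<open>a\<close>.\<close>
  have "T v i - ub i = (mat_vec n F v i - f * ub i) / a" for i
    using a assms unfolding power_step_def a_def[symmetric]
    by (subst A_decomp) (simp add: slice_def af field_simps)
  then have "nrm n (\<lambda>i. T v i - ub i) = nrm n (\<lambda>i. mat_vec n F v i - f * ub i) / a"
    using a by (simp add: nrm_divide)
  also have "\<dots> \<le> (4 * \<delta>) / a"
    using nrm_diff_le[of "mat_vec n F v" "\<lambda>i. f * ub i" n] Fv f a
    by (intro divide_right_mono) (auto simp: nrm_scale unit)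
  also have "\<dots> \<le> (4 * \<delta>) / (5 / 6)"
    using a \<delta>_nonneg by (intro divide_left_mono) auto
  finally show ?thesis using \<delta>_nonneg by simp
qed

lemma step_slice:
  assumes "v \<in> slice n ub"
  shows "T v \<in> slice n ub"
proof -
  have "inn n ub (T v) = 1"
    using denom[OF assms] by (simp add: power_step_def inn_divide_right)
  moreover have "nrm n (T v) \<le> 2"
    using step_close[OF assms] nrm_ge_diff[of "T v" n ub] unit \<delta>_le by simp
  ultimately show ?thesis by (simp add: slice_def)
qed

lemma step_contraction:
  assumes v: "v \<in> slice n ub" and w: "w \<in> slice n ub"
  shows "nrm n (\<lambda>i. T v i - T w i) \<le> nrm n (\<lambda>i. v i - w i) / 2"
proof -
  define a where "a = inn n ub (mat_vec n A v)"
  define b where "b = inn n ub (mat_vec n A w)"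
  define r where "r = nrm n (\<lambda>i. v i - w i)"
  let ?D = "mat_vec n F (\<lambda>i. v i - w i)"
  have a: "5 / 6 \<le> a" and b: "5 / 6 \<le> b"
    using denom[OF v] denom[OF w] by (auto simp: a_def b_def)
  have D: "nrm n ?D \<le> \<delta> * r" using F_bound unfolding r_def .
  have ab: "a - b = inn n ub ?D"
    using v w unfolding a_def b_def inn_A by (simp add: slice_def mat_vec_diff inn_diff_right)
  have ab': "\<bar>a - b\<bar> \<le> \<delta> * r" unfolding ab r_def by (rule inn_F)
  have "mat_vec n A v i - mat_vec n A w i = ?D i" for i
    using v w unfolding A_decomp by (simp add: slice_def mat_vec_diff)
  then have Av: "mat_vec n A v i = mat_vec n A w i + ?D i" for i
    by (simp add: algebra_simps)
  have eq: "T v i - T w i = (?D i - (a - b) * T w i) / a" for i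
    using a b unfolding power_step_def a_def[symmetric] b_def[symmetric] Av
    by (simp add: field_simps)
  have "nrm n (\<lambda>i. T v i - T w i) = nrm n (\<lambda>i. ?D i - (a - b) * T w i) / a"
    unfolding eq using a by (simp add: nrm_divide)
  also have "\<dots> \<le> (3 * (\<delta> * r)) / a"
  proof (rule divide_right_mono)
    have "\<bar>a - b\<bar> * nrm n (T w) \<le> (\<delta> * r) * 2"
      using ab' step_slice[OF w] by (intro mult_mono) (auto simp: slice_def \<delta>_nonneg r_def)
    then show "nrm n (\<lambda>i. ?D i - (a - b) * T w i) \<le> 3 * (\<delta> * r)"
      using nrm_diff_le[of ?D "\<lambda>i. (a - b) * T w i" n] D by (simp add: nrm_scale)
  qed (use a in simp)
  also have "\<dots> \<le> (3 * (\<delta> * r)) / (5 / 6)"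
    using a \<delta>_nonneg by (intro divide_left_mono) (auto simp: r_def)
  also have "\<dots> \<le> r / 2"
  proof -
    have "0 \<le> r" by (simp add: r_def)
    then show ?thesis using mult_right_mono[OF \<delta>_le, of r] by simp
  qed
  finally show ?thesis unfolding r_def .
qed

section \<open>Iterates of the power step and the eigenpair they produce\<close>

lemma ub_slice: "ub \<in> slice n ub"
  by (simp add: slice_def inn_unit unit)

lemma iter_slice: "(T ^^ k) ub \<in> slice n ub"
  by (induction k) (auto intro: ub_slice step_slice)

lemma iter_step: "nrm n (\<lambda>i. (T ^^ Suc k) ub i - (T ^^ k) ub i) \<le> 6 * \<delta> * (1 / 2) ^ k"
proof (induction k)
  case 0
  then show ?case using step_close[OF ub_slice] by simp
next
  case (Suc k)
  have "nrm n (\<lambda>i. T ((T ^^ Suc k) ub) i - T ((T ^^ k) ub) i) \<le> nrm n (\<lambda>i. (T ^^ Suc k) ub i - (T ^^ k) ub i) / 2"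
    by (intro step_contraction iter_slice)
  then show ?case using Suc by simp
qed

lemma iter_close: "nrm n (\<lambda>i. (T ^^ Suc k) ub i - ub i) \<le> 6 * \<delta>"
  using step_close[OF iter_slice] by simp

text \<open>The iterates converge coordinatewise, their increments being geometric, and the relation
  \<open>A v = \<langle>ub, A v\<rangle> T v\<close> passes to the limit. The eigenvalue found here
  forces every leading eigenvalue to be at least 5/6.\<close>

lemma eigenpair_exists: "\<exists>lam v. is_eigenpair n A lam v \<and> 5 / 6 \<le> lam"
proof -
  have "convergent (\<lambda>k. (T ^^ k) ub i)" if i: "i < n" for i
  proof -
    let ?f = "\<lambda>k. (T ^^ k) ub i"
    have "summable (\<lambda>k. ?f (Suc k) - ?f k)"
    proof (rule summable_comparison_test')
      show "summable (\<lambda>k. 6 * \<delta> * (1 / 2) ^ k)" by (intro summable_mult summable_geometric) auto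
      show "norm (?f (Suc k) - ?f k) \<le> 6 * \<delta> * (1 / 2) ^ k" if "0 \<le> k" for k
        using component_le_nrm[OF i, of "\<lambda>i. (T ^^ Suc k) ub i - (T ^^ k) ub i"] iter_step[of k]
        by (simp del: funpow.simps)
    qed
    then obtain s where "(\<lambda>m. \<Sum>k<m. ?f (Suc k) - ?f k) \<longlonglongrightarrow> s"
      using summable_LIMSEQ by blast
    then have "(\<lambda>m. ?f m - ?f 0) \<longlonglongrightarrow> s" by (subst (asm) sum_lessThan_telescope[of ?f])
    then have "(\<lambda>m. (?f m - ?f 0) + ?f 0) \<longlonglongrightarrow> s + ?f 0" by (intro tendsto_intros)
    then show ?thesis by (auto simp: convergent_def)
  qed
  then obtain x where x: "\<And>i. i < n \<Longrightarrow> (\<lambda>k. (T ^^ k) ub i) \<longlonglongrightarrow> x i"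
    unfolding convergent_def by metis
  have inn: "(\<lambda>k. inn n c ((T ^^ k) ub)) \<longlonglongrightarrow> inn n c x" for c
    unfolding inn_def by (intro tendsto_intros x) auto
  have mv: "(\<lambda>k. mat_vec n A ((T ^^ k) ub) i) \<longlonglongrightarrow> mat_vec n A x i" for i
    unfolding mat_vec_eq_inn by (rule inn)
  define lam where "lam = inn n ub (mat_vec n A x)"
  have lam: "(\<lambda>k. inn n ub (mat_vec n A ((T ^^ k) ub))) \<longlonglongrightarrow> lam"
    unfolding lam_def by (subst (1 2) inn_def) (intro tendsto_intros mv)
  have "inn n ub x = 1"
    using inn[of ub] iter_slice by (simp add: slice_def LIMSEQ_const_iff)
  then have "\<exists>i<n. x i \<noteq> 0"
    unfolding inn_def by (metis (no_types, lifting) lessThan_iff mult_zero_right sum.neutral zero_neq_one)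
  moreover have "mat_vec n A x i = lam * x i" if i: "i < n" for i
  proof -
    have "(\<lambda>k. inn n ub (mat_vec n A ((T ^^ k) ub)) * (T ^^ Suc k) ub i) \<longlonglongrightarrow> lam * x i"
      by (intro tendsto_mult lam LIMSEQ_Suc[OF x[OF i]])
    moreover have "inn n ub (mat_vec n A ((T ^^ k) ub)) * (T ^^ Suc k) ub i = mat_vec n A ((T ^^ k) ub) i" for k
      using denom[OF iter_slice[of k]] by (simp add: power_step_def[of n ub A "(T ^^ k) ub"])
    ultimately show ?thesis using mv[of i] LIMSEQ_unique by fastforce
  qed
  moreover have "5 / 6 \<le> lam"
    by (rule LIMSEQ_le_const[OF lam]) (use denom[OF iter_slice] in auto)
  ultimately show ?thesis unfolding is_eigenpair_def by blast
qed

text \<open>The leading eigenvector, rescaled to have inner product 1 with \<open>ub\<close>, is the fixed point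
  of the contraction.\<close>

lemma leading_fixpoint:
  assumes lead: "is_leading_unit_eigvec n A u"
  obtains c v lam where "c \<noteq> 0" "\<bar>c\<bar> \<le> 1" "1 - \<bar>c\<bar> \<le> 6 * \<delta>" "v \<in> slice n ub" "\<And>i. u i = c * v i"
    "\<And>i. i < n \<Longrightarrow> T v i = v i" "\<And>i. i < n \<Longrightarrow> mat_vec n A v i = lam * v i" "\<bar>lam - 1\<bar> \<le> 2 * \<delta>"
    "nrm n (\<lambda>i. v i - ub i) \<le> 6 * \<delta>"
proof -
  have u1: "nrm n u = 1"
    using lead by (simp add: is_leading_unit_eigvec_def L2_set_def sqnorm_def)
  obtain lam where eig: "is_eigenpair n A lam u" and max: "\<And>l v. is_eigenpair n A l v \<Longrightarrow> l \<le> lam"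
    using lead by (auto simp: is_leading_unit_eigvec_def)
  have lam: "5 / 6 \<le> lam" using eigenpair_exists max by (meson order_trans)
  define c where "c = inn n ub u"
  have Au: "mat_vec n A u i = lam * u i" if "i < n" for i
    using eig that by (simp add: is_eigenpair_def)
  \<comment> \<open>As \<open>u\<close> has norm 1, this chain reads
    \<open>lam \<le> |c| + \<delta>\<close>. With \<open>lam \<ge> 5 / 6\<close> it gives
    \<open>|c| \<ge> 3 / 4\<close>, so \<open>u / c\<close> has norm at most 4/3 and lies in the
    slice.\<close>
  have "lam * nrm n u = nrm n (mat_vec n A u)"
    using lam nrm_cong[OF Au, of n] by (simp add: nrm_scale)
  also have "\<dots> \<le> nrm n (\<lambda>i. c * ub i) + nrm n (mat_vec n F u)"
    unfolding c_def by (subst A_decomp) (rule L2_set_triangle_ineq)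
  also have "\<dots> \<le> \<bar>c\<bar> + \<delta>"
    using F_bound[of u] by (simp add: nrm_scale unit u1)
  finally have c: "3 / 4 \<le> \<bar>c\<bar>" using lam \<delta>_le by (simp add: u1)
  have c1: "\<bar>c\<bar> \<le> 1" using inn_le_nrm[of n ub u] by (simp add: c_def unit u1)
  define v where "v = (\<lambda>i. u i / c)"
  have nv: "nrm n v = 1 / \<bar>c\<bar>" by (simp add: v_def nrm_divide u1)
  have "1 / \<bar>c\<bar> \<le> 1 / (3 / 4)" using c by (intro divide_left_mono) auto
  then have vs: "v \<in> slice n ub"
    using c nv by (auto simp: slice_def v_def inn_divide_right c_def[symmetric])
  have Av: "mat_vec n A v i = lam * v i" if "i < n" for i
    using Au[OF that] mat_vec_scale[of n A "1 / c" u] by (simp add: v_def)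
  have lamv: "inn n ub (mat_vec n A v) = lam"
  proof -
    have "inn n ub (mat_vec n A v) = inn n ub (\<lambda>i. lam * v i)" by (intro inn_cong Av) auto
    then show ?thesis using vs by (simp add: inn_scale_right slice_def)
  qed
  have Tv: "T v i = v i" if "i < n" for i
    using Av[OF that] lamv lam by (simp add: power_step_def)
  have vub: "nrm n (\<lambda>i. v i - ub i) \<le> 6 * \<delta>"
    using step_close[OF vs] nrm_cong[of n "\<lambda>i. T v i - ub i" "\<lambda>i. v i - ub i"] Tv by simp
  have "1 / \<bar>c\<bar> - 1 \<le> 6 * \<delta>"
    using nrm_ge_diff[of v n ub] vub unit nv by simp
  then have "\<bar>c\<bar> * (1 / \<bar>c\<bar> - 1) \<le> 1 * (6 * \<delta>)"
    using c c1 by (intro mult_mono) (auto simp: field_simps)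
  moreover have "c \<noteq> 0" using c by auto
  ultimately have "1 - \<bar>c\<bar> \<le> 6 * \<delta>" by (simp add: right_diff_distrib)
  moreover have "u i = c * v i" for i using \<open>c \<noteq> 0\<close> by (simp add: v_def)
  ultimately show ?thesis
    using that[of c v lam] \<open>c \<noteq> 0\<close> c1 vs Tv Av denom(1)[OF vs] lamv vub by simp
qed

end

lemma leading_divide:
  assumes "is_leading_unit_eigvec n G u" "0 < l"
  shows "is_leading_unit_eigvec n (\<lambda>i j. G i j / l) u"
proof -
  have pair: "is_eigenpair n (\<lambda>i j. G i j / l) lam v \<longleftrightarrow> is_eigenpair n G (lam * l) v" for lam v
    using assms(2) by (auto simp: is_eigenpair_def mat_vec_mat_divide field_simps)
  obtain lam where "is_eigenpair n G lam u" and max: "\<And>k v. is_eigenpair n G k v \<Longrightarrow> k \<le> lam"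
    using assms(1) by (auto simp: is_leading_unit_eigvec_def)
  then have "is_eigenpair n (\<lambda>i j. G i j / l) (lam / l) u"
    using assms(2) pair by simp
  moreover have "k \<le> lam / l" if "is_eigenpair n (\<lambda>i j. G i j / l) k v" for k v
    using max[of "k * l" v] that pair assms(2) by (simp add: field_simps)
  ultimately show ?thesis
    using assms(1) unfolding is_leading_unit_eigvec_def by blast
qed

subsection \<open>Leave-one-out comparison\<close>

text \<open>Row and column are zeroed, not deleted, so that the dimension, \<open>ub\<close> and all
  norms stay the same for every \<open>i\<close>.\<close>

definition loo :: "nat \<Rightarrow> (nat \<Rightarrow> nat \<Rightarrow> real) \<Rightarrow> (nat \<Rightarrow> nat \<Rightarrow> real)" where
  "loo i A = (\<lambda>j k. if j = i \<or> k = i then 0 else A j k)"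

lemma nrm_zero_coord: "nrm n (v(i := 0)) \<le> nrm n v"
  unfolding L2_set_def by (intro real_sqrt_le_mono sum_mono) auto

text \<open>\<open>loo i A\<close> is \<open>P A P\<close> with \<open>P\<close> the projection that
  kills coordinate \<open>i\<close>; operator bounds survive because \<open>P\<close> does not
  increase norms.\<close>

lemma inn_loo: "inn n w (mat_vec n (loo i A) v) = inn n (w(i := 0)) (mat_vec n A (v(i := 0)))"
  unfolding inn_def
proof (rule sum.cong[OF refl])
  fix k
  have "(\<Sum>j<n. (if j = i then 0 else A k j) * v j) = (\<Sum>j<n. A k j * (v(i := 0)) j)"
    by (rule sum.cong) auto
  then show "w k * mat_vec n (loo i A) v k = (w(i := 0)) k * mat_vec n A (v(i := 0)) k"
    by (simp add: mat_vec_def loo_def)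
qed

lemma opb_loo:
  assumes "opb n A b" "0 \<le> b"
  shows "opb n (loo i A) b"
proof (rule opbI)
  fix w v
  have "\<bar>inn n w (mat_vec n (loo i A) v)\<bar> \<le> b * nrm n (w(i := 0)) * nrm n (v(i := 0))"
    unfolding inn_loo by (rule opb_inn[OF assms(1)])
  also have "\<dots> \<le> b * nrm n w * nrm n v"
    using assms(2) by (intro mult_mono nrm_zero_coord) auto
  finally show "\<bar>inn n w (mat_vec n (loo i A) v)\<bar> \<le> b * nrm n w * nrm n v" .
qed

text \<open>Zeroing row and column \<open>i\<close> of \<open>ub ub\<^sup>T\<close> removes two
  rank-one pieces, each of norm at most \<open>|ub i|\<close>.\<close>

lemma near_rank_one_loo:
  assumes A: "near_rank_one n ub A \<delta>" and i: "i < n" and \<delta>': "\<delta> + 2 * \<bar>ub i\<bar> \<le> \<delta>'" "\<delta>' \<le> 1 / 12"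
  shows "near_rank_one n ub (loo i A) \<delta>'"
proof -
  interpret near_rank_one n ub A \<delta> by fact
  define e where "e = (\<lambda>j. if j = i then ub i else 0)"
  have e: "nrm n e = \<bar>ub i\<bar>"
    using nrm_scale[where c = "ub i" and v = "\<lambda>j. if j = i then 1 else 0" and n = n] i
    by (simp add: e_def L2_set_unit if_distrib cong: if_cong)
  have "opb n (\<lambda>j k. loo i F j k - e j * (ub(i := 0)) k) (\<delta> + \<bar>ub i\<bar> * nrm n (ub(i := 0)))"
    using opb_diff[OF opb_loo[OF close \<delta>_nonneg, of i] opb_rank_one[of n e "ub(i := 0)"]] e by simp
  from opb_diff[OF this opb_rank_one[of n ub e]]
  have "opb n (\<lambda>j k. loo i F j k - e j * (ub(i := 0)) k - ub j * e k)
     (\<delta> + \<bar>ub i\<bar> * nrm n (ub(i := 0)) + \<bar>ub i\<bar>)" using e unit by simp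
  moreover have "\<bar>ub i\<bar> * nrm n (ub(i := 0)) \<le> \<bar>ub i\<bar> * 1"
    using nrm_zero_coord[of ub i n] unit by (intro mult_left_mono) auto
  ultimately have "opb n (\<lambda>j k. loo i A j k - ub j * ub k) \<delta>'"
    using \<delta>' by (elim opb_mono[OF opb_cong]) (auto simp: loo_def e_def)
  then show ?thesis
    using \<delta>' \<delta>_nonneg unit by unfold_locales auto
qed

text \<open>The iterate for the matrix without row and column \<open>i\<close> vanishes at \<open>i\<close>, so the two matrices
  differ on it only in coordinate \<open>i\<close>, by the \<open>i\<close>-th row of \<open>A\<close> applied to it. Contraction turns
  this into a bound for its distance to the fixed point.\<close>

lemma loo_error:
  assumes A: "near_rank_one n ub A \<delta>" and A': "near_rank_one n ub (loo i A) \<delta>"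
    and i: "i < n" and diag: "A i i = 0" and row: "nrm n (A i) \<le> 2 * \<delta>"
    and lead: "is_leading_unit_eigvec n A u"
    and v_def: "v = ((power_step n ub (loo i A)) ^^ Suc k) ub"
  shows "\<bar>sgn (inn n ub u) * u i - mat_vec n A ub i\<bar>
     \<le> 6 * \<bar>mat_vec n A (\<lambda>j. v j - ub j) i\<bar> + 42 * \<delta> * \<bar>mat_vec n A ub i\<bar> + 4 * \<delta> * (1 / 2) ^ k"
proof -
  interpret near_rank_one n ub A \<delta> by fact
  interpret L: near_rank_one n ub "loo i A" \<delta> by fact
  obtain c x lam where x: "c \<noteq> 0" "\<bar>c\<bar> \<le> 1" "1 - \<bar>c\<bar> \<le> 6 * \<delta>" "x \<in> slice n ub" "\<And>i. u i = c * x i"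
    "\<And>i. i < n \<Longrightarrow> T x i = x i" "\<And>i. i < n \<Longrightarrow> mat_vec n A x i = lam * x i" "\<bar>lam - 1\<bar> \<le> 2 * \<delta>"
    "nrm n (\<lambda>i. x i - ub i) \<le> 6 * \<delta>"
    using leading_fixpoint[OF lead] by blast
  have cu: "inn n ub u = c"
    using x(4) inn_scale_right[of n ub c x] inn_cong[of n ub ub u "\<lambda>i. c * x i"] x(5) by (simp add: slice_def)
  define r where "r = mat_vec n A v i"
  define \<alpha> where "\<alpha> = \<bar>mat_vec n A (\<lambda>j. v j - ub j) i\<bar>"
  define \<beta> where "\<beta> = \<bar>mat_vec n A ub i\<bar>"
  define p where "p = (1 / 2 :: real) ^ k"
  have p: "0 \<le> p" by (simp add: p_def)
  have vs: "v \<in> slice n ub" unfolding v_def by (rule L.iter_slice)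
  have vi: "v i = 0"
    by (simp add: v_def power_step_def mat_vec_def loo_def)
  have Av: "mat_vec n A v j = mat_vec n (loo i A) v j + (if j = i then r else 0)" for j
  proof -
    have "j \<noteq> i \<Longrightarrow> mat_vec n A v j = mat_vec n (loo i A) v j"
      unfolding mat_vec_def by (rule sum.cong) (auto simp: loo_def vi)
    moreover have "mat_vec n (loo i A) v i = 0" by (simp add: mat_vec_def loo_def)
    ultimately show ?thesis by (auto simp: r_def)
  qed
  define a where "a = inn n ub (mat_vec n A v)"
  define b where "b = inn n ub (mat_vec n (loo i A) v)"
  have a: "5 / 6 \<le> a" and b: "5 / 6 \<le> b"
    using denom[OF vs] L.denom[OF vs] by (auto simp: a_def b_def)
  have ab: "a - b = ub i * r"
  proof -
    have "a = b + inn n ub (\<lambda>j. if j = i then r else 0)"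
      unfolding a_def b_def inn_add_right[symmetric] by (rule inn_cong) (auto simp: Av)
    then show ?thesis using i by (simp add: inn_def if_distrib cong: if_cong)
  qed
  let ?T' = "power_step n ub (loo i A)"
  \<comment> \<open>The two images of \<open>v\<close> differ by \<open>r\<close> in coordinate
    \<open>i\<close> only, hence their denominators differ by \<open>ub i * r\<close>.\<close>
  have TT: "nrm n (\<lambda>j. T v j - ?T' v j) \<le> 4 * \<bar>r\<bar>"
  proof -
    have "T v j - ?T' v j = (r * (if j = i then 1 else 0) - (a - b) * ?T' v j) / a" for j
      using a b unfolding power_step_def a_def[symmetric] b_def[symmetric] Av[of j]
      by (simp add: field_simps)
    then have "nrm n (\<lambda>j. T v j - ?T' v j) = nrm n (\<lambda>j. r * (if j = i then 1 else 0) - (a - b) * ?T' v j) / a"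
      using a by (simp add: nrm_divide)
    also have "\<dots> \<le> (3 * \<bar>r\<bar>) / a"
    proof (rule divide_right_mono)
      have "\<bar>ub i\<bar> \<le> 1" using component_le_nrm[OF i, of ub] unit by simp
      then have "\<bar>ub i\<bar> * \<bar>r\<bar> \<le> 1 * \<bar>r\<bar>" by (intro mult_right_mono) auto
      then have "\<bar>a - b\<bar> * nrm n (?T' v) \<le> \<bar>r\<bar> * 2"
        using L.step_slice[OF vs] by (intro mult_mono) (auto simp: slice_def ab abs_mult)
      then show "nrm n (\<lambda>j. r * (if j = i then 1 else 0) - (a - b) * ?T' v j) \<le> 3 * \<bar>r\<bar>"
        using nrm_diff_le[of "\<lambda>j. r * (if j = i then 1 else 0)" "\<lambda>j. (a - b) * ?T' v j" n] i
        unfolding nrm_scale by (simp add: L2_set_unit)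
    qed (use a in simp)
    also have "\<dots> \<le> (3 * \<bar>r\<bar>) / (5 / 6)" using a by (intro divide_left_mono) auto
    finally show ?thesis by simp
  qed
  have Tv: "nrm n (\<lambda>j. ?T' v j - v j) \<le> 6 * \<delta> * p"
  proof -
    have "nrm n (\<lambda>j. ?T' v j - v j) \<le> 6 * \<delta> * (1 / 2) ^ Suc k"
      using L.iter_step[of "Suc k"] by (simp add: v_def)
    also have "\<dots> \<le> 6 * \<delta> * p" using \<delta>_nonneg unfolding p_def by (intro mult_left_mono power_decreasing) auto
    finally show ?thesis .
  qed
  \<comment> \<open>The route is \<open>T x\<close>, \<open>T v\<close>, \<open>?T' v\<close>,
    \<open>v\<close>. Contraction bounds the first leg by half of the distance being estimated, and
    absorbing it doubles the other two.\<close>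
  have xv: "nrm n (\<lambda>j. x j - v j) \<le> 8 * \<bar>r\<bar> + 12 * \<delta> * p"
  proof -
    have "nrm n (\<lambda>j. x j - v j) = nrm n (\<lambda>j. T x j - v j)" using x(6) by (intro nrm_cong) auto
    then show ?thesis
      using nrm_triangle3[of "T x" v n "T v"] nrm_triangle3[of "T v" v n "?T' v"]
        step_contraction[OF x(4) vs] TT Tv by simp
  qed
  have r: "\<bar>r\<bar> \<le> \<alpha> + \<beta>"
    unfolding r_def \<alpha>_def \<beta>_def mat_vec_diff by simp
  \<comment> \<open>Cauchy-Schwarz brings in the row norm, at most \<open>2 * \<delta>\<close>; this
    factor is what puts a \<open>\<delta>\<close> in front of \<open>\<beta>\<close>, which is not
    small by itself.\<close>
  have "\<bar>mat_vec n A (\<lambda>j. x j - v j) i\<bar> \<le> (2 * \<delta>) * (8 * (\<alpha> + \<beta>) + 12 * \<delta> * p)"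
    unfolding mat_vec_eq_inn using row xv r \<delta>_nonneg
    by (intro order_trans[OF inn_le_nrm] mult_mono) auto
  also have "\<dots> = 16 * \<delta> * \<alpha> + 16 * \<delta> * \<beta> + 24 * \<delta> * (\<delta> * p)" by (simp add: algebra_simps)
  also have "\<dots> \<le> 2 * \<alpha> + 16 * \<delta> * \<beta> + 2 * (\<delta> * p)"
    using mult_right_mono[of "16 * \<delta>" 2 \<alpha>] mult_right_mono[of "24 * \<delta>" 2 "\<delta> * p"] \<delta>_le \<delta>_nonneg p
    by (simp add: \<alpha>_def)
  finally have xub: "\<bar>mat_vec n A (\<lambda>j. x j - ub j) i\<bar> \<le> 3 * \<alpha> + 16 * \<delta> * \<beta> + 2 * (\<delta> * p)"
    using abs_triangle_ineq[of "mat_vec n A x i - mat_vec n A v i" "mat_vec n A v i - mat_vec n A ub i"]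
    unfolding \<alpha>_def mat_vec_diff by simp
  have lam: "5 / 6 \<le> lam" using x(8) \<delta>_le by linarith
  have s: "sgn c * u i = \<bar>c\<bar> * x i" by (simp add: x(5) sgn_if)
  have Ax: "mat_vec n A x i = mat_vec n A (\<lambda>j. x j - ub j) i + mat_vec n A ub i"
    by (simp add: mat_vec_diff)
  \<comment> \<open>Rescaling by \<open>|c| / lam\<close> costs little: \<open>1 - |c|\<close> is at
    most \<open>6 * \<delta>\<close>, \<open>|lam - 1|\<close> at most \<open>2 * \<delta>\<close>,
    and \<open>lam \<ge> 5 / 6\<close>.\<close>
  have "\<bar>\<bar>c\<bar> / lam - 1\<bar> = \<bar>\<bar>c\<bar> - lam\<bar> / lam" using lam by (simp add: abs_if field_simps)
  also have "\<dots> \<le> (8 * \<delta>) / (5 / 6)" using x(2,3,8) lam by (intro frac_le) auto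
  also have "\<dots> \<le> 10 * \<delta>" using \<delta>_nonneg by simp
  finally have cl: "\<bar>\<bar>c\<bar> / lam - 1\<bar> \<le> 10 * \<delta>" .
  have "\<bar>c\<bar> * x i - mat_vec n A ub i = (\<bar>c\<bar> / lam - 1) * mat_vec n A x i + mat_vec n A (\<lambda>j. x j - ub j) i"
  proof -
    have "\<bar>c\<bar> / lam * mat_vec n A x i = \<bar>c\<bar> * x i" using lam x(7)[OF i] by simp
    moreover have "P * R = Q \<Longrightarrow> R = Y + B \<Longrightarrow> Q - B = (P - 1) * R + Y" for P Q R Y B :: real
      by (simp add: algebra_simps)
    ultimately show ?thesis using Ax by blast
  qed
  also have "\<bar>\<dots>\<bar> \<le> (10 * \<delta>) * (\<bar>mat_vec n A (\<lambda>j. x j - ub j) i\<bar> + \<beta>) + \<bar>mat_vec n A (\<lambda>j. x j - ub j) i\<bar>"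
  proof -
    have "\<bar>(\<bar>c\<bar> / lam - 1) * mat_vec n A x i\<bar> \<le> (10 * \<delta>) * (\<bar>mat_vec n A (\<lambda>j. x j - ub j) i\<bar> + \<beta>)"
      unfolding abs_mult
    proof (rule mult_mono[OF cl])
      show "\<bar>mat_vec n A x i\<bar> \<le> \<bar>mat_vec n A (\<lambda>j. x j - ub j) i\<bar> + \<beta>"
        unfolding Ax \<beta>_def by (rule abs_triangle_ineq)
    qed (use \<delta>_nonneg in auto)
    then show ?thesis
      using abs_triangle_ineq[of "(\<bar>c\<bar> / lam - 1) * mat_vec n A x i" "mat_vec n A (\<lambda>j. x j - ub j) i"]
      by linarith
  qed
  also have "\<dots> \<le> 10 * \<delta> * \<beta> + 2 * \<bar>mat_vec n A (\<lambda>j. x j - ub j) i\<bar>"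
    using mult_right_mono[of "10 * \<delta>" 1 "\<bar>mat_vec n A (\<lambda>j. x j - ub j) i\<bar>"] \<delta>_le
    by (simp only: distrib_left) linarith
  also have "\<dots> \<le> 6 * \<alpha> + 42 * \<delta> * \<beta> + 4 * \<delta> * p"
    using xub by (simp only: mult.assoc)
  finally show ?thesis unfolding cu s \<alpha>_def \<beta>_def p_def .
qed

subsection \<open>Gaussian vectors and chi-square tails\<close>

abbreviation gauss :: "'i set \<Rightarrow> ('i \<Rightarrow> real) measure" where
  "gauss P \<equiv> PiM P (\<lambda>_. std_normal_distribution)"

lemma prob_space_std_normal: "prob_space std_normal_distribution"
  by (rule prob_space_normal_density) simp

lemma prob_space_gauss: "prob_space (gauss P)"
  by (intro prob_space_PiM prob_space_std_normal)

lemma coord_measurable: "p \<in> P \<Longrightarrow> (\<lambda>z. z p) \<in> borel_measurable (gauss P)"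
  by (rule measurable_compose[OF measurable_component_singleton]) auto

lemma coord_distr:
  assumes "p \<in> P"
  shows "distr (gauss P) borel (\<lambda>z. z p) = std_normal_distribution"
proof -
  have "distr (gauss P) borel (\<lambda>z. z p) = distr (gauss P) std_normal_distribution (\<lambda>z. z p)"
    by (rule distr_cong) auto
  also have "\<dots> = std_normal_distribution"
    using assms by (rule distr_PiM_component[OF prob_space_std_normal])
  finally show ?thesis .
qed

lemma coord_distributed:
  assumes "p \<in> P"
  shows "distributed (gauss P) lborel (\<lambda>z. z p) (\<lambda>x. ennreal (std_normal_density x))"
proof -
  have "distr (gauss P) lborel (\<lambda>z. z p) = distr (gauss P) borel (\<lambda>z. z p)"
    by (rule distr_cong) auto
  then show ?thesis
    using coord_distr[OF assms] coord_measurable[OF assms] unfolding distributed_def by simp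
qed

lemma coord_indep:
  assumes "P \<noteq> {}"
  shows "prob_space.indep_vars (gauss P) (\<lambda>_. borel) (\<lambda>p z. z p) P"
proof -
  interpret prob_space "gauss P" by (rule prob_space_gauss)
  have "distr (gauss P) (PiM P (\<lambda>_. borel)) (\<lambda>x. \<lambda>i\<in>P. x i) = distr (gauss P) (PiM P (\<lambda>_. borel)) (\<lambda>x. x)"
    by (rule distr_cong) (auto simp: space_PiM restrict_def PiE_def extensional_def fun_eq_iff)
  also have "\<dots> = gauss P"
    by (rule distr_id2) (intro sets_PiM_cong, auto)
  also have "\<dots> = PiM P (\<lambda>i. distr (gauss P) borel (\<lambda>z. z i))"
    by (intro PiM_cong refl) (simp add: coord_distr)
  finally show ?thesis
    by (subst indep_vars_iff_distr_eq_PiM'[OF assms]) (auto intro: coord_measurable)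
qed

lemma linear_comb_distributed:
  assumes "finite B" "B \<subseteq> P" and v: "(\<Sum>p\<in>B. (c p)\<^sup>2) = v" "0 < v"
  shows "distributed (gauss P) lborel (\<lambda>z. \<Sum>p\<in>B. c p * z p) (\<lambda>x. ennreal (normal_density 0 (sqrt v) x))"
proof -
  \<comment> \<open>A zero coefficient gives a constant variable, which has no density; such terms
    are dropped.\<close>
  define B' where "B' = {p\<in>B. c p \<noteq> 0}"
  have sq: "(\<Sum>p\<in>B'. (c p)\<^sup>2) = v"
    unfolding v(1)[symmetric] B'_def by (rule sum.mono_neutral_left) (use assms in auto)
  have lin: "(\<Sum>p\<in>B. c p * z p) = (\<Sum>p\<in>B'. c p * z p)" for z :: "'a \<Rightarrow> real"
    unfolding B'_def by (rule sum.mono_neutral_right) (use assms in auto)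
  have ne: "B' \<noteq> {}" using sq v by auto
  have fin: "finite B'" and sub: "B' \<subseteq> P" using assms by (auto simp: B'_def)
  interpret prob_space "gauss P" by (rule prob_space_gauss)
  have "indep_vars (\<lambda>_. borel) (\<lambda>p z. z p) B'"
    using ne sub by (intro indep_vars_subset[OF coord_indep]) auto
  then have ind: "indep_vars (\<lambda>_. borel) (\<lambda>p z. c p * z p) B'"
    by (rule indep_vars_compose2) auto
  have "distributed (gauss P) lborel (\<lambda>z. c p * z p) (\<lambda>x. ennreal (normal_density 0 \<bar>c p\<bar> x))" if "p \<in> B'" for p
    using normal_density_affine[OF coord_distributed[of p P], of "c p" 0] that sub by (auto simp: B'_def)
  then have "distributed (gauss P) lborel (\<lambda>z. \<Sum>p\<in>B'. c p * z p)
      (\<lambda>x. ennreal (normal_density (\<Sum>p\<in>B'. 0) (sqrt (\<Sum>p\<in>B'. \<bar>c p\<bar>\<^sup>2)) x))"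
    by (intro sum_indep_normal fin ne ind) (auto simp: B'_def)
  then show ?thesis using sq by (simp add: lin)
qed

text \<open>The left side is the moment generating function at \<open>t\<close> of
  \<open>X\<^sup>2 - 1\<close> for a standard normal \<open>X\<close>; in its logarithm the
  first-order terms cancel.\<close>

lemma half_chi_mgf_bound:
  fixes t :: real
  assumes "\<bar>t\<bar> \<le> 1 / 4"
  shows "exp (- t) / sqrt (1 - 2 * t) \<le> exp (4 * t\<^sup>2)"
proof -
  have pos: "0 < 1 - 2 * t" using assms by (auto simp: abs_le_iff)
  have "\<bar>ln (1 + (- 2 * t)) - (- 2 * t)\<bar> \<le> 2 * (- 2 * t)\<^sup>2"
    by (rule abs_ln_one_plus_x_minus_x_bound) (use assms in simp)
  then have "- t - ln (1 - 2 * t) / 2 \<le> 4 * t\<^sup>2" by (simp add: power2_eq_square abs_le_iff)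
  then have le: "exp (- t - ln (1 - 2 * t) / 2) \<le> exp (4 * t\<^sup>2)" by simp
  have "exp (ln (1 - 2 * t) / 2) = sqrt (1 - 2 * t)"
    unfolding ln_sqrt[OF less_imp_le[OF pos], symmetric] by (rule exp_ln) (use pos in simp)
  with le show ?thesis unfolding exp_diff by metis
qed

lemma nn_integral_normal_density:
  "0 < \<sigma> \<Longrightarrow> (\<integral>\<^sup>+x. ennreal (normal_density m \<sigma> x) \<partial>lborel) = 1"
  by (subst nn_integral_eq_integral) auto

lemma normal_square_mgf:
  assumes D: "distributed M lborel X (\<lambda>x. ennreal (normal_density 0 (sqrt v) x))"
    and v: "0 < v" "\<bar>s\<bar> * v \<le> 1 / 4"
  shows "(\<integral>\<^sup>+z. ennreal (exp (s * ((X z)\<^sup>2 - v))) \<partial>M) \<le> ennreal (exp (4 * (s * v)\<^sup>2))"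
proof -
  define w where "w = 1 - 2 * (s * v)"
  have "\<bar>s * v\<bar> \<le> 1 / 4" using v by (simp add: abs_mult)
  then have w: "0 < w" by (auto simp: w_def abs_le_iff)
  \<comment> \<open>Tilting by the square changes the variance from \<open>v\<close> to
    \<open>v / w\<close> and leaves a constant factor.\<close>
  have eq: "normal_density 0 (sqrt v) x * exp (s * (x\<^sup>2 - v)) = exp (- (s * v)) / sqrt w * normal_density 0 (sqrt (v / w)) x" for x
  proof -
    have "- x\<^sup>2 / (2 * v) + s * (x\<^sup>2 - v) = - (s * v) + - x\<^sup>2 / (2 * (v / w))"
      using v w by (simp add: field_simps) (simp add: w_def algebra_simps)
    then have "exp (- x\<^sup>2 / (2 * v)) * exp (s * (x\<^sup>2 - v)) = exp (- (s * v)) * exp (- x\<^sup>2 / (2 * (v / w)))"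
      by (simp only: exp_add[symmetric])
    moreover have "sqrt (2 * pi * v) = sqrt w * sqrt (2 * pi * (v / w))"
      using w by (simp add: real_sqrt_mult[symmetric])
    ultimately show ?thesis
      using v w unfolding normal_density_def
      by (simp add: real_sqrt_pow2 field_simps)
  qed
  have "(\<integral>\<^sup>+z. ennreal (exp (s * ((X z)\<^sup>2 - v))) \<partial>M)
      = (\<integral>\<^sup>+x. ennreal (normal_density 0 (sqrt v) x) * ennreal (exp (s * (x\<^sup>2 - v))) \<partial>lborel)"
    by (rule distributed_nn_integral[OF D, symmetric]) auto
  also have "\<dots> = (\<integral>\<^sup>+x. ennreal (exp (- (s * v)) / sqrt w) * ennreal (normal_density 0 (sqrt (v / w)) x) \<partial>lborel)"
    using eq w by (intro nn_integral_cong) (simp add: ennreal_mult'[symmetric])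
  also have "\<dots> = ennreal (exp (- (s * v)) / sqrt w)"
    using v w by (subst nn_integral_cmult) (auto simp: nn_integral_normal_density)
  also have "\<dots> \<le> ennreal (exp (4 * (s * v)\<^sup>2))"
    unfolding w_def by (intro ennreal_leI half_chi_mgf_bound) (use v in \<open>simp add: abs_mult\<close>)
  finally show ?thesis .
qed

text \<open>The blocks let one statement cover two groupings of the noise array: columns, for the
  Gram matrix, and rows, for the inner products with the mean vector.\<close>

lemma chi_square_mgf:
  fixes c :: "'i \<Rightarrow> real" and B :: "'k \<Rightarrow> 'i set"
  assumes K: "finite K" and B: "\<And>k. k \<in> K \<Longrightarrow> finite (B k)" "\<And>k. k \<in> K \<Longrightarrow> B k \<subseteq> P"
    "disjoint_family_on B K"
    and v: "\<And>k. k \<in> K \<Longrightarrow> (\<Sum>p\<in>B k. (c p)\<^sup>2) = v" "0 \<le> v" "\<bar>s\<bar> * v \<le> 1 / 4"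
  shows "(\<integral>\<^sup>+z. ennreal (exp (s * (\<Sum>k\<in>K. (\<Sum>p\<in>B k. c p * z p)\<^sup>2 - v))) \<partial>gauss P)
     \<le> ennreal (exp (4 * (s * v)\<^sup>2 * card K))"
proof (cases "v = 0 \<or> K = {}")
  \<comment> \<open>With \<open>v = 0\<close> all coefficients vanish; the density argument of the
    other case requires positive variance.\<close>
  case True
  have "c p = 0" if "k \<in> K" "p \<in> B k" for k p
    using v(1)[OF that(1)] True B(1)[OF that(1)] that sum_nonneg_eq_0_iff[of "B k" "\<lambda>p. (c p)\<^sup>2"] by auto
  then have "(\<Sum>k\<in>K. (\<Sum>p\<in>B k. c p * z p)\<^sup>2 - v) = 0" for z :: "'i \<Rightarrow> real"
    using True by (auto intro!: sum.neutral)
  then show ?thesis using prob_space.emeasure_space_1[OF prob_space_gauss, of P] by simp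
next
  case False
  then have v0: "0 < v" and K0: "K \<noteq> {}" using v(2) by auto
  interpret prob_space "gauss P" by (rule prob_space_gauss)
  have P0: "P \<noteq> {}"
    using K0 v(1) v0 B(2) by fastforce
  let ?N = "\<lambda>k z. \<Sum>p\<in>B k. c p * z p"
  have "indep_vars (\<lambda>k. PiM (B k) (\<lambda>_. borel)) (\<lambda>k z. restrict (\<lambda>p. z p) (B k)) K"
    by (rule indep_vars_restrict[OF coord_indep[OF P0] B(2,3)])
  then have "indep_vars (\<lambda>_. borel) (\<lambda>k z. ?N k (restrict (\<lambda>p. z p) (B k))) K"
    by (rule indep_vars_compose2[where Y = ?N]) (auto intro!: borel_measurable_sum borel_measurable_times)
  then have "indep_vars (\<lambda>_. borel) ?N K"
    by (rule indep_vars_cong[THEN iffD1, rotated -1]) auto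
  then have ind: "indep_vars (\<lambda>_. borel) (\<lambda>k z. ennreal (exp (s * ((?N k z)\<^sup>2 - v)))) K"
    by (rule indep_vars_compose2[where Y = "\<lambda>k x. ennreal (exp (s * (x\<^sup>2 - v)))"]) auto
  have "(\<integral>\<^sup>+z. ennreal (exp (s * (\<Sum>k\<in>K. (?N k z)\<^sup>2 - v))) \<partial>gauss P)
      = (\<integral>\<^sup>+z. (\<Prod>k\<in>K. ennreal (exp (s * ((?N k z)\<^sup>2 - v)))) \<partial>gauss P)"
    using K by (simp add: sum_distrib_left exp_sum prod_ennreal)
  also have "\<dots> = (\<Prod>k\<in>K. \<integral>\<^sup>+z. ennreal (exp (s * ((?N k z)\<^sup>2 - v))) \<partial>gauss P)"
    by (rule indep_vars_nn_integral[OF K ind]) auto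
  also have "\<dots> \<le> (\<Prod>k\<in>K. ennreal (exp (4 * (s * v)\<^sup>2)))"
    by (intro prod_mono_ennreal normal_square_mgf[OF linear_comb_distributed] B v v0)
  also have "\<dots> = ennreal (exp (4 * (s * v)\<^sup>2 * card K))"
    by (simp add: ennreal_power exp_of_nat_mult[symmetric] mult.commute)
  finally show ?thesis .
qed

lemma (in prob_space) exp_markov:
  assumes [measurable]: "W \<in> borel_measurable M"
    and "(\<integral>\<^sup>+z. ennreal (exp (W z)) \<partial>M) \<le> ennreal b"
  shows "prob {z\<in>space M. t \<le> W z} \<le> exp (- t) * b"
proof -
  have "emeasure M {z\<in>space M. t \<le> W z} = emeasure M {z\<in>space M. 1 \<le> ennreal (exp (- t)) * ennreal (exp (W z))}"
    by (rule arg_cong[where f = "emeasure M"])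
      (auto simp: ennreal_mult'[symmetric] exp_add[symmetric] ennreal_1[symmetric] simp del: ennreal_1)
  also have "\<dots> \<le> ennreal (exp (- t)) * (\<integral>\<^sup>+z. ennreal (exp (W z)) * indicator (space M) z \<partial>M)"
    by (rule nn_integral_Markov_inequality) auto
  also have "(\<integral>\<^sup>+z. ennreal (exp (W z)) * indicator (space M) z \<partial>M) = (\<integral>\<^sup>+z. ennreal (exp (W z)) \<partial>M)"
    by (intro nn_integral_cong) auto
  also have "ennreal (exp (- t)) * \<dots> \<le> ennreal (exp (- t)) * ennreal b"
    by (intro mult_left_mono assms) auto
  finally have *: "emeasure M {z\<in>space M. t \<le> W z} \<le> ennreal (exp (- t) * b)"
    by (simp add: ennreal_mult')
  show ?thesis
  proof (cases "0 \<le> b")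
    case True
    then show ?thesis using * by (simp add: emeasure_eq_measure)
  next
    \<comment> \<open>For \<open>b < 0\<close> the value \<open>ennreal b\<close> is 0, which
      contradicts the positivity of \<open>exp\<close>.\<close>
    case False
    then have "(\<integral>\<^sup>+z. ennreal (exp (W z)) \<partial>M) = 0" using assms(2) by (simp add: ennreal_neg)
    then have "AE z in M. False" by (simp add: nn_integral_0_iff_AE ennreal_eq_0_iff)
    then show ?thesis by simp
  qed
qed

text \<open>Chernoff's method with parameters \<open>s\<close> and \<open>- s\<close>. The parameter
  stays free because a good choice depends on the ratio of \<open>n\<close> to \<open>d\<close> in
  one use and on \<open>v\<close> in the other.\<close>

lemma chi_square_tail:
  fixes c :: "'i \<Rightarrow> real" and B :: "'k \<Rightarrow> 'i set"
  assumes "finite K" "\<And>k. k \<in> K \<Longrightarrow> finite (B k)" "\<And>k. k \<in> K \<Longrightarrow> B k \<subseteq> P"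
    "disjoint_family_on B K"
    and "\<And>k. k \<in> K \<Longrightarrow> (\<Sum>p\<in>B k. (c p)\<^sup>2) = v" "0 \<le> v" and s: "0 < s" "s * v \<le> 1 / 4"
  shows "measure (gauss P) {z\<in>space (gauss P). t \<le> \<bar>\<Sum>k\<in>K. (\<Sum>p\<in>B k. c p * z p)\<^sup>2 - v\<bar>}
     \<le> 2 * exp (4 * (s * v)\<^sup>2 * card K - s * t)"
proof -
  interpret prob_space "gauss P" by (rule prob_space_gauss)
  let ?Q = "\<lambda>z. \<Sum>k\<in>K. (\<Sum>p\<in>B k. c p * z p)\<^sup>2 - v"
  have [measurable]: "?Q \<in> borel_measurable (gauss P)"
    using assms(3) by (intro borel_measurable_sum borel_measurable_diff borel_measurable_power
      borel_measurable_times coord_measurable) auto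
  have *: "prob {z\<in>space (gauss P). s * t \<le> r * ?Q z} \<le> exp (- (s * t)) * exp (4 * (s * v)\<^sup>2 * card K)"
    if "r = s \<or> r = - s" for r
  proof (rule exp_markov)
    have r: "\<bar>r\<bar> = s" "(r * v)\<^sup>2 = (s * v)\<^sup>2" using that s by auto
    show "(\<integral>\<^sup>+z. ennreal (exp (r * ?Q z)) \<partial>gauss P) \<le> ennreal (exp (4 * (s * v)\<^sup>2 * card K))"
      unfolding r(2)[symmetric] by (rule chi_square_mgf) (use assms r in auto)
  qed measurable
  have "{z\<in>space (gauss P). t \<le> \<bar>?Q z\<bar>} = {z\<in>space (gauss P). s * t \<le> s * ?Q z} \<union> {z\<in>space (gauss P). s * t \<le> (- s) * ?Q z}"
  proof -
    have "t \<le> \<bar>x\<bar> \<longleftrightarrow> s * t \<le> s * x \<or> s * t \<le> (- s) * x" for x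
      using mult_le_cancel_left_pos[OF s(1), of t x] mult_le_cancel_left_pos[OF s(1), of t "- x"] by auto
    then show ?thesis by blast
  qed
  then have "prob {z\<in>space (gauss P). t \<le> \<bar>?Q z\<bar>}
      \<le> prob {z\<in>space (gauss P). s * t \<le> s * ?Q z} + prob {z\<in>space (gauss P). s * t \<le> (- s) * ?Q z}"
    by (simp only:) (rule measure_Un_le; measurable)
  also have "\<dots> \<le> 2 * (exp (- (s * t)) * exp (4 * (s * v)\<^sup>2 * card K))"
    using *[of s] *[of "- s"] by simp
  finally show ?thesis by (simp add: exp_add[symmetric] algebra_simps)
qed

subsection \<open>Operator norms from lattice points\<close>

text \<open>With this spacing, rounding all \<open>n\<close> coordinates moves a vector by at most
  1/4 in norm, while a ball of fixed radius holds only exponentially many points in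
  \<open>n\<close>.\<close>

definition lat :: "nat \<Rightarrow> (nat \<Rightarrow> int) \<Rightarrow> nat \<Rightarrow> real" where
  "lat n k = (\<lambda>i. of_int (k i) / (4 * sqrt n))"

lemma lat_add: "lat n (\<lambda>i. k i + l i) = (\<lambda>i. lat n k i + lat n l i)"
  by (simp add: lat_def add_divide_distrib)

lemma lat_diff: "lat n (\<lambda>i. k i - l i) = (\<lambda>i. lat n k i - lat n l i)"
  by (simp add: lat_def diff_divide_distrib)

lemma nrm_lat_sq: "0 < n \<Longrightarrow> (nrm n (lat n k))\<^sup>2 = of_int (\<Sum>i<n. (k i)\<^sup>2) / (16 * real n)"
  unfolding nrm_sq by (simp add: sqnorm_def lat_def power_divide power_mult_distrib sum_divide_distrib)

lemma lat_approx:
  assumes "0 < n"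
  obtains k where "nrm n (\<lambda>i. x i - lat n k i) \<le> 1 / 4"
proof -
  define k where "k i = \<lfloor>4 * sqrt n * x i\<rfloor>" for i
  have "\<bar>x i - lat n k i\<bar> \<le> 1 / (4 * sqrt n)" for i
  proof -
    have "x i - lat n k i = (4 * sqrt n * x i - of_int (k i)) / (4 * sqrt n)"
      using assms by (simp add: lat_def field_simps)
    moreover have "\<bar>4 * sqrt n * x i - of_int (k i)\<bar> \<le> 1"
      unfolding k_def by linarith
    ultimately show ?thesis
      using assms by (simp add: abs_divide divide_right_mono)
  qed
  then have "nrm n (\<lambda>i. \<bar>x i - lat n k i\<bar>) \<le> nrm n (\<lambda>i. 1 / (4 * sqrt n))"
    by (intro L2_set_mono) auto
  then have "nrm n (\<lambda>i. x i - lat n k i) \<le> 1 / 4"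
    using assms by (simp add: L2_set_constant) (simp add: L2_set_def)
  then show ?thesis by (rule that)
qed

text \<open>By polarization a bound for the quadratic form on the lattice points of norm at most 5/2
  bounds the bilinear form on those of norm at most 5/4, as the lattice is closed under sums and
  differences.\<close>

lemma opb_of_lattice:
  assumes n: "0 < n" and sym: "\<And>i j. A i j = A j i"
    and net: "\<And>k. nrm n (lat n k) \<le> 5 / 2 \<Longrightarrow> \<bar>inn n (lat n k) (mat_vec n A (lat n k))\<bar> \<le> \<tau>"
  shows "opb n A (2 * \<tau>)"
proof -
  let ?b = "\<lambda>w v. inn n w (mat_vec n A v)"
  define S where "S = {\<bar>?b w v\<bar> |w v. nrm n w \<le> 1 \<and> nrm n v \<le> 1}"
  \<comment> \<open>The best constant of the bilinear form. It must be finite before a bound of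
    \<open>\<beta>\<close> in terms of itself can be solved.\<close>
  define \<beta> where "\<beta> = Sup S"
  have bsym: "?b w v = ?b v w" for w v
  proof -
    have "?b w v = (\<Sum>i<n. \<Sum>j<n. w i * A i j * v j)"
      by (simp add: inn_def mat_vec_def sum_distrib_left mult.assoc)
    also have "\<dots> = (\<Sum>j<n. \<Sum>i<n. w i * A i j * v j)" by (rule sum.swap)
    also have "\<dots> = ?b v w"
      unfolding inn_def mat_vec_def sum_distrib_left
    proof (intro sum.cong refl)
      fix i j
      show "w i * A i j * v j = v j * (A j i * w i)" using sym[of i j] by simp
    qed
    finally show ?thesis .
  qed
  have bdd: "bdd_above S"
  proof (rule bdd_aboveI)
    fix r assume "r \<in> S"
    then obtain w v where r: "r = \<bar>?b w v\<bar>" and wv: "nrm n w \<le> 1" "nrm n v \<le> 1" by (auto simp: S_def)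
    have "\<bar>w i * (A i j * v j)\<bar> \<le> \<bar>A i j\<bar>" if "i < n" "j < n" for i j
    proof -
      have "\<bar>w i\<bar> \<le> 1" "\<bar>v j\<bar> \<le> 1"
        using component_le_nrm[OF that(1), of w] component_le_nrm[OF that(2), of v] wv by auto
      then have "\<bar>w i\<bar> * (\<bar>A i j\<bar> * \<bar>v j\<bar>) \<le> 1 * (\<bar>A i j\<bar> * 1)" by (intro mult_mono) auto
      then show ?thesis by (simp add: abs_mult)
    qed
    then show "r \<le> (\<Sum>i<n. \<Sum>j<n. \<bar>A i j\<bar>)"
      unfolding r inn_def mat_vec_def sum_distrib_left
      by (intro order_trans[OF sum_abs] sum_mono order_trans[OF sum_abs]) auto
  qed
  have S0: "0 \<in> S"
    by (simp add: S_def) (intro exI[of _ "\<lambda>_. 0"] conjI, auto simp: inn_def L2_set_def)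
  have \<beta>0: "0 \<le> \<beta>" unfolding \<beta>_def by (rule cSup_upper[OF S0 bdd])
  have hom: "\<bar>?b w v\<bar> \<le> \<beta> * nrm n w * nrm n v" for w v
  proof (cases "nrm n w = 0 \<or> nrm n v = 0")
    case True
    then show ?thesis
    proof
      assume "nrm n w = 0"
      then show ?thesis using inn_le_nrm[of n w "mat_vec n A v"] by simp
    next
      assume "nrm n v = 0"
      then show ?thesis unfolding bsym[of w v] using inn_le_nrm[of n v "mat_vec n A w"] by simp
    qed
  next
    case False
    then have pos: "0 < nrm n w" "0 < nrm n v" by (auto simp: order_less_le)
    have "?b (\<lambda>i. (1 / nrm n w) * w i) (\<lambda>i. (1 / nrm n v) * v i) = (1 / nrm n w) * ((1 / nrm n v) * ?b w v)"
      by (simp only: mat_vec_scale inn_scale_left inn_scale_right)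
    moreover have "\<bar>?b (\<lambda>i. (1 / nrm n w) * w i) (\<lambda>i. (1 / nrm n v) * v i)\<bar> \<le> \<beta>"
      unfolding \<beta>_def
    proof (rule cSup_upper[OF _ bdd])
      have "nrm n (\<lambda>i. (1 / nrm n w) * w i) \<le> 1" "nrm n (\<lambda>i. (1 / nrm n v) * v i) \<le> 1"
        using pos unfolding nrm_scale by auto
      then show "\<bar>?b (\<lambda>i. (1 / nrm n w) * w i) (\<lambda>i. (1 / nrm n v) * v i)\<bar> \<in> S"
        unfolding S_def by blast
    qed
    ultimately have "\<bar>(1 / nrm n w) * ((1 / nrm n v) * ?b w v)\<bar> \<le> \<beta>" by simp
    then show ?thesis using pos by (simp add: abs_mult field_simps)
  qed
  \<comment> \<open>The form is split at nearby lattice points: polarization gives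
    \<open>\<tau> / 2\<close> there, and the two remainders give \<open>\<beta> / 4\<close> and
    \<open>5 / 16 * \<beta>\<close>. Solving for \<open>\<beta>\<close> gives
    \<open>8 / 7 * \<tau>\<close>, below \<open>2 * \<tau>\<close>.\<close>
  have "r \<le> \<tau> / 2 + 9 / 16 * \<beta>" if rS: "r \<in> S" for r
  proof -
    obtain w v where r: "r = \<bar>?b w v\<bar>" and wv: "nrm n w \<le> 1" "nrm n v \<le> 1"
      using rS unfolding S_def by blast
    obtain k where k: "nrm n (\<lambda>i. w i - lat n k i) \<le> 1 / 4" using lat_approx[OF n] by blast
    obtain l where l: "nrm n (\<lambda>i. v i - lat n l i) \<le> 1 / 4" using lat_approx[OF n] by blast
    let ?k = "lat n k" and ?l = "lat n l"
    have k5: "nrm n ?k \<le> 5 / 4" using nrm_ge_diff[of ?k n w] k wv nrm_diff_commute[of ?k w n] by simp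
    have l5: "nrm n ?l \<le> 5 / 4" using nrm_ge_diff[of ?l n v] l wv nrm_diff_commute[of ?l v n] by simp
    have plus: "\<bar>?b (\<lambda>i. ?k i + ?l i) (\<lambda>i. ?k i + ?l i)\<bar> \<le> \<tau>"
      using net[of "\<lambda>i. k i + l i"] k5 l5 L2_set_triangle_ineq[of ?k ?l "{..<n}"] by (simp add: lat_add)
    have minus: "\<bar>?b (\<lambda>i. ?k i - ?l i) (\<lambda>i. ?k i - ?l i)\<bar> \<le> \<tau>"
      using net[of "\<lambda>i. k i - l i"] k5 l5 nrm_diff_le[of ?k ?l n] by (simp add: lat_diff)
    have "4 * ?b ?k ?l = ?b (\<lambda>i. ?k i + ?l i) (\<lambda>i. ?k i + ?l i) - ?b (\<lambda>i. ?k i - ?l i) (\<lambda>i. ?k i - ?l i)"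
      unfolding mat_vec_add mat_vec_diff inn_add_left inn_add_right inn_diff_left inn_diff_right
      using bsym[of ?k ?l] by simp
    moreover have "4 * x = p - m \<Longrightarrow> \<bar>p\<bar> \<le> \<tau> \<Longrightarrow> \<bar>m\<bar> \<le> \<tau> \<Longrightarrow> \<bar>x\<bar> \<le> \<tau> / 2" for x p m
      by linarith
    ultimately have kl: "\<bar>?b ?k ?l\<bar> \<le> \<tau> / 2" using plus minus by blast
    have "?b w v = ?b ?k ?l + ?b (\<lambda>i. w i - ?k i) v + ?b ?k (\<lambda>i. v i - ?l i)"
      unfolding mat_vec_diff inn_diff_left inn_diff_right by simp
    moreover have "\<bar>?b (\<lambda>i. w i - ?k i) v\<bar> \<le> \<beta> * (1 / 4) * 1"
      using k wv \<beta>0 by (intro order_trans[OF hom] mult_mono) auto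
    moreover have "\<bar>?b ?k (\<lambda>i. v i - ?l i)\<bar> \<le> \<beta> * (5 / 4) * (1 / 4)"
      using l k5 \<beta>0 by (intro order_trans[OF hom] mult_mono) auto
    moreover have "x = p + a + b \<Longrightarrow> \<bar>a\<bar> \<le> \<beta> * (1 / 4) * 1 \<Longrightarrow> \<bar>b\<bar> \<le> \<beta> * (5 / 4) * (1 / 4) \<Longrightarrow>
        \<bar>p\<bar> \<le> \<tau> / 2 \<Longrightarrow> \<bar>x\<bar> \<le> \<tau> / 2 + 9 / 16 * \<beta>" for x p a b
      by linarith
    ultimately show ?thesis unfolding r using kl by blast
  qed
  then have "\<beta> \<le> \<tau> / 2 + 9 / 16 * \<beta>" unfolding \<beta>_def using S0 by (intro cSup_least) auto
  then have "\<beta> \<le> 2 * \<tau>" using \<beta>0 by simp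
  then show ?thesis by (rule opb_mono[OF opbI[OF hom]])
qed

text \<open>These are the lattice points of norm at most 5/2, the squared norm being the sum divided
  by \<open>16 * n\<close>. The box supplies the product set over which the count
  factorises.\<close>

definition net :: "nat \<Rightarrow> (nat \<Rightarrow> int) set" where
  "net n = {k \<in> PiE {..<n} (\<lambda>_. {- int (100 * n)..int (100 * n)}). (\<Sum>i<n. (k i)\<^sup>2) \<le> 100 * int n}"

lemma finite_net: "finite (net n)"
  unfolding net_def by (rule finite_subset[of _ "PiE {..<n} (\<lambda>_. {- int (100 * n)..int (100 * n)})"]) (auto intro: finite_PiE)

lemma net_covers:
  assumes "0 < n" "nrm n (lat n k) \<le> 5 / 2"
  shows "restrict k {..<n} \<in> net n" "\<And>i. i < n \<Longrightarrow> lat n (restrict k {..<n}) i = lat n k i"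
proof -
  have "(nrm n (lat n k))\<^sup>2 \<le> (5 / 2)\<^sup>2" using assms(2) by (intro power_mono) auto
  then have "of_int (\<Sum>i<n. (k i)\<^sup>2) \<le> (of_int (100 * int n) :: real)"
    using assms(1) unfolding nrm_lat_sq[OF assms(1)] by (simp add: field_simps power2_eq_square)
  then have sum: "(\<Sum>i<n. (k i)\<^sup>2) \<le> 100 * int n" by (simp only: of_int_le_iff)
  have "\<bar>k i\<bar> \<le> 100 * int n" if "i < n" for i
  proof -
    have "(k i)\<^sup>2 \<le> (\<Sum>i<n. (k i)\<^sup>2)" using that by (intro member_le_sum) auto
    moreover have "\<bar>k i\<bar> \<le> (k i)\<^sup>2"
      using mult_left_mono[of 1 "\<bar>k i\<bar>" "\<bar>k i\<bar>"] by (cases "k i = 0") (auto simp: power2_eq_square)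
    ultimately show ?thesis using sum by linarith
  qed
  then show "restrict k {..<n} \<in> net n" using sum by (force simp: net_def abs_le_iff)
  show "\<And>i. i < n \<Longrightarrow> lat n (restrict k {..<n}) i = lat n k i" by (simp add: lat_def)
qed

lemma sum_half_power_int: "(\<Sum>j\<in>{- int m..int m}. (1 / 2 :: real) ^ nat \<bar>j\<bar>) \<le> 3 - 2 * (1 / 2) ^ m"
proof (induction m)
  case (Suc m)
  have "{- int (Suc m)..int (Suc m)} = insert (- int (Suc m)) (insert (int (Suc m)) {- int m..int m})"
    by auto
  then show ?case using Suc by (simp add: nat_add_distrib)
qed simp

text \<open>Weight each \<open>k\<close> by \<open>exp (100 * n)\<close> times the product of the
  \<open>exp (- (k i)\<^sup>2)\<close>, which is at least 1 on the net. Over the whole box the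
  weights factor into \<open>n\<close> sums over one coordinate, each at most
  \<open>3 \<le> exp 2\<close>.\<close>

lemma card_net: "real (card (net n)) \<le> exp (102 * real n)"
proof -
  let ?I = "{- int (100 * n)..int (100 * n)}"
  have summand: "exp (- (of_int j)\<^sup>2) \<le> (1 / 2 :: real) ^ nat \<bar>j\<bar>" for j :: int
  proof -
    have "\<bar>j\<bar> \<le> j\<^sup>2"
      using mult_left_mono[of 1 "\<bar>j\<bar>" "\<bar>j\<bar>"] by (cases "j = 0") (auto simp: power2_eq_square)
    then have "real_of_int \<bar>j\<bar> \<le> (of_int j)\<^sup>2" by (metis of_int_le_iff of_int_power)
    then have "exp (- (of_int j)\<^sup>2) \<le> exp (- real (nat \<bar>j\<bar>))" by simp
    also have "\<dots> = exp (- 1) ^ nat \<bar>j\<bar>" by (simp add: exp_of_nat_mult[symmetric])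
    also have "exp (- 1 :: real) \<le> 1 / 2"
      using exp_ge_add_one_self[of 1] by (simp add: exp_minus field_simps)
    then have "exp (- 1 :: real) ^ nat \<bar>j\<bar> \<le> (1 / 2) ^ nat \<bar>j\<bar>" by (intro power_mono) auto
    finally show ?thesis .
  qed
  have "(\<Sum>j\<in>?I. exp (- (of_int j)\<^sup>2) :: real) \<le> (\<Sum>j\<in>?I. (1 / 2) ^ nat \<bar>j\<bar>)"
    by (intro sum_mono summand)
  also have "\<dots> \<le> 3 - 2 * (1 / 2) ^ (100 * n)" by (rule sum_half_power_int)
  also have "\<dots> \<le> 3" by simp
  also have "\<dots> \<le> exp 2" using exp_ge_add_one_self[of 2] by simp
  finally have one: "(\<Sum>j\<in>?I. exp (- (of_int j)\<^sup>2) :: real) \<le> exp 2" .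
  have "real (card (net n)) = (\<Sum>k\<in>net n. 1)" by simp
  also have "\<dots> \<le> (\<Sum>k\<in>net n. exp (100 * real n) * (\<Prod>i<n. exp (- (of_int (k i))\<^sup>2)))"
  proof (rule sum_mono)
    fix k assume "k \<in> net n"
    then have "(\<Sum>i<n. (k i)\<^sup>2) \<le> 100 * int n" by (simp add: net_def)
    then have "real_of_int (\<Sum>i<n. (k i)\<^sup>2) \<le> real_of_int (100 * int n)" by (simp only: of_int_le_iff)
    then have "0 \<le> 100 * real n + (\<Sum>i<n. - (real_of_int (k i))\<^sup>2)" by (simp add: sum_negf)
    then show "1 \<le> exp (100 * real n) * (\<Prod>i<n. exp (- (real_of_int (k i))\<^sup>2))"
      by (simp add: exp_sum[symmetric] exp_add[symmetric] del: exp_sum)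
  qed
  also have "\<dots> \<le> (\<Sum>k\<in>PiE {..<n} (\<lambda>_. ?I). exp (100 * real n) * (\<Prod>i<n. exp (- (of_int (k i))\<^sup>2)))"
  proof (rule sum_mono2)
    show "finite (PiE {..<n} (\<lambda>_. ?I))" by (rule finite_PiE) auto
    show "net n \<subseteq> PiE {..<n} (\<lambda>_. ?I)" unfolding net_def by blast
    show "0 \<le> exp (100 * real n) * (\<Prod>i<n. exp (- (real_of_int (k i))\<^sup>2))" for k
      by (rule mult_nonneg_nonneg) (simp_all add: prod_nonneg)
  qed
  also have "\<dots> = exp (100 * real n) * (\<Prod>i<n. \<Sum>j\<in>?I. exp (- (of_int j)\<^sup>2))"
    by (subst prod_sum_PiE) (simp_all add: sum_distrib_left)
  also have "\<dots> \<le> exp (100 * real n) * (\<Prod>i<n. exp 2)"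
    by (intro mult_left_mono prod_mono conjI one sum_nonneg) auto
  also have "\<dots> = exp (102 * real n)"
    by (simp add: exp_of_nat_mult[symmetric] exp_add[symmetric])
  finally show ?thesis .
qed

subsection \<open>The noise Gram matrix\<close>

text \<open>\<open>Z Z\<^sup>T\<close> centred by its mean, \<open>d\<close> times the identity. The
  diagonal is kept here, so that the quadratic form is a sum of independent centred squares.\<close>

definition noise_gram :: "nat \<Rightarrow> (nat \<times> nat \<Rightarrow> real) \<Rightarrow> nat \<Rightarrow> nat \<Rightarrow> real" where
  "noise_gram d z i j = (\<Sum>k<d. z (i, k) * z (j, k)) - (if i = j then real d else 0)"

definition noise_form :: "nat \<Rightarrow> nat \<Rightarrow> (nat \<times> nat \<Rightarrow> real) \<Rightarrow> (nat \<Rightarrow> real) \<Rightarrow> real" where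
  "noise_form n d z x = (\<Sum>k<d. (\<Sum>i<n. x i * z (i, k))\<^sup>2 - sqnorm n x)"

text \<open>\<open>2625 = 25 * 105\<close>: with Chernoff parameter \<open>\<rho> / 25\<close> the
  linear term of the exponent is at most \<open>- 105 * n\<close>, enough to beat the
  \<open>exp (102 * n)\<close> points of the net.\<close>

definition gram_bound :: "nat \<Rightarrow> nat \<Rightarrow> real" where
  "gram_bound n d = 2625 * (sqrt (real n * real d) + real n)"

lemma gram_form: "(\<Sum>i<n. \<Sum>j<n. x i * (\<Sum>k<d. z (i, k) * z (j, k)) * x j) = (\<Sum>k<d. (\<Sum>i<n. x i * z (i, k))\<^sup>2)"
  for x :: "nat \<Rightarrow> real"
proof -
  have "(\<Sum>i<n. \<Sum>j<n. x i * (\<Sum>k<d. z (i, k) * z (j, k)) * x j)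
      = (\<Sum>i<n. \<Sum>j<n. \<Sum>k<d. (x i * z (i, k)) * (x j * z (j, k)))"
    unfolding sum_distrib_left sum_distrib_right by (intro sum.cong refl) (simp add: mult_ac)
  also have "\<dots> = (\<Sum>i<n. \<Sum>k<d. \<Sum>j<n. (x i * z (i, k)) * (x j * z (j, k)))"
    by (intro sum.cong refl sum.swap)
  also have "\<dots> = (\<Sum>k<d. \<Sum>i<n. \<Sum>j<n. (x i * z (i, k)) * (x j * z (j, k)))"
    by (rule sum.swap)
  also have "\<dots> = (\<Sum>k<d. (\<Sum>i<n. x i * z (i, k))\<^sup>2)"
    by (simp add: power2_eq_square sum_product)
  finally show ?thesis .
qed

lemma noise_form_eq: "inn n x (mat_vec n (noise_gram d z) x) = noise_form n d z x"
proof -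
  have "inn n x (mat_vec n (noise_gram d z) x)
     = (\<Sum>i<n. \<Sum>j<n. x i * (\<Sum>k<d. z (i, k) * z (j, k)) * x j) - (\<Sum>i<n. \<Sum>j<n. x i * (if i = j then real d else 0) * x j)"
    unfolding inn_def mat_vec_def noise_gram_def sum_distrib_left sum_subtractf[symmetric]
    by (intro sum.cong refl) (simp add: algebra_simps sum_distrib_left sum_distrib_right)
  also have "(\<Sum>i<n. \<Sum>j<n. x i * (if i = j then real d else 0) * x j) = real d * sqnorm n x"
    by (simp add: sqnorm_def if_distrib[of "\<lambda>t. _ * t"] if_distrib[of "\<lambda>t. t * _"] sum_distrib_left power2_eq_square mult_ac cong: if_cong)
  finally show ?thesis unfolding gram_form noise_form_def by (simp add: sum_subtractf)
qed

lemma noise_gram_opb: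
  assumes "0 < n" and "\<And>k. k \<in> net n \<Longrightarrow> \<bar>noise_form n d z (lat n k)\<bar> \<le> \<tau>"
  shows "opb n (noise_gram d z) (2 * \<tau>)"
proof (rule opb_of_lattice[OF assms(1)])
  show "noise_gram d z i j = noise_gram d z j i" for i j
    by (simp add: noise_gram_def mult.commute)
  fix k assume k: "nrm n (lat n k) \<le> 5 / 2"
  have "noise_form n d z (lat n k) = noise_form n d z (lat n (restrict k {..<n}))"
    unfolding noise_form_def sqnorm_def using net_covers(2)[OF assms(1) k] by simp
  then show "\<bar>inn n (lat n k) (mat_vec n (noise_gram d z) (lat n k))\<bar> \<le> \<tau>"
    unfolding noise_form_eq using assms(2)[OF net_covers(1)[OF assms(1) k]] by simp
qed

lemma noise_form_measurable: "(\<lambda>z. noise_form n d z x) \<in> borel_measurable (gauss ({..<n} \<times> {..<d}))"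
  unfolding noise_form_def
  by (intro borel_measurable_sum borel_measurable_diff borel_measurable_power
      borel_measurable_times coord_measurable) auto

lemma noise_form_tail:
  assumes "sqnorm n x \<le> 25 / 4" "0 < n" "0 < d"
  shows "measure (gauss ({..<n} \<times> {..<d})) {z\<in>space (gauss ({..<n} \<times> {..<d})). gram_bound n d \<le> \<bar>noise_form n d z x\<bar>}
    \<le> 2 * exp (real n / 4 - 105 * real n)"
proof -
  \<comment> \<open>Two regimes: 1 for \<open>d \<le> n\<close>, and \<open>sqrt (n / d)\<close>
    beyond. In both, the quadratic cost \<open>\<rho>\<^sup>2 * d\<close> is at most
    \<open>n\<close> and the linear gain at least \<open>n\<close>; dividing by 25 ensures
    \<open>s * v \<le> 1 / 4\<close> for \<open>v \<le> 25 / 4\<close>.\<close>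
  define \<rho> where "\<rho> = min 1 (sqrt (real n / real d))"
  define v where "v = sqnorm n x"
  define s where "s = \<rho> / 25"
  have v: "0 \<le> v" "v \<le> 25 / 4" using assms(1) by (auto simp: v_def sqnorm_def sum_nonneg)
  have \<rho>: "0 < \<rho>" "\<rho> \<le> 1" using assms by (auto simp: \<rho>_def)
  have "\<rho>\<^sup>2 \<le> (sqrt (real n / real d))\<^sup>2" using \<rho> by (intro power_mono) (auto simp: \<rho>_def)
  then have \<rho>2: "\<rho>\<^sup>2 * real d \<le> real n" using assms by (simp add: field_simps)
  have \<rho>3: "real n \<le> \<rho> * (sqrt (real n * real d) + real n)"
  proof (cases "sqrt (real n / real d) \<le> 1")
    case True
    have "sqrt (real n / real d) * sqrt (real n * real d) = real n"
      using assms by (simp add: real_sqrt_mult[symmetric])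
    then show ?thesis using True by (simp add: \<rho>_def min_def algebra_simps)
  next
    case False
    then show ?thesis by (simp add: \<rho>_def min_def)
  qed
  have sv: "s * v \<le> \<rho> / 4" using mult_left_mono[OF v(2), of \<rho>] \<rho> by (simp add: s_def)
  have *: "measure (gauss ({..<n} \<times> {..<d})) {z\<in>space (gauss ({..<n} \<times> {..<d})).
      gram_bound n d \<le> \<bar>\<Sum>k\<in>{..<d}. (\<Sum>p\<in>{..<n} \<times> {k}. x (fst p) * z p)\<^sup>2 - v\<bar>}
    \<le> 2 * exp (4 * (s * v)\<^sup>2 * card {..<d} - s * gram_bound n d)"
  proof (rule chi_square_tail)
    show "disjoint_family_on (\<lambda>k. {..<n} \<times> {k}) {..<d}" by (auto simp: disjoint_family_on_def)
    show "(\<Sum>p\<in>{..<n} \<times> {k}. (x (fst p))\<^sup>2) = v" for k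
      unfolding v_def sqnorm_def by (rule sum.reindex_bij_witness[of _ "\<lambda>i. (i, k)" fst]) auto
    show "s * v \<le> 1 / 4" using sv \<rho> by simp
  qed (use v \<rho> in \<open>auto simp: s_def\<close>)
  have **: "(\<Sum>p\<in>{..<n} \<times> {k}. x (fst p) * z p) = (\<Sum>i<n. x i * z (i, k))" for z :: "nat \<times> nat \<Rightarrow> real" and k
    by (rule sum.reindex_bij_witness[of _ "\<lambda>i. (i, k)" fst]) auto
  have "4 * (s * v)\<^sup>2 * card {..<d} - s * gram_bound n d \<le> real n / 4 - 105 * real n"
  proof -
    have "(s * v)\<^sup>2 \<le> (\<rho> / 4)\<^sup>2" using sv v \<rho> by (intro power_mono) (auto simp: s_def)
    then have "4 * (s * v)\<^sup>2 * d \<le> 4 * (\<rho> / 4)\<^sup>2 * d" by (intro mult_right_mono) auto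
    also have "\<dots> \<le> real n / 4" using \<rho>2 by (simp add: power_divide)
    finally have "4 * (s * v)\<^sup>2 * d \<le> real n / 4" .
    moreover have "105 * real n \<le> s * gram_bound n d"
      using \<rho>3 by (simp add: s_def gram_bound_def algebra_simps)
    ultimately show ?thesis by simp
  qed
  then have "2 * exp (4 * (s * v)\<^sup>2 * card {..<d} - s * gram_bound n d) \<le> 2 * exp (real n / 4 - 105 * real n)"
    by simp
  from order_trans[OF * this] show ?thesis
    unfolding ** noise_form_def v_def .
qed

definition gram_bad :: "nat \<Rightarrow> nat \<Rightarrow> (nat \<times> nat \<Rightarrow> real) set" where
  "gram_bad n d = (\<Union>k\<in>net n. {z\<in>space (gauss ({..<n} \<times> {..<d})). gram_bound n d \<le> \<bar>noise_form n d z (lat n k)\<bar>})"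

lemma gram_bad_sets: "gram_bad n d \<in> sets (gauss ({..<n} \<times> {..<d}))"
  unfolding gram_bad_def
proof (intro sets.finite_UN finite_net)
  fix k
  have [measurable]: "(\<lambda>z. noise_form n d z (lat n k)) \<in> borel_measurable (gauss ({..<n} \<times> {..<d}))"
    by (rule noise_form_measurable)
  show "{z\<in>space (gauss ({..<n} \<times> {..<d})). gram_bound n d \<le> \<bar>noise_form n d z (lat n k)\<bar>} \<in> sets (gauss ({..<n} \<times> {..<d}))"
    by measurable
qed

lemma gram_bad_measure:
  assumes n: "0 < n" and d: "0 < d"
  shows "measure (gauss ({..<n} \<times> {..<d})) (gram_bad n d) \<le> exp (- real n)"
proof -
  interpret prob_space "gauss ({..<n} \<times> {..<d})" by (rule prob_space_gauss)
  let ?E = "\<lambda>k. {z\<in>space (gauss ({..<n} \<times> {..<d})). gram_bound n d \<le> \<bar>noise_form n d z (lat n k)\<bar>}"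
  have meas: "?E k \<in> sets (gauss ({..<n} \<times> {..<d}))" for k
  proof -
    have [measurable]: "(\<lambda>z. noise_form n d z (lat n k)) \<in> borel_measurable (gauss ({..<n} \<times> {..<d}))"
      by (rule noise_form_measurable)
    show ?thesis by measurable
  qed
  have "prob (gram_bad n d) \<le> (\<Sum>k\<in>net n. prob (?E k))"
    unfolding gram_bad_def by (rule finite_measure_subadditive_finite[OF finite_net]) (use meas in blast)
  also have "\<dots> \<le> (\<Sum>k\<in>net n. 2 * exp (real n / 4 - 105 * real n))"
  proof (rule sum_mono, rule noise_form_tail[OF _ n d])
    fix k assume "k \<in> net n"
    then have "(\<Sum>i<n. (k i)\<^sup>2) \<le> 100 * int n" by (simp add: net_def)
    then have "real_of_int (\<Sum>i<n. (k i)\<^sup>2) \<le> real_of_int (100 * int n)" by (simp only: of_int_le_iff)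
    then show "sqnorm n (lat n k) \<le> 25 / 4"
      using n unfolding nrm_sq[symmetric] nrm_lat_sq[OF n] by (simp add: field_simps)
  qed
  also have "\<dots> = real (card (net n)) * (2 * exp (real n / 4 - 105 * real n))" by simp
  \<comment> \<open>The prefactor 2 is absorbed by \<open>exp n\<close>; in total
    \<open>102 + 1 + 1 / 4 - 105\<close> is below \<open>- 1\<close>.\<close>
  also have "\<dots> \<le> exp (102 * real n) * (exp (real n) * exp (real n / 4 - 105 * real n))"
  proof -
    have "(2::real) \<le> exp (real n)" using exp_ge_add_one_self[of "real n"] n by linarith
    then show ?thesis by (intro mult_mono card_net mult_right_mono) auto
  qed
  also have "\<dots> \<le> exp (- real n)" by (simp add: exp_add[symmetric])
  finally show ?thesis .
qed

section \<open>Noise in the direction of the mean vector\<close>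

definition signal_noise :: "nat \<Rightarrow> (nat \<Rightarrow> real) \<Rightarrow> (nat \<times> nat \<Rightarrow> real) \<Rightarrow> nat \<Rightarrow> real" where
  "signal_noise d m z i = (\<Sum>k<d. m k * z (i, k))"

definition signal_bad :: "nat \<Rightarrow> nat \<Rightarrow> (nat \<Rightarrow> real) \<Rightarrow> (nat \<times> nat \<Rightarrow> real) set" where
  "signal_bad n d m = {z\<in>space (gauss ({..<n} \<times> {..<d})).
     9 * real n * sqnorm d m \<le> \<bar>\<Sum>i<n. (signal_noise d m z i)\<^sup>2 - sqnorm d m\<bar>}"

lemma signal_noise_measurable: "i < n \<Longrightarrow> (\<lambda>z. signal_noise d m z i) \<in> borel_measurable (gauss ({..<n} \<times> {..<d}))"
  unfolding signal_noise_def by (intro borel_measurable_sum borel_measurable_times coord_measurable) auto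

lemma signal_bad_sets: "signal_bad n d m \<in> sets (gauss ({..<n} \<times> {..<d}))"
proof -
  have [measurable]: "(\<lambda>z. \<Sum>i<n. (signal_noise d m z i)\<^sup>2 - sqnorm d m) \<in> borel_measurable (gauss ({..<n} \<times> {..<d}))"
    by (intro borel_measurable_sum borel_measurable_diff borel_measurable_power signal_noise_measurable) auto
  show ?thesis unfolding signal_bad_def by measurable
qed

lemma signal_bad_measure:
  assumes n: "0 < n" and m: "0 < sqnorm d m"
  shows "measure (gauss ({..<n} \<times> {..<d})) (signal_bad n d m) \<le> exp (- real n)"
proof -
  define v where "v = sqnorm d m"
  \<comment> \<open>The largest admissible parameter. The exponent becomes
    \<open>n / 4 - 9 * n / 4 = - 2 * n\<close>, and one \<open>n\<close> of it pays for the
    prefactor 2.\<close>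
  define s where "s = 1 / (4 * v)"
  have v: "0 < v" using m by (simp add: v_def)
  have "measure (gauss ({..<n} \<times> {..<d})) {z\<in>space (gauss ({..<n} \<times> {..<d})).
      9 * real n * v \<le> \<bar>\<Sum>i\<in>{..<n}. (\<Sum>p\<in>{i} \<times> {..<d}. m (snd p) * z p)\<^sup>2 - v\<bar>}
    \<le> 2 * exp (4 * (s * v)\<^sup>2 * card {..<n} - s * (9 * real n * v))"
  proof (rule chi_square_tail)
    show "disjoint_family_on (\<lambda>i. {i} \<times> {..<d}) {..<n}" by (auto simp: disjoint_family_on_def)
    show "(\<Sum>p\<in>{i} \<times> {..<d}. (m (snd p))\<^sup>2) = v" for i
      unfolding v_def sqnorm_def by (rule sum.reindex_bij_witness[of _ "\<lambda>k. (i, k)" snd]) auto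
  qed (use v in \<open>auto simp: s_def\<close>)
  moreover have "(\<Sum>p\<in>{i} \<times> {..<d}. m (snd p) * z p) = signal_noise d m z i" for z :: "nat \<times> nat \<Rightarrow> real" and i
    unfolding signal_noise_def by (rule sum.reindex_bij_witness[of _ "\<lambda>k. (i, k)" snd]) auto
  moreover have "4 * (s * v)\<^sup>2 * card {..<n} - s * (9 * real n * v) = - 2 * real n"
    using v by (simp add: s_def power2_eq_square field_simps)
  ultimately have "measure (gauss ({..<n} \<times> {..<d})) (signal_bad n d m) \<le> 2 * exp (- 2 * real n)"
    unfolding signal_bad_def v_def by simp
  also have "\<dots> \<le> exp (real n) * exp (- 2 * real n)"
  proof -
    have "(2::real) \<le> exp (real n)" using exp_ge_add_one_self[of "real n"] n by linarith
    then show ?thesis by (intro mult_right_mono) auto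
  qed
  also have "\<dots> = exp (- real n)" by (simp add: exp_add[symmetric])
  finally show ?thesis .
qed

subsection \<open>Moments of a row\<close>

lemma std_normal_mgf: "(\<integral>\<^sup>+x. ennreal (exp (t * x)) \<partial>std_normal_distribution) = ennreal (exp (t\<^sup>2 / 2))"
proof -
  have eq: "std_normal_density x * exp (t * x) = exp (t\<^sup>2 / 2) * normal_density t 1 x" for x
  proof -
    have "- x\<^sup>2 / 2 + t * x = t\<^sup>2 / 2 + - (x - t)\<^sup>2 / 2" by (simp add: power2_eq_square field_simps)
    then have "exp (- x\<^sup>2 / 2) * exp (t * x) = exp (t\<^sup>2 / 2) * exp (- (x - t)\<^sup>2 / 2)"
      by (simp only: exp_add[symmetric])
    then show ?thesis unfolding normal_density_def by simp
  qed
  have "(\<integral>\<^sup>+x. ennreal (exp (t * x)) \<partial>std_normal_distribution)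
      = (\<integral>\<^sup>+x. ennreal (std_normal_density x) * ennreal (exp (t * x)) \<partial>lborel)"
    by (rule nn_integral_density) auto
  also have "\<dots> = (\<integral>\<^sup>+x. ennreal (exp (t\<^sup>2 / 2)) * ennreal (normal_density t 1 x) \<partial>lborel)"
    by (intro nn_integral_cong) (simp only: ennreal_mult'[symmetric] normal_density_nonneg eq exp_ge_zero)
  also have "\<dots> = ennreal (exp (t\<^sup>2 / 2))"
    by (subst nn_integral_cmult) (auto simp: nn_integral_normal_density)
  finally show ?thesis .
qed

lemma gauss_linear_mgf:
  assumes "finite R"
  shows "(\<integral>\<^sup>+y. ennreal (exp (t * (\<Sum>p\<in>R. c p * y p))) \<partial>gauss R) = ennreal (exp (t\<^sup>2 * (\<Sum>p\<in>R. (c p)\<^sup>2) / 2))"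
proof -
  interpret product_sigma_finite "\<lambda>_. std_normal_distribution"
    using prob_space_std_normal by (simp add: product_sigma_finite_def prob_space_imp_sigma_finite)
  have "(\<integral>\<^sup>+y. ennreal (exp (t * (\<Sum>p\<in>R. c p * y p))) \<partial>gauss R) = (\<integral>\<^sup>+y. (\<Prod>p\<in>R. ennreal (exp ((t * c p) * y p))) \<partial>gauss R)"
    using assms by (simp add: sum_distrib_left exp_sum prod_ennreal mult.assoc)
  also have "\<dots> = (\<Prod>p\<in>R. \<integral>\<^sup>+x. ennreal (exp ((t * c p) * x)) \<partial>std_normal_distribution)"
    by (rule product_nn_integral_prod[OF assms]) auto
  also have "\<dots> = ennreal (\<Prod>p\<in>R. exp ((t * c p)\<^sup>2 / 2))"
    by (simp add: std_normal_mgf prod_ennreal)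
  also have "(\<Prod>p\<in>R. exp ((t * c p)\<^sup>2 / 2)) = exp (t\<^sup>2 * (\<Sum>p\<in>R. (c p)\<^sup>2) / 2)"
    using assms by (simp add: exp_sum[symmetric] power_mult_distrib sum_distrib_left sum_divide_distrib)
  finally show ?thesis .
qed

text \<open>The inequality \<open>e x \<le> exp x\<close>, at \<open>x = s / B\<close> and raised to the power \<open>q\<close>.\<close>

lemma powr_le_exp:
  fixes s :: real
  assumes "0 \<le> s" "0 < B" "0 < q"
  shows "s powr q \<le> B powr q * exp (- q) * exp (q / B * s)"
proof (cases "s = 0")
  case False
  then have s: "0 < s" using assms by simp
  have "s / B \<le> exp (s / B - 1)" using exp_ge_add_one_self[of "s / B - 1"] by simp
  then have "(s / B) powr q \<le> exp (s / B - 1) powr q" using assms by (intro powr_mono2) auto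
  also have "\<dots> = exp (- q) * exp (q / B * s)"
    by (simp add: powr_def exp_add[symmetric] algebra_simps)
  finally have "B powr q * (s / B) powr q \<le> B powr q * (exp (- q) * exp (q / B * s))"
    by (intro mult_left_mono) auto
  then show ?thesis using assms s by (simp add: powr_mult[symmetric])
qed (use assms in simp)

lemma exp_half_powr:
  fixes B :: real
  assumes "0 < q" "0 < B"
  shows "B powr q * exp (q / 2) \<le> (2 * B) powr q"
proof -
  have "(exp (1 / 2 :: real))\<^sup>2 \<le> 2\<^sup>2" using exp_le by (simp add: exp_double[symmetric])
  then have "exp (1 / 2 :: real) \<le> 2" by (rule power2_le_imp_le) simp
  then have "exp (1 / 2) powr q \<le> 2 powr q" using assms by (intro powr_mono2) auto
  then have "exp (q / 2) \<le> 2 powr q" by (simp add: powr_def)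
  then show ?thesis using assms by (simp add: powr_mult mult.commute)
qed

text \<open>An exponential tilt at rate \<open>q / B\<close>: the factor \<open>exp (- q)\<close> of
  \<open>powr_le_exp\<close> cancels the contribution of the mean, and the variance condition bounds
  that of the noise by \<open>exp (q / 2)\<close>. Thus \<open>B\<close> has to dominate the mean
  and \<open>sqrt q\<close> standard deviations.\<close>

lemma gauss_abs_moment:
  assumes R: "finite R" and q: "0 < q" and B: "0 < B" and m: "\<bar>m\<bar> \<le> B"
    and c: "q * (\<Sum>p\<in>R. (c p)\<^sup>2) \<le> B\<^sup>2"
  shows "(\<integral>\<^sup>+y. ennreal (\<bar>m + (\<Sum>p\<in>R. c p * y p)\<bar> powr q) \<partial>gauss R) \<le> ennreal (2 * (2 * B) powr q)"
proof -
  let ?N = "\<lambda>y. \<Sum>p\<in>R. c p * y p"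
  define l where "l = q / B"
  have l: "0 < l" using q B by (simp add: l_def)
  have pt: "\<bar>m + x\<bar> powr q \<le> B powr q * (exp (l * x) + exp ((- l) * x))" for x
  proof -
    have "\<bar>m + x\<bar> powr q \<le> B powr q * exp (- q) * exp (l * \<bar>m + x\<bar>)"
      unfolding l_def by (rule powr_le_exp) (use q B in auto)
    also have "\<dots> \<le> B powr q * exp (- q) * exp (q + l * \<bar>x\<bar>)"
    proof -
      have "l * \<bar>m + x\<bar> \<le> l * (B + \<bar>x\<bar>)" using l m by (intro mult_left_mono) auto
      also have "\<dots> = q + l * \<bar>x\<bar>" using B by (simp add: l_def field_simps)
      finally show ?thesis by (intro mult_left_mono) auto
    qed
    also have "\<dots> = B powr q * exp (l * \<bar>x\<bar>)" by (simp add: exp_add exp_minus)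
    also have "exp (l * \<bar>x\<bar>) \<le> exp (l * x) + exp ((- l) * x)" by (cases "0 \<le> x") auto
    then have "B powr q * exp (l * \<bar>x\<bar>) \<le> B powr q * (exp (l * x) + exp ((- l) * x))"
      by (intro mult_left_mono) auto
    finally show ?thesis .
  qed
  have [measurable]: "?N \<in> borel_measurable (gauss R)"
    by (intro borel_measurable_sum borel_measurable_times coord_measurable) auto
  have "(\<integral>\<^sup>+y. ennreal (\<bar>m + ?N y\<bar> powr q) \<partial>gauss R)
     \<le> (\<integral>\<^sup>+y. ennreal (B powr q) * (ennreal (exp (l * ?N y)) + ennreal (exp ((- l) * ?N y))) \<partial>gauss R)"
  proof (rule nn_integral_mono)
    fix y
    have "ennreal (B powr q) * (ennreal (exp (l * ?N y)) + ennreal (exp ((- l) * ?N y)))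
        = ennreal (B powr q * (exp (l * ?N y) + exp ((- l) * ?N y)))"
      by (simp only: ennreal_plus[symmetric] ennreal_mult'[symmetric] exp_ge_zero powr_ge_zero)
    then show "ennreal (\<bar>m + ?N y\<bar> powr q) \<le> ennreal (B powr q) * (ennreal (exp (l * ?N y)) + ennreal (exp ((- l) * ?N y)))"
      using pt[of "?N y"] ennreal_leI by presburger
  qed
  also have "\<dots> = ennreal (B powr q) * ((\<integral>\<^sup>+y. ennreal (exp (l * ?N y)) \<partial>gauss R) + (\<integral>\<^sup>+y. ennreal (exp ((- l) * ?N y)) \<partial>gauss R))"
    by (subst nn_integral_cmult, measurable, subst nn_integral_add) auto
  also have "\<dots> = ennreal (B powr q * (2 * exp (l\<^sup>2 * (\<Sum>p\<in>R. (c p)\<^sup>2) / 2)))"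
    unfolding gauss_linear_mgf[OF R]
    by (simp add: ennreal_plus[symmetric] ennreal_mult'[symmetric] del: ennreal_plus)
  also have "\<dots> \<le> ennreal (2 * (B powr q * exp (q / 2)))"
  proof (rule ennreal_leI)
    have "l\<^sup>2 * (\<Sum>p\<in>R. (c p)\<^sup>2) = (q / B\<^sup>2) * (q * (\<Sum>p\<in>R. (c p)\<^sup>2))"
      by (simp add: l_def power2_eq_square)
    also have "\<dots> \<le> (q / B\<^sup>2) * B\<^sup>2" using c q by (intro mult_left_mono) auto
    also have "\<dots> = q" using B by simp
    finally have "exp (l\<^sup>2 * (\<Sum>p\<in>R. (c p)\<^sup>2) / 2) \<le> exp (q / 2)" by simp
    then have "B powr q * exp (l\<^sup>2 * (\<Sum>p\<in>R. (c p)\<^sup>2) / 2) \<le> B powr q * exp (q / 2)"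
      by (rule mult_left_mono) simp
    then show "B powr q * (2 * exp (l\<^sup>2 * (\<Sum>p\<in>R. (c p)\<^sup>2) / 2)) \<le> 2 * (B powr q * exp (q / 2))" by simp
  qed
  also have "\<dots> \<le> ennreal (2 * (2 * B) powr q)"
    using exp_half_powr[OF q B] by (intro ennreal_leI) simp
  finally show ?thesis .
qed

text \<open>The truncation looks only at \<open>m z\<close> and \<open>a z\<close>. Where these do
  not depend on the \<open>i\<close>-th sample, the statistic is, given the other samples, either
  zero or the \<open>q\<close>-th power of a Gaussian variable of controlled mean and
  variance.\<close>

definition row_stat :: "nat \<Rightarrow> real \<Rightarrow> real \<Rightarrow> nat \<Rightarrow> ((nat \<times> nat \<Rightarrow> real) \<Rightarrow> real) \<Rightarrow>
    ((nat \<times> nat \<Rightarrow> real) \<Rightarrow> nat \<Rightarrow> real) \<Rightarrow> (nat \<times> nat \<Rightarrow> real) \<Rightarrow> real" where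
  "row_stat d q B i m a z = (if \<bar>m z\<bar> \<le> B \<and> q * sqnorm d (a z) \<le> B\<^sup>2
     then \<bar>m z + (\<Sum>k<d. a z k * z (i, k))\<bar> powr q else 0)"

lemma row_stat_measurable:
  assumes "i < n" and [measurable]: "m \<in> borel_measurable (gauss ({..<n} \<times> {..<d}))"
    and a: "\<And>k. k < d \<Longrightarrow> (\<lambda>z. a z k) \<in> borel_measurable (gauss ({..<n} \<times> {..<d}))"
  shows "row_stat d q B i m a \<in> borel_measurable (gauss ({..<n} \<times> {..<d}))"
proof -
  have [measurable]: "(\<lambda>z. sqnorm d (a z)) \<in> borel_measurable (gauss ({..<n} \<times> {..<d}))"
    unfolding sqnorm_def by (intro borel_measurable_sum borel_measurable_power a) auto
  have [measurable]: "(\<lambda>z. \<Sum>k<d. a z k * z (i, k)) \<in> borel_measurable (gauss ({..<n} \<times> {..<d}))"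
    using assms(1) by (intro borel_measurable_sum borel_measurable_times coord_measurable a) auto
  show ?thesis unfolding row_stat_def[abs_def] by measurable
qed

lemma row_moment:
  assumes i: "i < n" and q: "0 < q" and B: "0 < B"
    and meas: "m \<in> borel_measurable (gauss ({..<n} \<times> {..<d}))"
      "\<And>k. k < d \<Longrightarrow> (\<lambda>z. a z k) \<in> borel_measurable (gauss ({..<n} \<times> {..<d}))"
    and dep: "\<And>z z'. (\<And>j k. j \<noteq> i \<Longrightarrow> z (j, k) = z' (j, k)) \<Longrightarrow> m z = m z'"
      "\<And>z z'. (\<And>j k. j \<noteq> i \<Longrightarrow> z (j, k) = z' (j, k)) \<Longrightarrow> a z = a z'"
  shows "(\<integral>\<^sup>+z. ennreal (row_stat d q B i m a z) \<partial>gauss ({..<n} \<times> {..<d})) \<le> ennreal (2 * (2 * B) powr q)"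
proof -
  interpret product_sigma_finite "\<lambda>_. std_normal_distribution"
    using prob_space_std_normal by (simp add: product_sigma_finite_def prob_space_imp_sigma_finite)
  define R where "R = {i} \<times> {..<d}"
  define I where "I = {..<n} \<times> {..<d} - R"
  have fin: "finite R" "finite I" and disj: "I \<inter> R = {}" by (auto simp: R_def I_def)
  have un: "{..<n} \<times> {..<d} = I \<union> R" using i by (auto simp: R_def I_def)
  let ?f = "\<lambda>z. ennreal (row_stat d q B i m a z)"
  have f: "?f \<in> borel_measurable (gauss (I \<union> R))"
    unfolding un[symmetric] using row_stat_measurable[OF i meas] by measurable
  have "(\<integral>\<^sup>+z. ?f z \<partial>gauss ({..<n} \<times> {..<d})) = (\<integral>\<^sup>+x. (\<integral>\<^sup>+y. ?f (merge I R (x, y)) \<partial>gauss R) \<partial>gauss I)"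
    unfolding un by (rule product_nn_integral_fold[OF disj fin(2,1) f])
  also have "\<dots> \<le> (\<integral>\<^sup>+x. ennreal (2 * (2 * B) powr q) \<partial>gauss I)"
  proof (rule nn_integral_mono)
    fix x :: "nat \<times> nat \<Rightarrow> real"
    \<comment> \<open>\<open>z0\<close> has zeros in row \<open>i\<close>; \<open>m\<close> and
      \<open>a\<close> cannot see the difference, so they are constant in the inner
      integral.\<close>
    define z0 where "z0 = merge I R (x, \<lambda>_. 0)"
    have same: "merge I R (x, y) (j, k) = z0 (j, k)" if "j \<noteq> i" for y :: "nat \<times> nat \<Rightarrow> real" and j k
      using that by (simp add: z0_def merge_def R_def)
    have m0: "m (merge I R (x, y)) = m z0" and a0: "a (merge I R (x, y)) = a z0" for y
      by (rule dep(1), rule same, assumption) (rule dep(2), rule same, assumption)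
    have row: "merge I R (x, y) (i, k) = y (i, k)" if "k < d" for y k
      using that by (simp add: merge_def R_def I_def)
    have sumR: "(\<Sum>k<d. g k * h (i, k)) = (\<Sum>p\<in>R. g (snd p) * h p)" for g :: "nat \<Rightarrow> real" and h :: "nat \<times> nat \<Rightarrow> real"
      unfolding R_def by (rule sum.reindex_bij_witness[of _ snd "\<lambda>k. (i, k)"]) auto
    have sqR: "(\<Sum>p\<in>R. (g (snd p))\<^sup>2) = sqnorm d g" for g
      unfolding R_def sqnorm_def by (rule sum.reindex_bij_witness[of _ "\<lambda>k. (i, k)" snd]) auto
    show "(\<integral>\<^sup>+y. ?f (merge I R (x, y)) \<partial>gauss R) \<le> ennreal (2 * (2 * B) powr q)"
    proof (cases "\<bar>m z0\<bar> \<le> B \<and> q * sqnorm d (a z0) \<le> B\<^sup>2")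
      case True
      then have "?f (merge I R (x, y)) = ennreal (\<bar>m z0 + (\<Sum>p\<in>R. a z0 (snd p) * y p)\<bar> powr q)" for y
        unfolding row_stat_def m0 a0 sumR[symmetric] using row by simp
      then show ?thesis
        using gauss_abs_moment[OF fin(1) q B, of "m z0" "\<lambda>p. a z0 (snd p)"] True by (simp add: sqR)
    next
      case False
      then have "?f (merge I R (x, y)) = 0" for y unfolding row_stat_def m0 a0 by auto
      then show ?thesis by simp
    qed
  qed
  also have "\<dots> = ennreal (2 * (2 * B) powr q)"
    using prob_space.emeasure_space_1[OF prob_space_gauss, of I] by simp
  finally show ?thesis .
qed

lemma (in prob_space) markov_exp_factor:
  assumes [measurable]: "W \<in> borel_measurable M" and "(\<integral>\<^sup>+z. ennreal (W z) \<partial>M) \<le> ennreal b" "0 < b"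
  shows "prob {z\<in>space M. b * exp q \<le> W z} \<le> exp (- q)"
proof -
  have "emeasure M {z\<in>space M. b * exp q \<le> W z} \<le> emeasure M {z\<in>space M. 1 \<le> ennreal (exp (- q) / b) * ennreal (W z)}"
  proof (rule emeasure_mono)
    have ge: "1 \<le> exp (- q) / b * x" if "b * exp q \<le> x" for x
      using that assms(3) by (simp add: exp_minus field_simps)
    have "1 \<le> ennreal (exp (- q) / b * x)" if "b * exp q \<le> x" for x
      using ennreal_leI[OF ge[OF that]] by simp
    then show "{z\<in>space M. b * exp q \<le> W z} \<subseteq> {z\<in>space M. 1 \<le> ennreal (exp (- q) / b) * ennreal (W z)}"
      using assms(3) by (auto simp: ennreal_mult'[symmetric])
  qed measurable
  also have "\<dots> \<le> ennreal (exp (- q) / b) * (\<integral>\<^sup>+z. ennreal (W z) * indicator (space M) z \<partial>M)"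
    by (rule nn_integral_Markov_inequality) auto
  also have "(\<integral>\<^sup>+z. ennreal (W z) * indicator (space M) z \<partial>M) = (\<integral>\<^sup>+z. ennreal (W z) \<partial>M)"
    by (intro nn_integral_cong) auto
  also have "ennreal (exp (- q) / b) * \<dots> \<le> ennreal (exp (- q) / b) * ennreal b"
    by (intro mult_left_mono assms) auto
  also have "\<dots> = ennreal (exp (- q))" using assms(3) by (simp add: ennreal_mult'[symmetric])
  finally show ?thesis by (simp add: emeasure_eq_measure)
qed

definition row_bad :: "nat \<Rightarrow> nat \<Rightarrow> real \<Rightarrow> real \<Rightarrow> (nat \<Rightarrow> (nat \<times> nat \<Rightarrow> real) \<Rightarrow> real) \<Rightarrow>
    (nat \<Rightarrow> (nat \<times> nat \<Rightarrow> real) \<Rightarrow> nat \<Rightarrow> real) \<Rightarrow> (nat \<times> nat \<Rightarrow> real) set" where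
  "row_bad n d q B m a = {z\<in>space (gauss ({..<n} \<times> {..<d})).
     (real n * (2 * (2 * B) powr q)) * exp q \<le> (\<Sum>i<n. row_stat d q B i (m i) (a i) z)}"

lemma row_bad_measure:
  assumes n: "0 < n" and q: "0 < q" and B: "0 < B"
    and meas: "\<And>i. i < n \<Longrightarrow> m i \<in> borel_measurable (gauss ({..<n} \<times> {..<d}))"
      "\<And>i k. i < n \<Longrightarrow> k < d \<Longrightarrow> (\<lambda>z. a i z k) \<in> borel_measurable (gauss ({..<n} \<times> {..<d}))"
    and dep: "\<And>i z z'. (\<And>j k. j \<noteq> i \<Longrightarrow> z (j, k) = z' (j, k)) \<Longrightarrow> m i z = m i z'"
      "\<And>i z z'. (\<And>j k. j \<noteq> i \<Longrightarrow> z (j, k) = z' (j, k)) \<Longrightarrow> a i z = a i z'"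
  shows "row_bad n d q B m a \<in> sets (gauss ({..<n} \<times> {..<d}))"
    "measure (gauss ({..<n} \<times> {..<d})) (row_bad n d q B m a) \<le> exp (- q)"
proof -
  interpret prob_space "gauss ({..<n} \<times> {..<d})" by (rule prob_space_gauss)
  let ?W = "\<lambda>z. \<Sum>i<n. row_stat d q B i (m i) (a i) z"
  have rm: "row_stat d q B i (m i) (a i) \<in> borel_measurable (gauss ({..<n} \<times> {..<d}))" if "i < n" for i
    using row_stat_measurable[OF that meas(1)[OF that] meas(2)[OF that]] .
  have W[measurable]: "?W \<in> borel_measurable (gauss ({..<n} \<times> {..<d}))"
    by (intro borel_measurable_sum rm) auto
  show "row_bad n d q B m a \<in> sets (gauss ({..<n} \<times> {..<d}))"
    unfolding row_bad_def by measurable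
  have nonneg: "0 \<le> row_stat d q B i (m i) (a i) z" for i z by (simp add: row_stat_def)
  have "(\<integral>\<^sup>+z. ennreal (?W z) \<partial>gauss ({..<n} \<times> {..<d})) = (\<integral>\<^sup>+z. (\<Sum>i<n. ennreal (row_stat d q B i (m i) (a i) z)) \<partial>gauss ({..<n} \<times> {..<d}))"
    by (simp add: sum_ennreal nonneg)
  also have "\<dots> = (\<Sum>i<n. \<integral>\<^sup>+z. ennreal (row_stat d q B i (m i) (a i) z) \<partial>gauss ({..<n} \<times> {..<d}))"
    by (rule nn_integral_sum) (use rm in auto)
  also have "\<dots> \<le> (\<Sum>i<n. ennreal (2 * (2 * B) powr q))"
  proof (rule sum_mono)
    fix i assume "i \<in> {..<n}"
    then have i: "i < n" by simp
    show "(\<integral>\<^sup>+z. ennreal (row_stat d q B i (m i) (a i) z) \<partial>gauss ({..<n} \<times> {..<d})) \<le> ennreal (2 * (2 * B) powr q)"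
      using row_moment[OF i q B meas(1)[OF i] meas(2)[OF i] dep] .
  qed
  also have "\<dots> = ennreal (real n * (2 * (2 * B) powr q))"
    by (subst sum_ennreal) auto
  finally show "prob (row_bad n d q B m a) \<le> exp (- q)"
    unfolding row_bad_def by (intro markov_exp_factor W) (use n B in auto)
qed

subsection \<open>The signal-plus-noise model\<close>

text \<open>Guarantees that the sign used in \<open>loo_error\<close> is 1 or -1, never 0.\<close>

lemma leading_inn_nonzero:
  assumes "near_rank_one n ub A \<delta>" "is_leading_unit_eigvec n A u"
  shows "inn n ub u \<noteq> 0"
proof -
  interpret near_rank_one n ub A \<delta> by fact
  show ?thesis
  proof (rule leading_fixpoint[OF assms(2)])
    fix c v
    assume c: "c \<noteq> 0" and v: "v \<in> slice n ub" and u: "\<And>i. u i = c * v i"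
    have "u = (\<lambda>i. c * v i)" using u by blast
    then have "inn n ub u = c" using v by (simp only: inn_scale_right slice_def) simp
    then show ?thesis using c by simp
  qed
qed

text \<open>\<open>360000 = 12 * 30000\<close> makes \<open>\<delta> \<le> 1 / 12\<close>. The
  assumption \<open>q \<le> n\<close> gives \<open>1 / sqrt n \<le> 1 / sqrt q\<close>, so that
  leaving out one sample costs no more than the order of the noise.\<close>

locale signal_model =
  fixes n d :: nat and y mu :: "nat \<Rightarrow> real" and q :: real
  assumes n_pos: "0 < n" and d_pos: "0 < d" and y_pm: "\<And>i. i < n \<Longrightarrow> y i \<in> {-1, 1}"
    and q_def: "q = SNR n d mu" and q_large: "360000 \<le> sqrt q" and q_le: "q \<le> real n"
begin

definition "v = sqnorm d mu"
definition "r = 1 / sqrt q"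
text \<open>The matrix \<open>M z\<close> is within \<open>21017 * r\<close> of rank one on the good
  event; leaving out a sample adds \<open>2 / sqrt n \<le> 2 * r\<close>, and 30000 leaves room for
  both.\<close>

definition "\<delta> = 30000 * r"
definition "lbar = real n * v"
definition "ub = (\<lambda>i. y i / sqrt (real n))"
definition "M z = (\<lambda>i j. hollow (gram d (data_mat y mu z)) i j / lbar)"

abbreviation "sn \<equiv> sqrt (real n)"

lemma sn_pos: "0 < sn" using n_pos by simp

lemma sq_pos: "0 < sqrt q" using q_large by linarith

lemma q_pos: "0 < q" using sq_pos by simp

lemma q_ge_1: "1 \<le> q"
proof -
  have "1 \<le> sqrt q" using q_large by linarith
  then show ?thesis by simp
qed

section \<open>Noise-to-signal ratios controlled by SNR\<close>

lemma v_nonneg: "0 \<le> v" by (simp add: v_def sqnorm_def sum_nonneg)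

lemma v_pos: "0 < v"
  using q_pos v_nonneg unfolding q_def SNR_def v_def[symmetric] by (cases "v = 0") auto

lemma q_eq: "q = v\<^sup>2 / (v + real d / real n)"
  unfolding q_def SNR_def v_def ..

text \<open>Each summand in the denominator of SNR gives one inequality. This one leads to the
  bounds on \<open>1 / sqrt v\<close> and \<open>1 / v\<close>; its companion \<open>q_dn\<close>
  leads to the bound on \<open>sqrt (d / n) / v\<close>.\<close>

lemma q_le_v: "q \<le> v"
proof -
  have "v\<^sup>2 / (v + real d / real n) \<le> v\<^sup>2 / v"
    using v_pos by (intro divide_left_mono mult_pos_pos add_pos_nonneg) auto
  then show ?thesis unfolding q_eq using v_pos by (simp add: power2_eq_square)
qed

lemma q_dn: "q * (real d / real n) \<le> v\<^sup>2"
proof -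
  have p: "0 < v + real d / real n" using v_pos by (intro add_pos_nonneg) auto
  then have "q * (v + real d / real n) = v\<^sup>2" unfolding q_eq by simp
  moreover have "0 \<le> q * v" using q_pos v_pos by simp
  ultimately show ?thesis by (simp add: distrib_left)
qed

lemma r_pos: "0 < r" using sq_pos by (simp add: r_def)

lemma r_le: "r \<le> 1 / 360000" unfolding r_def using q_large sq_pos by (intro divide_left_mono mult_pos_pos) auto

lemma \<delta>_pos: "0 < \<delta>" using r_pos by (simp add: \<delta>_def)

lemma \<delta>_le: "\<delta> \<le> 1 / 12" using r_le by (simp add: \<delta>_def)

lemma inv_sv_le: "1 / sqrt v \<le> r"
  unfolding r_def using q_le_v q_pos v_pos by (intro divide_left_mono) auto

lemma inv_v_le: "1 / v \<le> r"
proof -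
  have "1 / v \<le> 1 / q" using q_le_v q_pos v_pos by (intro divide_left_mono) auto
  also have "sqrt q * 1 \<le> sqrt q * sqrt q" using q_ge_1 sq_pos by (intro mult_left_mono) auto
  then have "1 / q \<le> 1 / sqrt q" using q_pos by (intro divide_left_mono) auto
  finally show ?thesis by (simp add: r_def)
qed

lemma inv_sn_le: "1 / sn \<le> r"
  unfolding r_def using q_le q_pos by (intro divide_left_mono) auto

lemma inv_n_le: "1 / real n \<le> r"
proof -
  have "1 / sn * (1 / sn) \<le> 1 / sn * 1" using n_pos by (intro mult_left_mono) auto
  then have "1 / real n \<le> 1 / sn" using n_pos by (simp add: real_sqrt_mult_self)
  then show ?thesis using inv_sn_le by simp
qed

lemma sdn_le: "sqrt (real d / real n) / v \<le> r"
proof -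
  have "sqrt q * sqrt (real d / real n) \<le> sqrt (v\<^sup>2)"
    unfolding real_sqrt_mult[symmetric] by (rule real_sqrt_le_mono[OF q_dn])
  then have "sqrt q * sqrt (real d / real n) \<le> v" using v_pos by simp
  then show ?thesis unfolding r_def using v_pos sq_pos by (simp add: field_simps)
qed

lemma inv_sv_le_1: "1 / sqrt v \<le> 1" using inv_sv_le r_le by linarith

lemma lbar_pos: "0 < lbar" using n_pos v_pos by (simp add: lbar_def)

lemma y_sq: "i < n \<Longrightarrow> y i * y i = 1" using y_pm[of i] by auto

lemma y_abs: "i < n \<Longrightarrow> \<bar>y i\<bar> = 1" using y_pm[of i] by auto

lemma nrm_y: "nrm n y = sn"
proof -
  have "(\<Sum>i<n. (y i)\<^sup>2) = (\<Sum>i<n. 1)" by (intro sum.cong) (auto simp: power2_eq_square y_sq)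
  then show ?thesis by (simp add: L2_set_def)
qed

lemma nrm_ub: "nrm n ub = 1"
  unfolding ub_def using n_pos by (simp add: nrm_divide nrm_y)

lemma ub_abs: "i < n \<Longrightarrow> \<bar>ub i\<bar> = 1 / sn"
  using n_pos by (simp add: ub_def abs_divide y_abs)

section \<open>Deterministic consequences of the two noise bounds\<close>

definition "good z \<longleftrightarrow> opb n (noise_gram d z) (2 * gram_bound n d) \<and> nrm n (signal_noise d mu z) \<le> 4 * sn * sqrt v"

lemma good_of_not_bad:
  assumes z: "z \<in> space (gauss ({..<n} \<times> {..<d}))" "z \<notin> gram_bad n d" "z \<notin> signal_bad n d mu"
  shows "good z"
proof -
  have "opb n (noise_gram d z) (2 * gram_bound n d)"
  proof (rule noise_gram_opb[OF n_pos])
    fix k assume "k \<in> net n"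
    then show "\<bar>noise_form n d z (lat n k)\<bar> \<le> gram_bound n d"
      using z(1,2) unfolding gram_bad_def by (auto simp: not_le intro: less_imp_le)
  qed
  moreover have "nrm n (signal_noise d mu z) \<le> 4 * sn * sqrt v"
  proof (rule power2_le_imp_le)
    have "(\<Sum>i<n. (signal_noise d mu z i)\<^sup>2 - v) < 9 * real n * v"
      using z(1,3) unfolding signal_bad_def v_def[symmetric] by auto
    then have "sqnorm n (signal_noise d mu z) \<le> 10 * (real n * v)"
      by (simp add: sqnorm_def sum_subtractf)
    also have "\<dots> \<le> 16 * (real n * v)" using v_pos by (intro mult_right_mono) auto
    finally show "(nrm n (signal_noise d mu z))\<^sup>2 \<le> (4 * sn * sqrt v)\<^sup>2"
      unfolding nrm_sq using v_pos by (simp add: power_mult_distrib)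
    show "0 \<le> 4 * sn * sqrt v" using v_pos by simp
  qed
  ultimately show ?thesis by (simp add: good_def)
qed

lemma gram_eq:
  assumes "i < n" "j < n"
  shows "gram d (data_mat y mu z) i j = y i * y j * v + y i * signal_noise d mu z j + signal_noise d mu z i * y j
     + (\<Sum>k<d. z (i, k) * z (j, k))"
proof -
  have "gram d (data_mat y mu z) i j = (\<Sum>k<d. y i * y j * (mu k)\<^sup>2 + y i * (mu k * z (j, k)) + (mu k * z (i, k)) * y j + z (i, k) * z (j, k))"
    unfolding gram_def data_mat_def by (intro sum.cong refl) (simp add: algebra_simps power2_eq_square)
  then show ?thesis
    by (simp add: sum.distrib v_def sqnorm_def signal_noise_def sum_distrib_left sum_distrib_right)
qed

lemma sqrt_nd: "sqrt (real n * real d) = real n * sqrt (real d / real n)"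
proof -
  have "sqrt (real n * real d) = sqrt (real n * real n * (real d / real n))" using n_pos by simp
  then show ?thesis by (simp only: real_sqrt_mult real_sqrt_mult_self abs_of_nat)
qed

lemma M_close:
  assumes "good z"
  shows "opb n (\<lambda>i j. M z i j - ub i * ub j) (21017 * r)"
proof -
  let ?g = "signal_noise d mu z"
  let ?W = "\<lambda>i j. y i * ?g j + ?g i * y j + noise_gram d z i j"
  define \<omega> where "\<omega> = 8 * real n * sqrt v + 2 * gram_bound n d"
  have "opb n ?W (nrm n y * nrm n ?g + nrm n ?g * nrm n y + 2 * gram_bound n d)"
    using assms by (intro opb_add opb_rank_one) (simp add: good_def)
  moreover have "nrm n y * nrm n ?g + nrm n ?g * nrm n y + 2 * gram_bound n d \<le> \<omega>"
  proof -
    have "sn * nrm n ?g \<le> sn * (4 * sn * sqrt v)"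
      using assms by (intro mult_left_mono) (auto simp: good_def)
    also have "\<dots> = 4 * real n * sqrt v" using n_pos by simp
    finally show ?thesis unfolding \<omega>_def nrm_y mult.commute[of _ sn] by simp
  qed
  ultimately have "opb n (hollow ?W) (2 * \<omega>)" by (intro opb_hollow) (rule opb_mono)
  \<comment> \<open>Zeroing the diagonal of \<open>v y y\<^sup>T\<close> subtracts \<open>v\<close>
    times the identity, since \<open>y i * y i = 1\<close>.\<close>
  moreover have "opb n (\<lambda>i j. if i = j then v else 0) v" using v_pos by (intro opb_diag) auto
  ultimately have "opb n (\<lambda>i j. (hollow ?W i j - (if i = j then v else 0)) / lbar) ((2 * \<omega> + v) / lbar)"
    by (intro opb_divide opb_diff lbar_pos)
  then have "opb n (\<lambda>i j. M z i j - ub i * ub j) ((2 * \<omega> + v) / lbar)"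
  proof (rule opb_cong)
    fix i j assume ij: "i < n" "j < n"
    have "ub i * ub j = y i * y j * v / lbar"
      using n_pos v_pos by (simp add: ub_def lbar_def)
    then show "(hollow ?W i j - (if i = j then v else 0)) / lbar = M z i j - ub i * ub j"
      using ij lbar_pos unfolding M_def
      by (auto simp: hollow_def gram_eq noise_gram_def diff_divide_distrib add_divide_distrib y_sq)
  qed
  moreover have "(2 * \<omega> + v) / lbar \<le> 21017 * r"
  proof -
    have "sqrt v / v = 1 / sqrt v" using v_pos by (simp add: real_div_sqrt field_simps)
    \<comment> \<open>The cross terms between mean and noise give 16, the Gram noise gives
      \<open>10500 = 4 * 2625\<close> twice, and the diagonal gives 1; their sum is 21017.\<close>
    then have "(2 * \<omega> + v) / lbar = 16 * (1 / sqrt v) + 10500 * (sqrt (real d / real n) / v) + 10500 * (1 / v) + 1 / real n"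
      using n_pos v_pos unfolding \<omega>_def gram_bound_def sqrt_nd lbar_def
      by (simp add: add_divide_distrib distrib_left)
    also have "\<dots> \<le> 16 * r + 10500 * r + 10500 * r + r"
      using inv_sv_le sdn_le inv_v_le inv_n_le by (intro add_mono mult_left_mono) auto
    finally show ?thesis by simp
  qed
  ultimately show ?thesis by (rule opb_mono)
qed

lemma M_near:
  assumes "good z" "21017 * r \<le> e" "e \<le> 1 / 12"
  shows "near_rank_one n ub (M z) e"
  using opb_mono[OF M_close[OF assms(1)] assms(2)] assms(2,3) r_pos nrm_ub by unfold_locales auto

lemma loo_near:
  assumes "good z" "i < n"
  shows "near_rank_one n ub (loo i (M z)) \<delta>"
proof (rule near_rank_one_loo[OF M_near[OF assms(1) order_refl] assms(2)])
  show "21017 * r \<le> 1 / 12" using r_le by simp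
  show "21017 * r + 2 * \<bar>ub i\<bar> \<le> \<delta>"
    using inv_sn_le r_pos by (simp add: ub_abs[OF assms(2)] \<delta>_def)
qed (rule \<delta>_le)

lemma M_row:
  assumes "good z" "i < n"
  shows "nrm n (M z i) \<le> 2 * \<delta>"
proof -
  have "nrm n (\<lambda>j. M z i j - ub i * ub j) \<le> 21017 * r"
    using opb_row[OF M_close[OF assms(1)] assms(2)] r_pos by simp
  moreover have "nrm n (M z i) - nrm n (\<lambda>j. ub i * ub j) \<le> nrm n (\<lambda>j. M z i j - ub i * ub j)"
    by (rule nrm_ge_diff)
  moreover have "nrm n (\<lambda>j. ub i * ub j) \<le> r"
    unfolding nrm_scale nrm_ub using ub_abs[OF assms(2)] inv_sn_le by simp
  ultimately show ?thesis using r_pos by (simp add: \<delta>_def)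
qed

lemma M_diag: "M z i i = 0" by (simp add: M_def hollow_def)

text \<open>Finitely many power steps replace the leading eigenvector of the leave-one-out matrix: they are
  explicitly measurable in \<open>z\<close>, and the remaining error \<open>2\<^sup>-\<^sup>n\<close> is negligible.\<close>

definition "V i z = ((power_step n ub (loo i (M z))) ^^ n) ub"

text \<open>The \<open>i\<close>-th row of \<open>M z\<close> applied to \<open>w\<close> is an inner product of the \<open>i\<close>-th data vector with
  a vector that is independent of it whenever \<open>w\<close> is.\<close>

definition "proj i w z = (\<lambda>k. (\<Sum>j<n. (w(i := 0)) j * data_mat y mu z j k) / lbar)"

lemma M_row_eq:
  assumes "i < n"
  shows "mat_vec n (M z) w i = y i * inn d mu (proj i w z) + (\<Sum>k<d. proj i w z k * z (i, k))"
proof -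
  let ?X = "data_mat y mu z"
  have "mat_vec n (M z) w i = (\<Sum>j<n. (\<Sum>k<d. ?X i k * ?X j k) * (w(i := 0)) j) / lbar"
    unfolding mat_vec_def M_def sum_divide_distrib by (intro sum.cong refl) (auto simp: hollow_def gram_def)
  also have "(\<Sum>j<n. (\<Sum>k<d. ?X i k * ?X j k) * (w(i := 0)) j) = (\<Sum>j<n. \<Sum>k<d. ?X i k * ((w(i := 0)) j * ?X j k))"
    unfolding sum_distrib_right by (intro sum.cong refl) (simp add: mult_ac)
  also have "\<dots> = (\<Sum>k<d. \<Sum>j<n. ?X i k * ((w(i := 0)) j * ?X j k))" by (rule sum.swap)
  also have "\<dots> / lbar = (\<Sum>k<d. ?X i k * proj i w z k)"
    by (simp add: proj_def sum_distrib_left[symmetric] sum_divide_distrib[symmetric])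
  also have "\<dots> = (\<Sum>k<d. y i * (mu k * proj i w z k) + proj i w z k * z (i, k))"
    by (intro sum.cong refl) (simp add: data_mat_def algebra_simps)
  finally show ?thesis by (simp add: sum.distrib inn_def sum_distrib_left)
qed

text \<open>The squared norm is \<open>noise_form\<close> plus \<open>d\<close> times the squared
  norm of \<open>w\<close>. The constant \<open>110\<^sup>2 = 12100\<close> dominates the
  coefficients 5250 and 1 that arise.\<close>

lemma noise_proj_le:
  assumes "good z"
  shows "nrm d (\<lambda>k. \<Sum>j<n. w j * z (j, k)) \<le> 110 * (sn + sqrt (real d)) * nrm n w"
proof (rule power2_le_imp_le)
  have le: "noise_form n d z w \<le> 2 * gram_bound n d * nrm n w * nrm n w"
    using opb_inn[of n "noise_gram d z" "2 * gram_bound n d" w w] assms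
    unfolding noise_form_eq good_def by (simp add: abs_le_iff)
  have eq: "noise_form n d z w = sqnorm d (\<lambda>k. \<Sum>j<n. w j * z (j, k)) - real d * (nrm n w * nrm n w)"
    unfolding noise_form_def sum_subtractf power2_eq_square[symmetric, of "nrm n w"] nrm_sq
    by (simp add: sqnorm_def[of d])
  have arith: "S - D * (t * t) \<le> 2 * b * t * t \<Longrightarrow> S \<le> (2 * b + D) * t\<^sup>2" for S D t b :: real
    by (simp add: algebra_simps power2_eq_square)
  have "sqnorm d (\<lambda>k. \<Sum>j<n. w j * z (j, k)) \<le> (2 * gram_bound n d + real d) * (nrm n w)\<^sup>2"
    by (rule arith[OF le[unfolded eq]])
  also have "\<dots> \<le> (110 * (sn + sqrt (real d)))\<^sup>2 * (nrm n w)\<^sup>2"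
  proof (rule mult_right_mono)
    have e: "(sn + sqrt (real d))\<^sup>2 = real n + real d + 2 * sqrt (real n * real d)"
      by (simp add: power2_sum real_sqrt_mult)
    have "2 * gram_bound n d + real d \<le> 12100 * (real n + real d + 2 * sqrt (real n * real d))"
      by (simp add: gram_bound_def)
    then show "2 * gram_bound n d + real d \<le> (110 * (sn + sqrt (real d)))\<^sup>2"
      unfolding power_mult_distrib e by simp
  qed simp
  finally show "(nrm d (\<lambda>k. \<Sum>j<n. w j * z (j, k)))\<^sup>2 \<le> (110 * (sn + sqrt (real d)) * nrm n w)\<^sup>2"
    unfolding nrm_sq by (simp add: power_mult_distrib nrm_sq)
  show "0 \<le> 110 * (sn + sqrt (real d)) * nrm n w" by simp
qed

lemma proj_eq:
  "proj i w z = (\<lambda>k. (inn n y (w(i := 0)) * mu k + (\<Sum>j<n. (w(i := 0)) j * z (j, k))) / lbar)"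
  unfolding proj_def inn_def data_mat_def
  by (simp add: distrib_left sum.distrib sum_distrib_left sum_distrib_right mult_ac)

text \<open>The norm of \<open>proj i w z\<close>, the conditional standard deviation of row
  \<open>i\<close> applied to \<open>w\<close>, is at most \<open>221 * r * nrm n w / sn\<close>,
  where \<open>221 = 1 + 110 + 110\<close>. Multiplication by \<open>sqrt q = 1 / r\<close> cancels
  \<open>r\<close>.\<close>

lemma proj_bound:
  assumes "good z" "221 * nrm n w / sn \<le> B"
  shows "q * sqnorm d (proj i w z) \<le> B\<^sup>2"
proof -
  let ?w = "w(i := 0)"
  have w: "nrm n ?w \<le> nrm n w" by (rule nrm_zero_coord)
  have "nrm d (\<lambda>k. inn n y ?w * mu k + (\<Sum>j<n. ?w j * z (j, k))) \<le> nrm d (\<lambda>k. inn n y ?w * mu k) + nrm d (\<lambda>k. \<Sum>j<n. ?w j * z (j, k))"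
    by (rule L2_set_triangle_ineq)
  also have "\<dots> \<le> sn * nrm n w * sqrt v + 110 * (sn + sqrt (real d)) * nrm n w"
  proof (rule add_mono)
    have "\<bar>inn n y ?w\<bar> \<le> sn * nrm n w"
      using inn_le_nrm[of n y ?w] mult_left_mono[OF w, of sn] unfolding nrm_y by simp
    moreover have "nrm d mu = sqrt v" by (simp add: v_def L2_set_def sqnorm_def)
    ultimately show "nrm d (\<lambda>k. inn n y ?w * mu k) \<le> sn * nrm n w * sqrt v"
      unfolding nrm_scale using v_pos by (simp add: mult_right_mono)
    show "nrm d (\<lambda>k. \<Sum>j<n. ?w j * z (j, k)) \<le> 110 * (sn + sqrt (real d)) * nrm n w"
      by (rule order_trans[OF noise_proj_le[OF assms(1)]]) (intro mult_left_mono w, simp)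
  qed
  finally have "nrm d (proj i w z) \<le> (sn * nrm n w * sqrt v + 110 * (sn + sqrt (real d)) * nrm n w) / lbar"
    unfolding proj_eq nrm_divide using lbar_pos by (simp add: divide_right_mono)
  also have "\<dots> = nrm n w / sn * (1 / sqrt v + 110 * (1 / v) + 110 * (sqrt (real d / real n) / v))"
  proof -
    have sv: "sqrt v / v = 1 / sqrt v" using v_pos by (simp add: real_div_sqrt field_simps)
    have s2: "sn / real n = 1 / sn" using n_pos by (simp add: real_div_sqrt field_simps)
    have "(sn * nrm n w * sqrt v + 110 * (sn + sqrt (real d)) * nrm n w) / lbar
       = nrm n w * (sn / real n) * (sqrt v / v) + 110 * nrm n w * (sn / real n) * (1 / v) + 110 * nrm n w * (sqrt (real d) / real n) / v"
      unfolding lbar_def by (simp add: add_divide_distrib distrib_left distrib_right mult_ac)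
    moreover have "sqrt (real d) / real n = 1 / sn * sqrt (real d / real n)"
      using n_pos by (simp add: real_sqrt_divide)
    ultimately show ?thesis unfolding sv s2 by (simp add: algebra_simps)
  qed
  also have "\<dots> \<le> nrm n w / sn * (r + 110 * r + 110 * r)"
    using inv_sv_le inv_v_le sdn_le n_pos by (intro mult_left_mono add_mono) auto
  also have "\<dots> = (221 * nrm n w / sn) * r" by simp
  also have "\<dots> \<le> B * r" using assms(2) r_pos by (intro mult_right_mono) auto
  finally have "(nrm d (proj i w z))\<^sup>2 \<le> (B * r)\<^sup>2" by (intro power_mono) auto
  then have "q * sqnorm d (proj i w z) \<le> q * (B * r)\<^sup>2"
    using q_pos unfolding nrm_sq by (intro mult_left_mono) auto
  also have "\<dots> = B\<^sup>2" using q_pos by (simp add: r_def power_mult_distrib power_divide)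
  finally show ?thesis .
qed

text \<open>The signal part is kept apart: for a deviation from \<open>ub\<close> it is evaluated by
  orthogonality to \<open>y\<close>, for \<open>ub\<close> itself by Cauchy-Schwarz. The other part
  comes from \<open>signal_noise\<close>, with \<open>1 / sqrt v\<close> bounded by 1.\<close>

lemma mean_bound:
  assumes "good z" "i < n"
  shows "\<bar>y i * inn d mu (proj i w z)\<bar> \<le> \<bar>inn n y (w(i := 0))\<bar> / real n + 4 * nrm n w / sn"
proof -
  let ?w = "w(i := 0)"
  have "inn d mu (proj i w z) = (inn n y ?w * v + inn n ?w (signal_noise d mu z)) / lbar"
  proof -
    have "inn d mu (\<lambda>k. \<Sum>j<n. ?w j * z (j, k)) = inn n ?w (signal_noise d mu z)"
      unfolding inn_def signal_noise_def sum_distrib_left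
      by (subst sum.swap) (intro sum.cong refl, simp add: mult_ac)
    moreover have "inn d mu mu = v" by (simp add: inn_def v_def sqnorm_def power2_eq_square)
    ultimately show ?thesis
      unfolding proj_eq inn_divide_right inn_add_right inn_scale_right by simp
  qed
  then have "\<bar>y i * inn d mu (proj i w z)\<bar> = \<bar>inn n y ?w * v + inn n ?w (signal_noise d mu z)\<bar> / lbar"
    using lbar_pos by (simp add: abs_mult y_abs[OF assms(2)] abs_divide)
  also have "\<dots> \<le> (\<bar>inn n y ?w\<bar> * v + nrm n w * (4 * sn * sqrt v)) / lbar"
  proof (rule divide_right_mono)
    have "\<bar>inn n ?w (signal_noise d mu z)\<bar> \<le> nrm n w * (4 * sn * sqrt v)"
      using assms(1) by (intro order_trans[OF inn_le_nrm] mult_mono nrm_zero_coord) (auto simp: good_def)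
    moreover have "\<bar>inn n y ?w * v\<bar> = \<bar>inn n y ?w\<bar> * v" using v_pos by (simp add: abs_mult)
    ultimately show "\<bar>inn n y ?w * v + inn n ?w (signal_noise d mu z)\<bar> \<le> \<bar>inn n y ?w\<bar> * v + nrm n w * (4 * sn * sqrt v)"
      using abs_triangle_ineq[of "inn n y ?w * v" "inn n ?w (signal_noise d mu z)"] by (rule_tac order_trans) auto
  qed (use lbar_pos in simp)
  also have "\<dots> = \<bar>inn n y ?w\<bar> / real n + 4 * nrm n w * (1 / sn) * (1 / sqrt v)"
  proof -
    have sv: "sqrt v / v = 1 / sqrt v" using v_pos by (simp add: real_div_sqrt field_simps)
    have s2: "sn / real n = 1 / sn" using n_pos by (simp add: real_div_sqrt field_simps)
    have "(\<bar>inn n y ?w\<bar> * v + nrm n w * (4 * sn * sqrt v)) / lbar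
        = \<bar>inn n y ?w\<bar> / real n + 4 * nrm n w * (sn / real n) * (sqrt v / v)"
      unfolding lbar_def using v_pos by (simp add: add_divide_distrib)
    then show ?thesis unfolding sv s2 .
  qed
  also have "4 * nrm n w * (1 / sn) * (1 / sqrt v) \<le> 4 * nrm n w * (1 / sn) * 1"
    using inv_sv_le_1 by (intro mult_left_mono) auto
  finally show ?thesis by (simp only: mult_1_right times_divide_eq_right)
qed

end

subsection \<open>Error in the q-norm\<close>

text \<open>A sum of three terms is at most three times the largest. This replaces Minkowski's
  inequality; the factor 3 inside the powers affects constants only.\<close>

lemma powr_sum3_le:
  fixes a b c q :: real
  assumes "0 \<le> a" "0 \<le> b" "0 \<le> c" "0 < q"
  shows "(a + b + c) powr q \<le> (3 * a) powr q + (3 * b) powr q + (3 * c) powr q"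
proof -
  define t where "t = max a (max b c)"
  have "(a + b + c) powr q \<le> (3 * t) powr q"
    using assms by (intro powr_mono2) (auto simp: t_def)
  also have "\<dots> \<le> (3 * a) powr q + (3 * b) powr q + (3 * c) powr q"
    unfolding t_def max_def by (auto simp: add_increasing add_increasing2)
  finally show ?thesis .
qed

lemma exp_eq_powr_le: "0 \<le> q \<Longrightarrow> exp q \<le> 3 powr q" for q :: real
proof -
  assume "0 \<le> q"
  then have "exp 1 powr q \<le> 3 powr q" using exp_le by (intro powr_mono2) auto
  then show ?thesis by (simp add: powr_def)
qed

text \<open>With \<open>exp q \<le> 3 powr q\<close>, the factors exponential in \<open>q\<close>
  all move inside \<open>q\<close>-th powers. The 6 in \<open>part\<close> is 2 from
  \<open>2 * B\<close> times 3 from \<open>exp q\<close>.\<close>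

lemma lq_norm_sum_bound:
  fixes e \<alpha> \<beta> :: "nat \<Rightarrow> real"
  assumes q: "1 \<le> q" and \<delta>: "0 \<le> \<delta>" and s: "0 < s"
    and e: "\<And>i. i < n \<Longrightarrow> \<bar>e i\<bar> \<le> 6 * \<bar>\<alpha> i\<bar> + 42 * \<delta> * \<bar>\<beta> i\<bar> + 4 * \<delta> / s"
    and \<alpha>: "(\<Sum>i<n. \<bar>\<alpha> i\<bar> powr q) \<le> real n * (2 * (2 * (1326 * \<delta> / s)) powr q) * exp q"
    and \<beta>: "(\<Sum>i<n. \<bar>\<beta> i\<bar> powr q) \<le> real n * (2 * (2 * (221 / s)) powr q) * exp q"
  shows "lq_norm q n e \<le> 1000000 * (\<delta> / s) * real n powr (1 / q)"
proof -
  define D where "D = \<delta> / s"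
  have D: "0 \<le> D" using \<delta> s by (simp add: D_def)
  have q0: "0 < q" "0 \<le> q" using q by auto
  have part: "c powr q * S \<le> 2 * (real n * (200000 * D) powr q)"
    if "S \<le> real n * (2 * (2 * B) powr q) * exp q" "0 \<le> c" "0 \<le> B" "6 * c * B \<le> 200000 * D" for c S B
  proof -
    have "c powr q * S \<le> c powr q * (real n * (2 * (2 * B) powr q) * 3 powr q)"
      using that exp_eq_powr_le[OF q0(2)] by (intro mult_left_mono order_trans[OF that(1)]) auto
    also have "\<dots> = 2 * (real n * (6 * c * B) powr q)"
    proof -
      have "(6 * c * B) powr q = (c * (2 * B) * 3) powr q" by (simp add: mult_ac)
      also have "\<dots> = c powr q * (2 * B) powr q * 3 powr q" using that by (simp only: powr_mult mult_nonneg_nonneg)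
      finally show ?thesis by simp
    qed
    also have "\<dots> \<le> 2 * (real n * (200000 * D) powr q)"
      using that q0 by (intro mult_left_mono powr_mono2) auto
    finally show ?thesis .
  qed
  have "(\<Sum>i<n. \<bar>e i\<bar> powr q) \<le> (\<Sum>i<n. 18 powr q * \<bar>\<alpha> i\<bar> powr q + (126 * \<delta>) powr q * \<bar>\<beta> i\<bar> powr q + (12 * D) powr q)"
  proof (rule sum_mono)
    fix i assume "i \<in> {..<n}"
    then have "\<bar>e i\<bar> powr q \<le> (6 * \<bar>\<alpha> i\<bar> + 42 * \<delta> * \<bar>\<beta> i\<bar> + 4 * \<delta> / s) powr q"
      using e q0 by (intro powr_mono2) auto
    also have "\<dots> \<le> (3 * (6 * \<bar>\<alpha> i\<bar>)) powr q + (3 * (42 * \<delta> * \<bar>\<beta> i\<bar>)) powr q + (3 * (4 * \<delta> / s)) powr q"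
      using \<delta> s q0 by (intro powr_sum3_le) auto
    also have "3 * (6 * \<bar>\<alpha> i\<bar>) = 18 * \<bar>\<alpha> i\<bar>" by simp
    also have "3 * (42 * \<delta> * \<bar>\<beta> i\<bar>) = (126 * \<delta>) * \<bar>\<beta> i\<bar>" by simp
    also have "3 * (4 * \<delta> / s) = 12 * D" by (simp add: D_def)
    also have "(18 * \<bar>\<alpha> i\<bar>) powr q = 18 powr q * \<bar>\<alpha> i\<bar> powr q" by (rule powr_mult)
    also have "((126 * \<delta>) * \<bar>\<beta> i\<bar>) powr q = (126 * \<delta>) powr q * \<bar>\<beta> i\<bar> powr q" by (rule powr_mult)
    finally show "\<bar>e i\<bar> powr q \<le> 18 powr q * \<bar>\<alpha> i\<bar> powr q + (126 * \<delta>) powr q * \<bar>\<beta> i\<bar> powr q + (12 * D) powr q" .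
  qed
  also have "\<dots> = 18 powr q * (\<Sum>i<n. \<bar>\<alpha> i\<bar> powr q) + (126 * \<delta>) powr q * (\<Sum>i<n. \<bar>\<beta> i\<bar> powr q) + real n * (12 * D) powr q"
    by (simp add: sum.distrib sum_distrib_left)
  also have "\<dots> \<le> 2 * (real n * (200000 * D) powr q) + 2 * (real n * (200000 * D) powr q) + real n * (200000 * D) powr q"
  proof (intro add_mono)
    show "18 powr q * (\<Sum>i<n. \<bar>\<alpha> i\<bar> powr q) \<le> 2 * (real n * (200000 * D) powr q)"
    proof (rule part[OF \<alpha>])
      have "6 * 18 * (1326 * \<delta> / s) = 143208 * D" by (simp add: D_def)
      then show "6 * 18 * (1326 * \<delta> / s) \<le> 200000 * D" using D by simp
    qed (use \<delta> s in auto)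
    show "(126 * \<delta>) powr q * (\<Sum>i<n. \<bar>\<beta> i\<bar> powr q) \<le> 2 * (real n * (200000 * D) powr q)"
    proof (rule part[OF \<beta>])
      have "6 * (126 * \<delta>) * (221 / s) = 167076 * D" by (simp add: D_def)
      then show "6 * (126 * \<delta>) * (221 / s) \<le> 200000 * D" using D by simp
    qed (use \<delta> s in auto)
    show "real n * (12 * D) powr q \<le> real n * (200000 * D) powr q"
      using D q0 by (intro mult_left_mono powr_mono2) auto
  qed
  \<comment> \<open>\<open>5 = 2 + 2 + 1\<close>. Under the root it is at most 5 because
    \<open>q \<ge> 1\<close>, and \<open>5 * 200000\<close> is the final constant.\<close>
  also have "\<dots> = 5 * (real n * (200000 * D) powr q)" by simp
  finally have "lq_norm q n e \<le> (5 * (real n * (200000 * D) powr q)) powr (1 / q)"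
    unfolding lq_norm_def using q0 by (intro powr_mono2) (auto intro: sum_nonneg)
  also have "\<dots> = 5 powr (1 / q) * (real n powr (1 / q) * ((200000 * D) powr q) powr (1 / q))"
    by (simp add: powr_mult)
  also have "((200000 * D) powr q) powr (1 / q) = 200000 * D"
    using q0 D by (simp add: powr_powr)
  also have "5 powr (1 / q) * (real n powr (1 / q) * (200000 * D)) \<le> 5 powr 1 * (real n powr (1 / q) * (200000 * D))"
    using q D by (intro mult_right_mono powr_mono) auto
  finally show ?thesis by (simp add: D_def mult_ac)
qed

section \<open>Independence of the \<open>i\<close>-th sample, exceptional events and the final
  estimate\<close>

context signal_model
begin

abbreviation "\<Omega> \<equiv> gauss ({..<n} \<times> {..<d})"

lemma data_measurable: "i < n \<Longrightarrow> k < d \<Longrightarrow> (\<lambda>z. data_mat y mu z i k) \<in> borel_measurable \<Omega>"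
  unfolding data_mat_def by (intro borel_measurable_add borel_measurable_const coord_measurable) auto

lemma M_measurable: "i < n \<Longrightarrow> j < n \<Longrightarrow> (\<lambda>z. M z i j) \<in> borel_measurable \<Omega>"
  unfolding M_def hollow_def gram_def
  by (cases "i = j") (auto intro!: borel_measurable_divide borel_measurable_sum borel_measurable_times data_measurable)

lemma loo_measurable: "j < n \<Longrightarrow> k < n \<Longrightarrow> (\<lambda>z. loo i (M z) j k) \<in> borel_measurable \<Omega>"
  unfolding loo_def by (cases "j = i \<or> k = i") (auto intro: M_measurable)

lemma V_measurable:
  assumes "j < n"
  shows "(\<lambda>z. V i z j) \<in> borel_measurable \<Omega>"
proof -
  have "(\<lambda>z. ((power_step n ub (loo i (M z))) ^^ t) ub j) \<in> borel_measurable \<Omega>" if "j < n" for t j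
    using that
  proof (induction t arbitrary: j)
    case (Suc t)
    have mv: "(\<lambda>z. mat_vec n (loo i (M z)) (((power_step n ub (loo i (M z))) ^^ t) ub) j) \<in> borel_measurable \<Omega>" if "j < n" for j
      unfolding mat_vec_def using that
      by (intro borel_measurable_sum borel_measurable_times loo_measurable Suc.IH) auto
    show ?case
      unfolding funpow.simps comp_def power_step_def[of n ub _ "(_ ^^ _) _"] inn_def
      using Suc.prems by (intro borel_measurable_divide borel_measurable_sum borel_measurable_times mv borel_measurable_const) auto
  qed simp
  then show ?thesis unfolding V_def using assms .
qed

lemma loo_dep:
  assumes "\<And>j k. j \<noteq> i \<Longrightarrow> z (j, k) = z' (j, k)"
  shows "loo i (M z) = loo i (M z')"
  unfolding loo_def M_def hollow_def gram_def data_mat_def using assms by (intro ext) auto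

lemma V_dep: "(\<And>j k. j \<noteq> i \<Longrightarrow> z (j, k) = z' (j, k)) \<Longrightarrow> V i z = V i z'"
  unfolding V_def using loo_dep[of i z z'] by simp

text \<open>The only occurrence of the \<open>i\<close>-th data vector is multiplied by
  \<open>(w(i := 0)) i = 0\<close>.\<close>

lemma proj_dep:
  assumes "\<And>j k. j \<noteq> i \<Longrightarrow> z (j, k) = z' (j, k)"
  shows "proj i w z = proj i w z'"
  unfolding proj_def data_mat_def
  by (intro ext arg_cong[where f = "\<lambda>t. t / lbar"] sum.cong refl) (auto simp: assms)

lemma proj_measurable:
  assumes "\<And>j. j < n \<Longrightarrow> (\<lambda>z. w z j) \<in> borel_measurable \<Omega>" "k < d"
  shows "(\<lambda>z. proj i (w z) z k) \<in> borel_measurable \<Omega>"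
  unfolding proj_def
proof (intro borel_measurable_divide borel_measurable_sum borel_measurable_times borel_measurable_const)
  fix j assume "j \<in> {..<n}"
  then show "(\<lambda>z. ((w z)(i := 0)) j) \<in> borel_measurable \<Omega>" "(\<lambda>z. data_mat y mu z j k) \<in> borel_measurable \<Omega>"
    using assms by (cases "j = i"; auto intro: data_measurable)+
qed

lemma proj_mean_measurable:
  assumes "\<And>j. j < n \<Longrightarrow> (\<lambda>z. w z j) \<in> borel_measurable \<Omega>"
  shows "(\<lambda>z. y i * inn d mu (proj i (w z) z)) \<in> borel_measurable \<Omega>"
  unfolding inn_def
  by (intro borel_measurable_sum borel_measurable_times borel_measurable_const proj_measurable assms) auto

definition "dev i z = (\<lambda>j. V i z j - ub j)"
text \<open>\<open>1326 = 6 * 221\<close>: the constant of \<open>proj_bound\<close> times the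
  distance bound \<open>6 * \<delta>\<close> between an iterate and \<open>ub\<close>, divided by
  \<open>\<delta>\<close>.\<close>

definition "dev_bad = row_bad n d q (1326 * \<delta> / sn) (\<lambda>i z. y i * inn d mu (proj i (dev i z) z)) (\<lambda>i z. proj i (dev i z) z)"
definition "mean_bad = row_bad n d q (221 / sn) (\<lambda>i z. y i * inn d mu (proj i ub z)) (\<lambda>i z. proj i ub z)"

lemma dev_bad_measure: "dev_bad \<in> sets \<Omega>" "measure \<Omega> dev_bad \<le> exp (- q)"
proof -
  have B: "0 < 1326 * \<delta> / sn" using \<delta>_pos sn_pos by simp
  have w: "(\<lambda>z. dev i z j) \<in> borel_measurable \<Omega>" if "j < n" for i j
    unfolding dev_def using that by (intro borel_measurable_diff V_measurable borel_measurable_const)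
  have dep: "proj i (dev i z) z = proj i (dev i z') z'" if "\<And>j k. j \<noteq> i \<Longrightarrow> z (j, k) = z' (j, k)" for i z z'
  proof -
    have "V i z = V i z'" by (rule V_dep, rule that, assumption)
    then have "dev i z = dev i z'" by (simp add: dev_def)
    moreover have "proj i w z = proj i w z'" for w by (rule proj_dep, rule that, assumption)
    ultimately show ?thesis by simp
  qed
  have dep': "y i * inn d mu (proj i (dev i z) z) = y i * inn d mu (proj i (dev i z') z')"
    if "\<And>j k. j \<noteq> i \<Longrightarrow> z (j, k) = z' (j, k)" for i z z'
    by (rule arg_cong[where f = "\<lambda>t. y i * inn d mu t"], rule dep, rule that, assumption)
  note facts = n_pos q_pos B proj_mean_measurable[OF w] proj_measurable[OF w]
  show "dev_bad \<in> sets \<Omega>" unfolding dev_bad_def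
    by (rule row_bad_measure(1)[OF facts]) (assumption | (rule dep' dep; simp))+
  show "measure \<Omega> dev_bad \<le> exp (- q)" unfolding dev_bad_def
    by (rule row_bad_measure(2)[OF facts]) (assumption | (rule dep' dep; simp))+
qed

lemma mean_bad_measure: "mean_bad \<in> sets \<Omega>" "measure \<Omega> mean_bad \<le> exp (- q)"
proof -
  have B: "0 < 221 / sn" using sn_pos by simp
  have w: "(\<lambda>z. ub j) \<in> borel_measurable \<Omega>" for j by simp
  have dep': "y i * inn d mu (proj i ub z) = y i * inn d mu (proj i ub z')"
    if "\<And>j k. j \<noteq> i \<Longrightarrow> z (j, k) = z' (j, k)" for i z z'
    by (rule arg_cong[where f = "\<lambda>t. y i * inn d mu t"], rule proj_dep, rule that, assumption)
  note facts = n_pos q_pos B proj_mean_measurable[OF w] proj_measurable[OF w]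
  show "mean_bad \<in> sets \<Omega>" unfolding mean_bad_def
    by (rule row_bad_measure(1)[OF facts]) (assumption | (rule dep' proj_dep; simp))+
  show "measure \<Omega> mean_bad \<le> exp (- q)" unfolding mean_bad_def
    by (rule row_bad_measure(2)[OF facts]) (assumption | (rule dep' proj_dep; simp))+
qed

text \<open>\<open>V i z\<close> and \<open>ub\<close> both have inner product 1 with
  \<open>ub\<close>, so their difference is orthogonal to \<open>y\<close>. Its coordinate
  \<open>i\<close> is \<open>- ub i\<close>, as \<open>V i z\<close> vanishes there; zeroing that
  coordinate leaves \<open>y i * ub i\<close>.\<close>

lemma dev_facts:
  assumes "good z" "i < n"
  shows "nrm n (dev i z) \<le> 6 * \<delta>" "\<bar>inn n y ((dev i z)(i := 0))\<bar> = 1 / sn"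
proof -
  interpret L: near_rank_one n ub "loo i (M z)" \<delta> by (rule loo_near[OF assms])
  obtain t where t: "n = Suc t" using n_pos by (cases n) auto
  have Vt: "V i z = (L.T ^^ Suc t) ub" unfolding V_def using t by metis
  show "nrm n (dev i z) \<le> 6 * \<delta>" unfolding dev_def Vt by (rule L.iter_close)
  have slice: "inn n ub (V i z) = 1" using L.iter_slice[of "Suc t"] unfolding Vt slice_def by blast
  have Vi: "V i z i = 0" unfolding Vt by (simp add: power_step_def mat_vec_def loo_def)
  have y_ub: "y = (\<lambda>j. sn * ub j)" using sn_pos by (simp add: ub_def)
  have "inn n y (dev i z) = 0"
    by (subst y_ub) (simp only: inn_scale_left dev_def inn_diff_right slice L.inn_unit, simp)
  moreover have "inn n y (dev i z) = inn n y ((dev i z)(i := 0)) + y i * dev i z i"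
  proof -
    have "inn n y (dev i z) = (\<Sum>j\<in>{..<n} - {i}. y j * dev i z j) + y i * dev i z i"
      unfolding inn_def using assms(2) by (subst sum.remove[of _ i]) auto
    moreover have "inn n y ((dev i z)(i := 0)) = (\<Sum>j\<in>{..<n} - {i}. y j * dev i z j)"
      unfolding inn_def using assms(2) by (subst sum.remove[of _ i]) auto
    ultimately show ?thesis by simp
  qed
  ultimately have "inn n y ((dev i z)(i := 0)) = y i * ub i" by (simp add: dev_def Vi)
  then show "\<bar>inn n y ((dev i z)(i := 0))\<bar> = 1 / sn"
    by (simp add: abs_mult ub_abs[OF assms(2)] y_abs[OF assms(2)])
qed

text \<open>On the good event the truncation is inactive, so the sum controlled by Markov's
  inequality is the actual sum of \<open>q\<close>-th powers.\<close>

lemma row_stat_dev: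
  assumes "good z" "i < n"
  shows "row_stat d q (1326 * \<delta> / sn) i (\<lambda>z. y i * inn d mu (proj i (dev i z) z)) (\<lambda>z. proj i (dev i z) z) z
    = \<bar>mat_vec n (M z) (dev i z) i\<bar> powr q"
proof -
  have d1: "nrm n (dev i z) / sn \<le> 6 * \<delta> / sn"
    using dev_facts(1)[OF assms] sn_pos by (intro divide_right_mono) auto
  have "\<bar>y i * inn d mu (proj i (dev i z) z)\<bar> \<le> (1 / sn) / real n + 4 * nrm n (dev i z) / sn"
    using mean_bound[OF assms, of "dev i z"] unfolding dev_facts(2)[OF assms] .
  also have "\<dots> \<le> \<delta> / sn + 24 * \<delta> / sn"
  proof (rule add_mono)
    have "1 / real n * (1 / sn) \<le> \<delta> * (1 / sn)"
      using inv_n_le r_pos sn_pos by (intro mult_right_mono) (auto simp: \<delta>_def)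
    then show "(1 / sn) / real n \<le> \<delta> / sn" by (simp add: mult.commute)
    show "4 * nrm n (dev i z) / sn \<le> 24 * \<delta> / sn" using d1 by simp
  qed
  also have "\<dots> \<le> 1326 * \<delta> / sn" using \<delta>_pos sn_pos by (simp add: divide_right_mono add_divide_distrib[symmetric])
  finally have m: "\<bar>y i * inn d mu (proj i (dev i z) z)\<bar> \<le> 1326 * \<delta> / sn" .
  have a: "q * sqnorm d (proj i (dev i z) z) \<le> (1326 * \<delta> / sn)\<^sup>2"
    by (rule proj_bound[OF assms(1)]) (use d1 in simp)
  show ?thesis
    unfolding row_stat_def M_row_eq[OF assms(2)] using m a by simp
qed

lemma row_stat_mean:
  assumes "good z" "i < n"
  shows "row_stat d q (221 / sn) i (\<lambda>z. y i * inn d mu (proj i ub z)) (\<lambda>z. proj i ub z) z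
    = \<bar>mat_vec n (M z) ub i\<bar> powr q"
proof -
  have "\<bar>inn n y (ub(i := 0))\<bar> \<le> sn * 1"
    using nrm_zero_coord[of ub i n] by (intro order_trans[OF inn_le_nrm] mult_mono) (auto simp: nrm_y nrm_ub)
  then have "\<bar>inn n y (ub(i := 0))\<bar> / real n \<le> sn / real n" by (intro divide_right_mono) auto
  moreover have "sn / real n = 1 / sn" using n_pos by (simp add: real_div_sqrt field_simps)
  ultimately have "\<bar>y i * inn d mu (proj i ub z)\<bar> \<le> 1 / sn + 4 / sn"
    using mean_bound[OF assms, of ub] by (simp add: nrm_ub)
  also have "\<dots> \<le> 221 / sn" using sn_pos by (simp add: divide_right_mono add_divide_distrib[symmetric])
  finally have m: "\<bar>y i * inn d mu (proj i ub z)\<bar> \<le> 221 / sn" .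
  have a: "q * sqnorm d (proj i ub z) \<le> (221 / sn)\<^sup>2"
    by (rule proj_bound[OF assms(1)]) (simp add: nrm_ub)
  show ?thesis
    unfolding row_stat_def M_row_eq[OF assms(2)] using m a by simp
qed

text \<open>The \<open>n\<close> steps in \<open>V\<close> are read by \<open>loo_error\<close> as
  \<open>Suc t\<close> steps with error \<open>(1 / 2) ^ t\<close>, hence the exponent
  \<open>n - 1\<close>.\<close>

lemma half_power_le: "(1 / 2 :: real) ^ (n - 1) \<le> 1 / sn"
proof -
  have "real n \<le> 2 ^ (n - 1)"
  proof -
    have "Suc t \<le> 2 ^ t" for t :: nat by (induction t) auto
    from this[of "n - 1"] have "n \<le> 2 ^ (n - 1)" using n_pos by simp
    then show ?thesis by (metis of_nat_le_iff of_nat_numeral of_nat_power)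
  qed
  moreover have "sn \<le> real n"
  proof -
    have "sn * 1 \<le> sn * sn" using n_pos by (intro mult_left_mono) auto
    then show ?thesis by simp
  qed
  ultimately have "sn \<le> 2 ^ (n - 1)" by (rule order_trans[rotated])
  then have "1 / 2 ^ (n - 1) \<le> 1 / sn" using sn_pos by (intro divide_left_mono mult_pos_pos) auto
  then show ?thesis by (simp add: power_one_over)
qed

lemma lq_norm_ub: "lq_norm q n ub = real n powr (1 / q) / sn"
proof -
  have "(\<Sum>i<n. \<bar>ub i\<bar> powr q) = real n * (1 / sn) powr q" by (simp add: ub_abs)
  then have "lq_norm q n ub = real n powr (1 / q) * ((1 / sn) powr q) powr (1 / q)"
    unfolding lq_norm_def by (simp add: powr_mult)
  also have "((1 / sn) powr q) powr (1 / q) = 1 / sn" using q_pos sn_pos by (simp add: powr_powr)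
  finally show ?thesis by simp
qed

lemma error_bound:
  assumes z: "z \<in> space \<Omega>" and nb: "z \<notin> gram_bad n d" "z \<notin> signal_bad n d mu" "z \<notin> dev_bad" "z \<notin> mean_bad"
    and lead: "is_leading_unit_eigvec n (hollow (gram d (data_mat y mu z))) u"
  shows "(MIN s\<in>{-1, 1::real}. lq_norm q n (\<lambda>i. s * u i - mat_vec n (hollow (gram d (data_mat y mu z))) ub i / lbar))
    < 60000000000 / sqrt q * lq_norm q n ub"
proof -
  have g: "good z" by (rule good_of_not_bad[OF z nb(1,2)])
  have leadM: "is_leading_unit_eigvec n (M z) u"
    unfolding M_def by (rule leading_divide[OF lead lbar_pos])
  have near: "near_rank_one n ub (M z) \<delta>" by (rule M_near[OF g _ \<delta>_le]) (use r_pos in \<open>simp add: \<delta>_def\<close>)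
  define s where "s = sgn (inn n ub u)"
  have s: "s \<in> {-1, 1}" using leading_inn_nonzero[OF near leadM] by (auto simp: s_def sgn_if)
  let ?e = "\<lambda>i. s * u i - mat_vec n (M z) ub i"
  obtain t where t: "n = Suc t" using n_pos by (cases n) auto
  have "lq_norm q n ?e \<le> 1000000 * (\<delta> / sn) * real n powr (1 / q)"
  proof (rule lq_norm_sum_bound[OF q_ge_1 _ sn_pos, where \<alpha> = "\<lambda>i. mat_vec n (M z) (dev i z) i" and \<beta> = "\<lambda>i. mat_vec n (M z) ub i"])
    show "0 \<le> \<delta>" using \<delta>_pos by simp
    fix i assume i: "i < n"
    have Vt: "V i z = (power_step n ub (loo i (M z)) ^^ Suc t) ub" unfolding V_def using t by metis
    have "\<bar>?e i\<bar> \<le> 6 * \<bar>mat_vec n (M z) (dev i z) i\<bar> + 42 * \<delta> * \<bar>mat_vec n (M z) ub i\<bar> + 4 * \<delta> * (1 / 2) ^ t"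
      unfolding s_def dev_def
      by (rule loo_error[OF near loo_near[OF g i] i M_diag M_row[OF g i] leadM Vt])
    moreover have "4 * \<delta> * (1 / 2) ^ t \<le> 4 * \<delta> / sn"
    proof -
      have "4 * \<delta> * (1 / 2) ^ t \<le> 4 * \<delta> * (1 / sn)"
        using half_power_le t \<delta>_pos by (intro mult_left_mono) auto
      then show ?thesis by simp
    qed
    ultimately show "\<bar>?e i\<bar> \<le> 6 * \<bar>mat_vec n (M z) (dev i z) i\<bar> + 42 * \<delta> * \<bar>mat_vec n (M z) ub i\<bar> + 4 * \<delta> / sn"
      by linarith
  next
    have "(\<Sum>i<n. row_stat d q (1326 * \<delta> / sn) i (\<lambda>z. y i * inn d mu (proj i (dev i z) z)) (\<lambda>z. proj i (dev i z) z) z)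
       < real n * (2 * (2 * (1326 * \<delta> / sn)) powr q) * exp q"
      using z nb(3) unfolding dev_bad_def row_bad_def by (simp add: not_le)
    then show "(\<Sum>i<n. \<bar>mat_vec n (M z) (dev i z) i\<bar> powr q) \<le> real n * (2 * (2 * (1326 * \<delta> / sn)) powr q) * exp q"
      using row_stat_dev[OF g] by simp
    have "(\<Sum>i<n. row_stat d q (221 / sn) i (\<lambda>z. y i * inn d mu (proj i ub z)) (\<lambda>z. proj i ub z) z)
       < real n * (2 * (2 * (221 / sn)) powr q) * exp q"
      using z nb(4) unfolding mean_bad_def row_bad_def by (simp add: not_le)
    then show "(\<Sum>i<n. \<bar>mat_vec n (M z) ub i\<bar> powr q) \<le> real n * (2 * (2 * (221 / sn)) powr q) * exp q"
      using row_stat_mean[OF g] by simp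
  qed
  also have "\<dots> = (1000000 * \<delta>) * lq_norm q n ub" unfolding lq_norm_ub by simp
  \<comment> \<open>\<open>1000000 * 30000\<close> is half of the stated constant, which yields
    strictness.\<close>
  also have "\<dots> < 60000000000 / sqrt q * lq_norm q n ub"
  proof (rule mult_strict_right_mono)
    show "1000000 * \<delta> < 60000000000 / sqrt q" using sq_pos by (simp add: \<delta>_def r_def divide_strict_right_mono)
    show "0 < lq_norm q n ub" unfolding lq_norm_ub using n_pos by simp
  qed
  finally have lt: "lq_norm q n ?e < 60000000000 / sqrt q * lq_norm q n ub" .
  have eq: "mat_vec n (hollow (gram d (data_mat y mu z))) ub i / lbar = mat_vec n (M z) ub i" for i
    unfolding M_def mat_vec_mat_divide ..
  show ?thesis unfolding eq by (rule le_less_trans[OF Min_le lt]) (use s in auto)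
qed

text \<open>\<open>u\<close> is an arbitrary selection of leading eigenvectors, possibly not
  measurable in \<open>z\<close>. The set \<open>A\<close> is the complement of the four exceptional
  sets, none of which involves \<open>u\<close>.\<close>

lemma error_event:
  assumes lead: "\<And>z. z \<in> space \<Omega> \<Longrightarrow> is_leading_unit_eigvec n (hollow (gram d (data_mat y mu z))) (u z)"
  shows "\<exists>A\<in>sets \<Omega>. A \<subseteq> {z\<in>space \<Omega>. (MIN s\<in>{-1, 1::real}. lq_norm q n
        (\<lambda>i. s * u z i - mat_vec n (hollow (gram d (data_mat y mu z))) ub i / lbar))
      < 60000000000 / sqrt q * lq_norm q n ub} \<and> 1 - 5 * exp (- q) < measure \<Omega> A"
proof -
  interpret prob_space \<Omega> by (rule prob_space_gauss)
  define bad where "bad = gram_bad n d \<union> signal_bad n d mu \<union> dev_bad \<union> mean_bad"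
  note sets = gram_bad_sets[of n d] signal_bad_sets[of n d mu] dev_bad_measure(1) mean_bad_measure(1)
  have bad: "bad \<in> sets \<Omega>" unfolding bad_def using sets by blast
  have "prob bad \<le> prob (gram_bad n d) + prob (signal_bad n d mu) + prob dev_bad + prob mean_bad"
  proof -
    have "prob bad \<le> prob (gram_bad n d \<union> signal_bad n d mu \<union> dev_bad) + prob mean_bad"
      unfolding bad_def using sets by (intro measure_Un_le) blast+
    also have "prob (gram_bad n d \<union> signal_bad n d mu \<union> dev_bad) \<le> prob (gram_bad n d \<union> signal_bad n d mu) + prob dev_bad"
      using sets by (intro measure_Un_le) blast+
    also have "prob (gram_bad n d \<union> signal_bad n d mu) \<le> prob (gram_bad n d) + prob (signal_bad n d mu)"
      using sets by (intro measure_Un_le) blast+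
    finally show ?thesis by simp
  qed
  also have "\<dots> \<le> exp (- real n) + exp (- real n) + exp (- q) + exp (- q)"
    using v_pos unfolding v_def
    by (intro add_mono gram_bad_measure signal_bad_measure dev_bad_measure(2) mean_bad_measure(2) n_pos d_pos)
  also have "\<dots> \<le> 4 * exp (- q)" using q_le by simp
  \<comment> \<open>The fifth \<open>exp (- q)\<close> provides the strict inequality.\<close>
  also have "\<dots> < 5 * exp (- q)" by simp
  finally have "1 - 5 * exp (- q) < prob (space \<Omega> - bad)" using prob_compl[OF bad] by simp
  moreover have "space \<Omega> - bad \<subseteq> {z\<in>space \<Omega>. (MIN s\<in>{-1, 1::real}. lq_norm q n
        (\<lambda>i. s * u z i - mat_vec n (hollow (gram d (data_mat y mu z))) ub i / lbar))
      < 60000000000 / sqrt q * lq_norm q n ub}"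
  proof
    fix z assume "z \<in> space \<Omega> - bad"
    then have z: "z \<in> space \<Omega>" "z \<notin> gram_bad n d" "z \<notin> signal_bad n d mu" "z \<notin> dev_bad" "z \<notin> mean_bad"
      by (auto simp: bad_def)
    show "z \<in> {z\<in>space \<Omega>. (MIN s\<in>{-1, 1::real}. lq_norm q n
        (\<lambda>i. s * u z i - mat_vec n (hollow (gram d (data_mat y mu z))) ub i / lbar))
      < 60000000000 / sqrt q * lq_norm q n ub}"
      using error_bound[OF z lead[OF z(1)]] z(1) by blast
  qed
  moreover have "space \<Omega> - bad \<in> sets \<Omega>" using bad by blast
  ultimately show ?thesis by blast
qed

end

theorem theorem3p3:
  fixes d :: "nat \<Rightarrow> nat"
    and y :: "nat \<Rightarrow> nat \<Rightarrow> real"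
    and mu :: "nat \<Rightarrow> nat \<Rightarrow> real"
    and u1 :: "nat \<Rightarrow> (nat \<times> nat \<Rightarrow> real) \<Rightarrow> nat \<Rightarrow> real"
  assumes d_ge: "\<And>n. 2 \<le> n \<Longrightarrow> 2 \<le> d n"
    and y_pm: "\<And>n i. 2 \<le> n \<Longrightarrow> i < n \<Longrightarrow> y n i \<in> {-1, 1}"
    and SNR_inf: "filterlim (\<lambda>n. SNR n (d n) (mu n)) at_top sequentially"
    and SNR_le: "\<exists>C'. \<forall>n\<ge>2. SNR n (d n) (mu n) \<le> C' * ln (real n)"
    and u1_lead: "\<And>n z. 2 \<le> n \<Longrightarrow> z \<in> space (noise_space n (d n)) \<Longrightarrow>
        is_leading_unit_eigvec n (hollow (gram (d n) (data_mat (y n) (mu n) z))) (u1 n z)"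
  shows "\<exists>eps :: nat \<Rightarrow> real. eps \<longlonglongrightarrow> 0 \<and>
    (\<exists>C > 0. \<exists>N > (0::nat). \<forall>n \<ge> N. 2 \<le> n \<longrightarrow>
      (let q = SNR n (d n) (mu n);
           G = (\<lambda>z. hollow (gram (d n) (data_mat (y n) (mu n) z)));
           ubar = (\<lambda>i. y n i / sqrt (real n));
           lbar = real n * sqnorm (d n) (mu n)
       in \<exists>A \<in> sets (noise_space n (d n)).
            A \<subseteq> {z \<in> space (noise_space n (d n)).
                   (MIN s\<in>{-1, 1::real}. lq_norm q n
                      (\<lambda>i. s * u1 n z i - mat_vec n (G z) ubar i / lbar))
                   < eps n * lq_norm q n ubar}
          \<and> measure (noise_space n (d n)) A > 1 - C * exp (- q)))"
proof (intro exI[of _ "\<lambda>n. 60000000000 / sqrt (SNR n (d n) (mu n))"] conjI)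
  show "(\<lambda>n. 60000000000 / sqrt (SNR n (d n) (mu n))) \<longlonglongrightarrow> 0"
    by (rule tendsto_divide_0[OF tendsto_const])
      (rule filterlim_mono[OF filterlim_compose[OF sqrt_at_top SNR_inf] at_top_le_at_infinity order_refl])
next
  obtain C' where C': "\<And>n. 2 \<le> n \<Longrightarrow> SNR n (d n) (mu n) \<le> C' * ln (real n)"
    using SNR_le by blast
  \<comment> \<open>Since \<open>ln n / n\<close> tends to 0, eventually
    \<open>C' * ln n \<le> n\<close>; this supplies \<open>q \<le> n\<close>.\<close>
  have "((\<lambda>n. C' * (ln (real n) / real n)) \<longlongrightarrow> C' * 0) sequentially"
    by (intro tendsto_mult tendsto_const filterlim_compose[OF ln_x_over_x_tendsto_0 filterlim_real_sequentially])
  then have "\<forall>\<^sub>F n in sequentially. C' * (ln (real n) / real n) < 1"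
    by (rule order_tendstoD) simp
  moreover have "\<forall>\<^sub>F n in sequentially. 360000\<^sup>2 \<le> SNR n (d n) (mu n)"
    using SNR_inf by (simp add: filterlim_at_top)
  ultimately have "\<forall>\<^sub>F n in sequentially. C' * (ln (real n) / real n) < 1 \<and> 360000\<^sup>2 \<le> SNR n (d n) (mu n)"
    by (rule eventually_conj)
  then obtain N where N: "\<And>n. N \<le> n \<Longrightarrow> C' * (ln (real n) / real n) < 1 \<and> 360000\<^sup>2 \<le> SNR n (d n) (mu n)"
    by (auto simp: eventually_sequentially)
  have event: "\<exists>A\<in>sets (noise_space n (d n)). A \<subseteq> {z \<in> space (noise_space n (d n)).
        (MIN s\<in>{-1, 1::real}. lq_norm (SNR n (d n) (mu n)) n
          (\<lambda>i. s * u1 n z i - mat_vec n (hollow (gram (d n) (data_mat (y n) (mu n) z))) (\<lambda>i. y n i / sqrt (real n)) i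
             / (real n * sqnorm (d n) (mu n))))
        < 60000000000 / sqrt (SNR n (d n) (mu n)) * lq_norm (SNR n (d n) (mu n)) n (\<lambda>i. y n i / sqrt (real n))}
      \<and> measure (noise_space n (d n)) A > 1 - 5 * exp (- SNR n (d n) (mu n))"
    if n: "N \<le> n" "2 \<le> n" for n
  proof -
    interpret signal_model n "d n" "y n" "mu n" "SNR n (d n) (mu n)"
    proof
      show "360000 \<le> sqrt (SNR n (d n) (mu n))"
        using N[OF n(1)] by (intro real_le_rsqrt) simp
      have "C' * ln (real n) \<le> real n"
        using N[OF n(1)] n(2) by (simp add: field_simps)
      then show "SNR n (d n) (mu n) \<le> real n" using C'[OF n(2)] by simp
    qed (use n d_ge[OF n(2)] y_pm[OF n(2)] in auto)
    show ?thesis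
      using error_event[of "u1 n"] u1_lead[OF n(2)] unfolding noise_space_def ub_def lbar_def v_def by blast
  qed
  show "\<exists>C > 0. \<exists>N > (0::nat). \<forall>n \<ge> N. 2 \<le> n \<longrightarrow>
      (let q = SNR n (d n) (mu n);
           G = (\<lambda>z. hollow (gram (d n) (data_mat (y n) (mu n) z)));
           ubar = (\<lambda>i. y n i / sqrt (real n));
           lbar = real n * sqnorm (d n) (mu n)
       in \<exists>A \<in> sets (noise_space n (d n)).
            A \<subseteq> {z \<in> space (noise_space n (d n)).
                   (MIN s\<in>{-1, 1::real}. lq_norm q n
                      (\<lambda>i. s * u1 n z i - mat_vec n (G z) ubar i / lbar))
                   < 60000000000 / sqrt (SNR n (d n) (mu n)) * lq_norm q n ubar}
          \<and> measure (noise_space n (d n)) A > 1 - C * exp (- q))"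
    unfolding Let_def
  \<comment> \<open>\<open>Suc N\<close> makes the threshold positive.\<close>
  proof (intro exI[of _ "5 :: real"] exI[of _ "Suc N"] conjI allI impI)
    fix n assume "Suc N \<le> n" "2 \<le> n"
    then have "N \<le> n" "2 \<le> n" by simp_all
    from event[OF this] show "\<exists>A\<in>sets (noise_space n (d n)). A \<subseteq> {z \<in> space (noise_space n (d n)).
        (MIN s\<in>{-1, 1::real}. lq_norm (SNR n (d n) (mu n)) n
          (\<lambda>i. s * u1 n z i - mat_vec n (hollow (gram (d n) (data_mat (y n) (mu n) z))) (\<lambda>i. y n i / sqrt (real n)) i
             / (real n * sqnorm (d n) (mu n))))
        < 60000000000 / sqrt (SNR n (d n) (mu n)) * lq_norm (SNR n (d n) (mu n)) n (\<lambda>i. y n i / sqrt (real n))}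
      \<and> measure (noise_space n (d n)) A > 1 - 5 * exp (- SNR n (d n) (mu n))" .
  qed simp_all
qed

end
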